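(* Let $n,k$ be integers with $1\leq k\leq n-3$ and let $G\in\mathfrak{C}'_{n,k}(k)$. Then $F(G)\geq F(L_{n,n-k})$. Moreover, if $n\neq 2k+1$, equality holds if and only if $G\cong L_{n,n-k}$, and if $n=2k+1$, equality holds if and only if $G\in\{L_{2k+1,k+1},\,Q_{2k+1,k}\}$.
   Context: All graphs are simple, finite, undirected and connected. $F(G)$ is the number of connected subgraphs of $G$ (nonempty connected subgraphs consisting of a vertex subset and a subset of edges among them; distinct subgraphs counted separately). $\mathfrak{C}_{n,k}$ is the family of connected graphs on $n$ vertices with exactly $k$ cut vertices; $\mathfrak{C}_{n,k}(g)$ is the subfamily of graphs with girth at least $g$ (trees have infinite girth), and $\mathfrak{C}'_{n,k}(g)$ is the set of non-tree graphs in $\mathfrak{C}_{n,k}(g)$. $L_{n,n-k}$ is obtained by identifying an end vertex of the path $P_{k+1}$ with a vertex of the cycle $C_{n-k}$. The path-star tree $P_{m,r}$ is obtained by identifying one end vertex of the path $P_m$ with the center of the star $K_{1,r}$; its path-part pendant vertex is the other end of $P_m$. $Q_{n,k}$ is the graph obtained by identifying a vertex of the cycle $C_{n-k-1}$ with the path-part pendant vertex of $P_{k,2}$. *)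

theory Defs
  imports "Graph_Theory.Graph_Theory" "HOL-Library.Extended_Nat"
begin

text \<open>
  A finite simple undirected graph is a \<^locale>\<open>pair_graph\<close>: a finite, loop-free digraph
  with a symmetric arc relation, an edge \<open>{u, v}\<close> being the pair of arcs \<open>(u, v)\<close>, \<open>(v, u)\<close>.
  Isomorphism is the library's \<^const>\<open>digraph_iso\<close>.
\<close>

text \<open>
  Requiring \<^term>\<open>pair_graph H\<close> makes the arc set of \<open>H\<close> symmetric, so that each \<open>H\<close> is a vertex
  subset with a subset of the edges; the library's \<^const>\<open>connected\<close> excludes the empty graph.
\<close>

definition num_connected_subgraphs :: "'a pair_pre_digraph \<Rightarrow> nat" where
  "num_connected_subgraphs G =
     card {H :: 'a pair_pre_digraph.
       pair_graph H \<and> subgraph (with_proj H) (with_proj G) \<and> connected (with_proj H)}"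

text \<open>
  Meant for connected \<open>G\<close>. The condition \<^term>\<open>pverts G \<noteq> {v}\<close> keeps the vertex of the
  one-vertex graph from being a cut vertex, as \<^const>\<open>connected\<close> is false for the empty graph.
\<close>

definition cut_vertex :: "'a pair_pre_digraph \<Rightarrow> 'a \<Rightarrow> bool" where
  "cut_vertex G v \<longleftrightarrow>
     v \<in> pverts G \<and> pverts G \<noteq> {v} \<and> \<not> connected (pre_digraph.del_vert (with_proj G) v)"

text \<open>
  In a symmetric digraph the walk \<open>u, v, u\<close> along a single edge is a \<^const>\<open>pre_digraph.cycle\<close>,
  hence the length condition. For the same reason the library's \<^const>\<open>tree\<close> cannot be used.
\<close>

definition graph_cycle :: "'a pair_pre_digraph \<Rightarrow> ('a \<times> 'a) list \<Rightarrow> bool" where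
  "graph_cycle G p \<longleftrightarrow> pre_digraph.cycle (with_proj G) p \<and> 3 \<le> length p"

definition girth :: "'a pair_pre_digraph \<Rightarrow> enat" where
  "girth G = (INF p \<in> {p. graph_cycle G p}. enat (length p))"

definition graph_tree :: "'a pair_pre_digraph \<Rightarrow> bool" where
  "graph_tree G \<longleftrightarrow> connected (with_proj G) \<and> (\<nexists>p. graph_cycle G p)"

definition cut_family :: "nat \<Rightarrow> nat \<Rightarrow> 'a pair_pre_digraph set" where
  "cut_family n k = {G. pair_graph G \<and> connected (with_proj G) \<and>
     card (pverts G) = n \<and> card {v. cut_vertex G v} = k}"

definition cut_family_girth :: "nat \<Rightarrow> nat \<Rightarrow> nat \<Rightarrow> 'a pair_pre_digraph set" where
  "cut_family_girth n k g = {G \<in> cut_family n k. enat g \<le> girth G}"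

definition cut_family_girth_nontree :: "nat \<Rightarrow> nat \<Rightarrow> nat \<Rightarrow> 'a pair_pre_digraph set" where
  "cut_family_girth_nontree n k g = {G \<in> cut_family_girth n k g. \<not> graph_tree G}"

text \<open>
  The disjoint union of \<open>G\<close> and \<open>H\<close> with the vertex \<open>v\<close> of \<open>H\<close> identified with the vertex \<open>u\<close>
  of \<open>G\<close>; the merged vertex is \<^term>\<open>Inl u\<close>.
\<close>

definition identify_verts ::
  "'a pair_pre_digraph \<Rightarrow> 'a \<Rightarrow> 'b pair_pre_digraph \<Rightarrow> 'b \<Rightarrow> ('a + 'b) pair_pre_digraph" where
  "identify_verts G u H v =
     (let f = (\<lambda>x. if x = v then Inl u else Inr x) in
      \<lparr>pverts = Inl ` pverts G \<union> f ` pverts H,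
       parcs = map_prod Inl Inl ` parcs G \<union> map_prod f f ` parcs H\<rparr>)"

definition path_graph :: "nat \<Rightarrow> nat pair_pre_digraph" where
  "path_graph m =
     \<lparr>pverts = {..<m}, parcs = {(i, j). i < m \<and> j < m \<and> (j = i + 1 \<or> i = j + 1)}\<rparr>"

text \<open>Meant for \<open>m \<ge> 3\<close>; the value at \<open>2\<close> is a single edge.\<close>

definition cycle_graph :: "nat \<Rightarrow> nat pair_pre_digraph" where
  "cycle_graph m =
     \<lparr>pverts = {..<m},
      parcs = {(i, j). i < m \<and> j < m \<and> (j = (i + 1) mod m \<or> i = (j + 1) mod m)}\<rparr>"

text \<open>\<open>K\<^bsub>1,r\<^esub>\<close> with center \<open>0\<close>.\<close>

definition star_graph :: "nat \<Rightarrow> nat pair_pre_digraph" where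
  "star_graph r =
     \<lparr>pverts = {..r}, parcs = {(i, j). i \<le> r \<and> j \<le> r \<and> (i = 0) \<noteq> (j = 0)}\<rparr>"

text \<open>\<open>L\<^bsub>n,g\<^esub>\<close>, where \<open>g\<close> is the length of the cycle.\<close>

definition L_graph :: "nat \<Rightarrow> nat \<Rightarrow> (nat + nat) pair_pre_digraph" where
  "L_graph n g = identify_verts (path_graph (n - g + 1)) 0 (cycle_graph g) 0"

text \<open>\<open>P\<^bsub>m,r\<^esub>\<close>, for \<open>m \<ge> 1\<close>; its path-part pendant vertex is \<^term>\<open>Inl (m - 1)\<close>.\<close>

definition path_star :: "nat \<Rightarrow> nat \<Rightarrow> (nat + nat) pair_pre_digraph" where
  "path_star m r = identify_verts (path_graph m) 0 (star_graph r) 0"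

definition Q_graph :: "nat \<Rightarrow> nat \<Rightarrow> (nat + (nat + nat)) pair_pre_digraph" where
  "Q_graph n k = identify_verts (cycle_graph (n - k - 1)) 0 (path_star k 2) (Inl (k - 1))"

end

theory Submission
  imports Defs
begin

text \<open>
  All counting is done in vertex sets \<open>W\<close> of one fixed edge set \<open>E\<close>. Gluing two graphs at a vertex \<open>v\<close>
  multiplies the numbers of connected subgraphs through \<open>v\<close>, and a block with \<open>b \<ge> 3\<close> vertices has at
  least \<open>b (b + 1) / 2 + 1\<close> connected subgraphs through each vertex: an st-numbering provides the
  \<open>b (b - 1) / 2\<close> proper ones (a prefix together with a suffix), and deleting at most one edge provides
  \<open>b + 1\<close> spanning ones. Removing end blocks one at a time then yields, for a root \<open>w\<close> and with \<open>J\<close> cut and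
  \<open>P\<close> non-cut vertices other than \<open>w\<close>, at least \<open>J + P (P + 1) / 2 + 1\<close> connected subgraphs through \<open>w\<close>,
  and \<open>P + 1\<close> more if the graph has a cycle.

  The theorem follows by induction on the number of vertices. If removing a leaf at \<open>v\<close> lowers the number
  of cut vertices, the rooted bound at \<open>v\<close> is exactly what is needed. If it does not, the graph is glued at
  \<open>v\<close> from two parts; the girth bounds the number of cut vertices by the number of non-cut vertices of the
  part with a cycle, and equality leaves only the second leaf of \<open>Q\<close>. If there is no leaf, removing an end
  block leaves a graph with a cycle, and the bound is strict.
\<close>

text \<open>The rooted bound separates cut from non-cut vertices because the extremal count depends
  on \<open>n\<close> and \<open>k\<close> alone: a cut vertex is worth one rooted subgraph, a
  non-cut vertex linearly many, and removing an end block can change the status of its attachment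
  vertex only. The surplus \<open>P + 1\<close> for a cycle makes the bound exact for a lollipop
  rooted at the end of its tail, so no slack is lost while the tail grows and equality can be traced
  back step by step. The girth enters only as a lower bound on the sizes of two-connected vertex
  sets. In this form the assumption passes to vertex subsets, since the edge set stays fixed.
  Equality is tracked by explicit labellings, which extend vertex by vertex; digraph isomorphisms
  appear only at the end. The second extremal graph has a cycle of length exactly \<open>k\<close>,
  so a further cut vertex would violate the girth assumption and it cannot carry a longer tail.
  Bounds are mostly doubled to stay within the natural numbers.\<close>

section \<open>Connectedness and gluing\<close>

text \<open>Connectedness by cuts instead of walks: every proper nonempty part sends an edge to its
  complement. Only edges with both ends in \<open>W\<close> matter, so one edge set \<open>E\<close>
  serves all vertex sets.\<close>

definition conn :: "'a set set \<Rightarrow> 'a set \<Rightarrow> bool" where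
  "conn E W \<longleftrightarrow> W \<noteq> {} \<and>
     (\<forall>A. A \<subseteq> W \<longrightarrow> A \<noteq> {} \<longrightarrow> A \<noteq> W \<longrightarrow> (\<exists>a\<in>A. \<exists>b\<in>W - A. {a, b} \<in> E))"

definition glued :: "'a set set \<Rightarrow> 'a set \<Rightarrow> 'a set \<Rightarrow> 'a \<Rightarrow> bool" where
  "glued E A B v \<longleftrightarrow> A \<inter> B = {v} \<and> (\<forall>a\<in>A - {v}. \<forall>b\<in>B - {v}. {a, b} \<notin> E)"

lemma conn_nonempty: "conn E W \<Longrightarrow> W \<noteq> {}"
  by (simp add: conn_def)

lemma conn_crossing:
  assumes "conn E W" "A \<subseteq> W" "A \<noteq> {}" "A \<noteq> W"
  obtains a b where "a \<in> A" "b \<in> W - A" "{a, b} \<in> E"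
  using assms unfolding conn_def by blast

lemma connI:
  assumes "W \<noteq> {}"
    and "\<And>A. A \<subseteq> W \<Longrightarrow> A \<noteq> {} \<Longrightarrow> A \<noteq> W \<Longrightarrow> \<exists>a\<in>A. \<exists>b\<in>W - A. {a, b} \<in> E"
  shows "conn E W"
  using assms unfolding conn_def by blast

lemma conn_singleton [simp]: "conn E {x}"
  by (rule connI) auto

lemma conn_mono: "conn D W \<Longrightarrow> D \<subseteq> E \<Longrightarrow> conn E W"
  unfolding conn_def by (meson subsetD)

lemma conn_cong:
  assumes "\<And>a b. a \<in> W \<Longrightarrow> b \<in> W \<Longrightarrow> {a, b} \<in> D \<longleftrightarrow> {a, b} \<in> E"
  shows "conn D W \<longleftrightarrow> conn E W"
proof -
  have "(\<exists>a\<in>A. \<exists>b\<in>W - A. {a, b} \<in> D) \<longleftrightarrow> (\<exists>a\<in>A. \<exists>b\<in>W - A. {a, b} \<in> E)" if "A \<subseteq> W" for A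
    using assms that by blast
  then show ?thesis unfolding conn_def by auto
qed

lemma conn_restrict: "W \<subseteq> A \<Longrightarrow> conn (E \<inter> Pow A) W \<longleftrightarrow> conn E W"
  by (rule conn_cong) auto

lemma conn_Un:
  assumes "conn E A" "conn E B" "A \<inter> B \<noteq> {}"
  shows "conn E (A \<union> B)"
proof (rule connI)
  show "A \<union> B \<noteq> {}" using assms by auto
next
  fix X assume X: "X \<subseteq> A \<union> B" "X \<noteq> {}" "X \<noteq> A \<union> B"
  show "\<exists>a\<in>X. \<exists>b\<in>A \<union> B - X. {a, b} \<in> E"
  proof (cases "X \<inter> A \<noteq> {} \<and> \<not> A \<subseteq> X")
    case True
    then obtain a b where "a \<in> X \<inter> A" "b \<in> A - X \<inter> A" "{a, b} \<in> E"
      using conn_crossing[OF assms(1), of "X \<inter> A"] by blast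
    then show ?thesis by blast
  next
    case False
    have "X \<inter> B \<noteq> {} \<and> \<not> B \<subseteq> X" using False X assms(3) by blast
    then obtain a b where "a \<in> X \<inter> B" "b \<in> B - X \<inter> B" "{a, b} \<in> E"
      using conn_crossing[OF assms(2), of "X \<inter> B"] by blast
    then show ?thesis by blast
  qed
qed

lemma conn_edge:
  assumes "{a, b} \<in> E"
  shows "conn E {a, b}"
proof (rule connI)
  fix A assume "A \<subseteq> {a, b}" "A \<noteq> {}" "A \<noteq> {a, b}"
  then have "a \<noteq> b" "A = {a} \<or> A = {b}" by blast+
  then show "\<exists>x\<in>A. \<exists>y\<in>{a, b} - A. {x, y} \<in> E"
    using assms by (auto simp: insert_commute)
qed simp

lemma conn_Un_edge:
  assumes "conn E A" "conn E B" "a \<in> A" "b \<in> B" "{a, b} \<in> E"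
  shows "conn E (A \<union> B)"
proof -
  have "conn E (A \<union> {a, b})"
    by (rule conn_Un[OF assms(1) conn_edge[OF assms(5)]]) (use assms in auto)
  then have "conn E ((A \<union> {a, b}) \<union> B)"
    by (rule conn_Un[OF _ assms(2)]) (use assms in auto)
  moreover have "(A \<union> {a, b}) \<union> B = A \<union> B" using assms by auto
  ultimately show ?thesis by simp
qed

lemma conn_insert:
  assumes "conn E A" "a \<in> A" "{a, x} \<in> E"
  shows "conn E (insert x A)"
  using conn_Un_edge[OF assms(1) conn_singleton assms(2) _ assms(3)] by simp

text \<open>The union of all connected subsets of \<open>U\<close> through \<open>x\<close> works:
  the far end of an edge leaving it could be added.\<close>

lemma conn_component:
  assumes "x \<in> U"
  obtains C where "C \<subseteq> U" "x \<in> C" "conn E C" "\<And>a b. a \<in> C \<Longrightarrow> b \<in> U - C \<Longrightarrow> {a, b} \<notin> E"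
proof -
  let ?F = "{C. C \<subseteq> U \<and> x \<in> C \<and> conn E C}"
  have "conn E (\<Union>?F)"
  proof (rule connI)
    show "\<Union>?F \<noteq> {}" using assms by (auto intro!: exI[of _ "{x}"])
    fix A assume A: "A \<subseteq> \<Union>?F" "A \<noteq> {}" "A \<noteq> \<Union>?F"
    obtain C where C: "C \<in> ?F" "C \<inter> A \<noteq> {}" "\<not> C \<subseteq> A"
    proof (cases "x \<in> A")
      case True
      obtain y where "y \<in> \<Union>?F" "y \<notin> A" using A by blast
      then obtain C where "C \<in> ?F" "y \<in> C" by blast
      then show ?thesis using True \<open>y \<notin> A\<close> by (intro that[of C]) auto
    next
      case False
      obtain y where "y \<in> A" using A by blast
      then obtain C where "C \<in> ?F" "y \<in> C" using A by blast
      then show ?thesis using False \<open>y \<in> A\<close> by (intro that[of C]) auto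
    qed
    then obtain a b where "a \<in> C \<inter> A" "b \<in> C - C \<inter> A" "{a, b} \<in> E"
      using conn_crossing[of E C "C \<inter> A"] by blast
    then show "\<exists>a\<in>A. \<exists>b\<in>\<Union>?F - A. {a, b} \<in> E" using C by blast
  qed
  moreover have "\<Union>?F \<subseteq> U" by blast
  moreover have "x \<in> \<Union>?F" using assms by (auto intro!: exI[of _ "{x}"])
  moreover have "{a, b} \<notin> E" if "a \<in> \<Union>?F" "b \<in> U - \<Union>?F" for a b
  proof
    assume "{a, b} \<in> E"
    then have "conn E (insert b (\<Union>?F))" using calculation that by (intro conn_insert[of _ _ a]) auto
    then have "insert b (\<Union>?F) \<in> ?F" using calculation that by auto
    then show False using that by blast
  qed
  ultimately show ?thesis by (intro that[of "\<Union>?F"]) auto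
qed

lemma glued_commute: "glued E A B v \<Longrightarrow> glued E B A v"
  unfolding glued_def by (metis Int_commute insert_commute)

lemma glued_mono: "glued E A B v \<Longrightarrow> D \<subseteq> E \<Longrightarrow> A' \<subseteq> A \<Longrightarrow> B' \<subseteq> B \<Longrightarrow> v \<in> A' \<Longrightarrow> v \<in> B' \<Longrightarrow> glued D A' B' v"
  unfolding glued_def by blast

lemma glued_mem: "glued E A B v \<Longrightarrow> v \<in> A" "glued E A B v \<Longrightarrow> v \<in> B"
  unfolding glued_def by auto

text \<open>A cut \<open>X\<close> of \<open>A\<close> becomes a cut of \<open>A \<union> B\<close>
  by adding all of \<open>B\<close> if it contains \<open>v\<close>, and as it stands otherwise. An
  edge across the new cut cannot join the two sides away from \<open>v\<close>, so it lies in
  \<open>A\<close>.\<close>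

lemma glued_conn_left:
  assumes "glued E A B v" "conn E (A \<union> B)"
  shows "conn E A"
proof (rule connI)
  have AB: "A \<inter> B = {v}" using assms(1) by (simp add: glued_def)
  then show "A \<noteq> {}" by auto
  fix X assume X: "X \<subseteq> A" "X \<noteq> {}" "X \<noteq> A"
  show "\<exists>a\<in>X. \<exists>b\<in>A - X. {a, b} \<in> E"
  proof (cases "v \<in> X")
    case True
    obtain y where y: "y \<in> A" "y \<notin> X" using X by blast
    then have "y \<notin> B" using True AB by auto
    then have ne: "X \<union> B \<noteq> A \<union> B" using y by blast
    obtain a b where ab: "a \<in> X \<union> B" "b \<in> (A \<union> B) - (X \<union> B)" "{a, b} \<in> E"
      by (rule conn_crossing[OF assms(2) _ _ ne]) (use X in auto)
    have "a \<in> X"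
    proof (rule ccontr)
      assume "a \<notin> X"
      then have "a \<in> B - {v}" "b \<in> A - {v}" using ab True AB by auto
      then show False using glued_commute[OF assms(1)] ab(3) by (simp add: glued_def)
    qed
    then show ?thesis using ab by blast
  next
    case False
    then have ne: "X \<noteq> A \<union> B" using AB by auto
    obtain a b where ab: "a \<in> X" "b \<in> (A \<union> B) - X" "{a, b} \<in> E"
      by (rule conn_crossing[OF assms(2) _ _ ne]) (use X in auto)
    have "b \<in> A"
    proof (rule ccontr)
      assume "b \<notin> A"
      then have "a \<in> A - {v}" "b \<in> B - {v}" using ab X False AB by auto
      then show False using assms(1) ab(3) by (simp add: glued_def)
    qed
    then show ?thesis using ab by blast
  qed
qed

lemma glued_conn_iff:
  assumes "glued E A B v"
  shows "conn E (A \<union> B) \<longleftrightarrow> conn E A \<and> conn E B"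
proof
  assume "conn E (A \<union> B)"
  then show "conn E A \<and> conn E B"
    using glued_conn_left[OF assms] glued_conn_left[OF glued_commute[OF assms]] by (simp add: Un_commute)
next
  assume "conn E A \<and> conn E B"
  then show "conn E (A \<union> B)" using assms by (intro conn_Un) (auto simp: glued_def)
qed

lemma glued_conn_avoiding:
  assumes "glued E A B v" "conn E U" "U \<subseteq> A \<union> B" "v \<notin> U"
  shows "U \<subseteq> A - {v} \<or> U \<subseteq> B - {v}"
proof (rule ccontr)
  assume "\<not> ?thesis"
  then have "U \<inter> A \<noteq> {}" "U \<inter> A \<noteq> U" using assms by blast+
  then obtain a b where "a \<in> U \<inter> A" "b \<in> U - U \<inter> A" "{a, b} \<in> E"
    using conn_crossing[OF assms(2), of "U \<inter> A"] by blast
  then show False using assms unfolding glued_def by blast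
qed

text \<open>A largest connected proper subset through \<open>v\<close> can be extended by one
  vertex, and maximality makes the extension all of \<open>W\<close>.\<close>

lemma conn_remove_vertex:
  assumes "finite W" "conn E W" "v \<in> W" "W \<noteq> {v}"
  obtains x where "x \<in> W" "x \<noteq> v" "conn E (W - {x})"
proof -
  let ?P = "\<lambda>C. C \<subset> W \<and> v \<in> C \<and> conn E C"
  have "?P {v}" using assms by auto
  moreover have "\<forall>C. ?P C \<longrightarrow> card C < Suc (card W)"
    using assms(1) by (meson card_mono less_Suc_eq_le psubset_imp_subset)
  ultimately obtain C where C: "?P C" "\<And>C'. ?P C' \<Longrightarrow> card C' \<le> card C"
    using ex_has_greatest_nat[of ?P "{v}" card "Suc (card W)"] by (metis order_less_imp_le)
  obtain a x where x: "a \<in> C" "x \<in> W - C" "{a, x} \<in> E"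
    using conn_crossing[OF assms(2), of C] C by blast
  have "conn E (insert x C)" using C x by (intro conn_insert[of _ _ a]) auto
  moreover have "card (insert x C) > card C"
    using C x assms(1) by (metis Diff_iff card_insert_disjoint finite_subset lessI psubset_imp_subset)
  ultimately have "insert x C = W" using C(1) C(2)[of "insert x C"] x by force
  then have "W - {x} = C" using x by auto
  then show ?thesis using that[of x] x C by auto
qed

section \<open>Counting connected subgraphs\<close>

text \<open>\<open>X\<close> holds the vertices that the subgraph is forced to contain:
  \<open>{}\<close> gives the total count, \<open>{v}\<close> the count rooted at \<open>v\<close>,
  and two vertices occur when a root lies away from the gluing point.\<close>

definition conn_subgraphs :: "'a set set \<Rightarrow> 'a set \<Rightarrow> 'a set \<Rightarrow> ('a set \<times> 'a set set) set" where
  "conn_subgraphs E W X = {(U, D). X \<subseteq> U \<and> U \<subseteq> W \<and> D \<subseteq> E \<inter> Pow U \<and> conn D U}"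

definition ncs :: "'a set set \<Rightarrow> 'a set \<Rightarrow> 'a set \<Rightarrow> nat" where
  "ncs E W X = card (conn_subgraphs E W X)"

lemma finite_conn_subgraphs [simp]: "finite W \<Longrightarrow> finite (conn_subgraphs E W X)"
  by (rule finite_subset[of _ "Pow W \<times> Pow (Pow W)"]) (force simp: conn_subgraphs_def)+

lemma ncs_split:
  assumes "finite W" "v \<notin> X"
  shows "ncs E W X = ncs E (W - {v}) X + ncs E W (insert v X)"
proof -
  have "conn_subgraphs E W X = conn_subgraphs E (W - {v}) X \<union> conn_subgraphs E W (insert v X)"
    using assms(2) by (auto simp: conn_subgraphs_def)
  moreover have "conn_subgraphs E (W - {v}) X \<inter> conn_subgraphs E W (insert v X) = {}"
    by (auto simp: conn_subgraphs_def)
  ultimately show ?thesis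
    using assms by (simp add: ncs_def card_Un_disjoint)
qed

locale edges =
  fixes E :: "'a set set"
  assumes edge_card: "e \<in> E \<Longrightarrow> card e = 2"
begin

lemma no_loop: "{x, x} \<notin> E" "{x} \<notin> E"
  using edge_card[of "{x}"] by auto

lemma subset_singleton_edges:
  assumes "D \<subseteq> E" "D \<subseteq> Pow {v}"
  shows "D = {}"
proof -
  have "card e \<noteq> 2" if "e \<subseteq> {v}" for e using that by (auto simp: subset_singleton_iff)
  then show ?thesis using assms edge_card by blast
qed

lemma ncs_singleton: "X \<subseteq> {v} \<Longrightarrow> ncs E {v} X = 1"
proof -
  assume X: "X \<subseteq> {v}"
  have "conn_subgraphs E {v} X = {({v}, {})}"
  proof
    show "conn_subgraphs E {v} X \<subseteq> {({v}, {})}"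
    proof (rule subrelI)
      fix U D assume "(U, D) \<in> conn_subgraphs E {v} X"
      then have *: "U \<subseteq> {v}" "D \<subseteq> E" "D \<subseteq> Pow U" "conn D U" by (auto simp: conn_subgraphs_def)
      then have "U = {v}" using conn_nonempty by blast
      then show "(U, D) \<in> {({v}, {})}" using * subset_singleton_edges[of D v] by simp
    qed
    show "{({v}, {})} \<subseteq> conn_subgraphs E {v} X" using X by (simp add: conn_subgraphs_def)
  qed
  then show ?thesis by (simp add: ncs_def)
qed

lemma glued_edges:
  assumes "glued E A B v" "D \<subseteq> E" "D \<subseteq> Pow (A \<union> B)"
  shows "D = (D \<inter> Pow A) \<union> (D \<inter> Pow B)"
proof -
  have "e \<subseteq> A \<or> e \<subseteq> B" if "e \<in> D" for e
  proof -
    have "e \<in> E" using that assms(2) by auto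
    then obtain x y where e: "e = {x, y}" using edge_card[of e] by (auto simp: card_2_iff)
    have "x \<in> A \<union> B" "y \<in> A \<union> B" using e that assms(3) by auto
    moreover have "{x, y} \<in> E" "{y, x} \<in> E" using e that assms(2) by (auto simp: insert_commute)
    ultimately show ?thesis using assms(1) e unfolding glued_def by (cases "x = v"; cases "y = v") auto
  qed
  then show ?thesis by blast
qed

text \<open>A connected subgraph through \<open>v\<close> is cut at \<open>v\<close> into its traces
  on \<open>A\<close> and \<open>B\<close>, both connected by \<open>glued_conn_iff\<close>. Nothing
  is counted twice: an edge inside both sides would lie in \<open>{v}\<close>, and there are no
  loops.\<close>

lemma ncs_glued:
  assumes g: "glued E A B v" and X: "X \<subseteq> A" "v \<in> X" and Y: "Y \<subseteq> B" "v \<in> Y"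
  shows "ncs E (A \<union> B) (X \<union> Y) = ncs E A X * ncs E B Y"
proof -
  let ?f = "\<lambda>(U, D). ((U \<inter> A, D \<inter> Pow A), (U \<inter> B, D \<inter> Pow B))"
  let ?g = "\<lambda>((U, D), (U', D')). (U \<union> U', D \<union> D')"
  have AB: "A \<inter> B = {v}" using g by (simp add: glued_def)
  have "bij_betw ?f (conn_subgraphs E (A \<union> B) (X \<union> Y)) (conn_subgraphs E A X \<times> conn_subgraphs E B Y)"
  proof (rule bij_betw_byWitness[where f' = ?g])
    show "\<forall>a\<in>conn_subgraphs E (A \<union> B) (X \<union> Y). ?g (?f a) = a"
    proof (clarsimp simp: conn_subgraphs_def)
      fix U D assume *: "U \<subseteq> A \<union> B" "D \<subseteq> E" "D \<subseteq> Pow U"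
      then have "D = (D \<inter> Pow A) \<union> (D \<inter> Pow B)" by (intro glued_edges[OF g]) auto
      then show "U \<inter> A \<union> U \<inter> B = U \<and> D \<inter> Pow A \<union> D \<inter> Pow B = D" using * by blast
    qed
    show "\<forall>a'\<in>conn_subgraphs E A X \<times> conn_subgraphs E B Y. ?f (?g a') = a'"
    proof (clarsimp simp: conn_subgraphs_def)
      fix U D U' D'
      assume *: "X \<subseteq> U" "U \<subseteq> A" "D \<subseteq> E" "D \<subseteq> Pow U" "Y \<subseteq> U'" "U' \<subseteq> B" "D' \<subseteq> E" "D' \<subseteq> Pow U'"
      have DA: "D \<subseteq> Pow A" "D' \<subseteq> Pow B" using * Pow_mono[of U A] Pow_mono[of U' B] by auto
      have "D \<inter> Pow B \<subseteq> Pow (A \<inter> B)" "D' \<inter> Pow A \<subseteq> Pow (A \<inter> B)" using DA by auto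
      then have "D \<inter> Pow B = {}" "D' \<inter> Pow A = {}"
        using * AB by (auto intro!: subset_singleton_edges[of _ v])
      then have "(D \<union> D') \<inter> Pow A = D" "(D \<union> D') \<inter> Pow B = D'" using DA by auto
      moreover have "U' \<inter> A = {v}" "U \<inter> B = {v}" "v \<in> U" "v \<in> U'" using * X Y AB by auto
      then have "(U \<union> U') \<inter> A = U" "(U \<union> U') \<inter> B = U'" using * by auto
      ultimately show "(U \<union> U') \<inter> A = U \<and> (D \<union> D') \<inter> Pow A = D \<and> (U \<union> U') \<inter> B = U' \<and> (D \<union> D') \<inter> Pow B = D'"
        by simp
    qed
    show "?f ` conn_subgraphs E (A \<union> B) (X \<union> Y) \<subseteq> conn_subgraphs E A X \<times> conn_subgraphs E B Y"
    proof (rule image_subsetI)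
      fix p assume p: "p \<in> conn_subgraphs E (A \<union> B) (X \<union> Y)"
      obtain U D where UD: "p = (U, D)" by (cases p)
      have *: "X \<subseteq> U" "Y \<subseteq> U" "U \<subseteq> A \<union> B" "D \<subseteq> E" "D \<subseteq> Pow U" "conn D U"
        using p UD by (auto simp: conn_subgraphs_def)
      have gD: "glued D (U \<inter> A) (U \<inter> B) v" by (rule glued_mono[OF g]) (use * X Y in auto)
      have "(U \<inter> A) \<union> (U \<inter> B) = U" using * by blast
      then have "conn D (U \<inter> A)" "conn D (U \<inter> B)" using glued_conn_iff[OF gD] *(6) by simp_all
      then have "conn (D \<inter> Pow A) (U \<inter> A)" "conn (D \<inter> Pow B) (U \<inter> B)" by (simp_all add: conn_restrict)
      then show "?f p \<in> conn_subgraphs E A X \<times> conn_subgraphs E B Y"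
        using * X Y by (auto simp: UD conn_subgraphs_def)
    qed
    show "?g ` (conn_subgraphs E A X \<times> conn_subgraphs E B Y) \<subseteq> conn_subgraphs E (A \<union> B) (X \<union> Y)"
    proof (rule image_subsetI)
      fix p assume p: "p \<in> conn_subgraphs E A X \<times> conn_subgraphs E B Y"
      obtain U D U' D' where UD: "p = ((U, D), (U', D'))" by (metis surj_pair)
      have *: "X \<subseteq> U" "U \<subseteq> A" "D \<subseteq> E" "D \<subseteq> Pow U" "conn D U"
        "Y \<subseteq> U'" "U' \<subseteq> B" "D' \<subseteq> E" "D' \<subseteq> Pow U'" "conn D' U'"
        using p UD by (auto simp: conn_subgraphs_def)
      have "conn (D \<union> D') (U \<union> U')"
      proof (rule conn_Un)
        show "conn (D \<union> D') U" by (rule conn_mono[OF *(5)]) simp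
        show "conn (D \<union> D') U'" by (rule conn_mono[OF *(10)]) simp
        show "U \<inter> U' \<noteq> {}" using * X Y by auto
      qed
      then show "?g p \<in> conn_subgraphs E (A \<union> B) (X \<union> Y)"
        using * by (auto simp: UD conn_subgraphs_def)
    qed
  qed
  then show ?thesis
    unfolding ncs_def by (simp add: bij_betw_same_card flip: card_cartesian_product)
qed

lemma ncs_glued_avoiding:
  assumes g: "glued E A B v" and fin: "finite A" "finite B"
  shows "ncs E (A \<union> B - {v}) {} = ncs E (A - {v}) {} + ncs E (B - {v}) {}"
    and "w \<in> A \<Longrightarrow> w \<noteq> v \<Longrightarrow> ncs E (A \<union> B - {v}) {w} = ncs E (A - {v}) {w}"
proof -
  have AB: "A \<inter> B = {v}" using g by (simp add: glued_def)
  have *: "U \<subseteq> A - {v} \<or> U \<subseteq> B - {v}" if "(U, D) \<in> conn_subgraphs E (A \<union> B - {v}) X" for U D X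
    using that glued_conn_avoiding[OF g conn_mono] by (auto simp: conn_subgraphs_def)
  have "conn_subgraphs E (A \<union> B - {v}) {} = conn_subgraphs E (A - {v}) {} \<union> conn_subgraphs E (B - {v}) {}" (is "?L = ?R")
  proof
    show "?L \<subseteq> ?R"
    proof (rule subrelI)
      fix U D assume a: "(U, D) \<in> ?L"
      from *[OF a] show "(U, D) \<in> ?R" using a by (auto simp: conn_subgraphs_def)
    qed
    show "?R \<subseteq> ?L" by (auto simp: conn_subgraphs_def)
  qed
  moreover have "conn_subgraphs E (A - {v}) {} \<inter> conn_subgraphs E (B - {v}) {} = {}"
  proof -
    have False if "(U, D) \<in> conn_subgraphs E (A - {v}) {}" "(U, D) \<in> conn_subgraphs E (B - {v}) {}" for U D
      using that AB conn_nonempty[of D U] by (auto simp: conn_subgraphs_def)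
    then show ?thesis by auto
  qed
  ultimately show "ncs E (A \<union> B - {v}) {} = ncs E (A - {v}) {} + ncs E (B - {v}) {}"
    using fin by (simp add: ncs_def card_Un_disjoint)
  assume w: "w \<in> A" "w \<noteq> v"
  have "conn_subgraphs E (A \<union> B - {v}) {w} = conn_subgraphs E (A - {v}) {w}" (is "?L = ?R")
  proof
    show "?L \<subseteq> ?R"
    proof (rule subrelI)
      fix U D assume a: "(U, D) \<in> ?L"
      then have "w \<in> U" by (auto simp: conn_subgraphs_def)
      with *[OF a] w AB have "U \<subseteq> A - {v}" by auto
      then show "(U, D) \<in> ?R" using a by (auto simp: conn_subgraphs_def)
    qed
    show "?R \<subseteq> ?L" by (auto simp: conn_subgraphs_def)
  qed
  then show "ncs E (A \<union> B - {v}) {w} = ncs E (A - {v}) {w}" by (simp add: ncs_def)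
qed

lemma ncs_glued_total:
  assumes g: "glued E A B v" and fin: "finite A" "finite B"
  shows "ncs E (A \<union> B) {} + ncs E A {v} = ncs E A {} + ncs E (B - {v}) {} + ncs E A {v} * ncs E B {v}"
  using ncs_split[of "A \<union> B" v "{}" E] ncs_split[of A v "{}" E] ncs_glued_avoiding(1)[OF assms]
    ncs_glued[OF g, of "{v}" "{v}"] glued_mem[OF g] fin by simp

lemma ncs_glued_containing:
  assumes g: "glued E A B v" and fin: "finite A" "finite B" and w: "w \<in> A" "w \<noteq> v"
  shows "ncs E (A \<union> B) {w} + ncs E A {v, w} = ncs E A {w} + ncs E A {v, w} * ncs E B {v}"
  using ncs_split[of "A \<union> B" v "{w}" E] ncs_split[of A v "{w}" E] ncs_glued_avoiding(2)[OF g fin w]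
    ncs_glued[OF g, of "{v, w}" "{v}"] glued_mem[OF g] fin w by (simp add: insert_commute)

end

section \<open>Cut vertices and branches\<close>

definition cutv :: "'a set set \<Rightarrow> 'a set \<Rightarrow> 'a set" where
  "cutv E W = {u \<in> W. W \<noteq> {u} \<and> \<not> conn E (W - {u})}"

text \<open>\<open>K\<close> is a connected component of \<open>W - {v}\<close>. It may be all of
  \<open>W - {v}\<close>, in which case \<open>v\<close> is not a cut vertex.\<close>

definition branch :: "'a set set \<Rightarrow> 'a set \<Rightarrow> 'a \<Rightarrow> 'a set \<Rightarrow> bool" where
  "branch E W v K \<longleftrightarrow> v \<in> W - K \<and> K \<subseteq> W \<and> conn E K \<and> (\<forall>a\<in>K. \<forall>b\<in>W - K - {v}. {a, b} \<notin> E)"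

text \<open>Three vertices exclude single edges, which lie on no cycle. Maximality is not demanded,
  so these sets include all blocks with a cycle but also smaller two-connected sets, such as the
  vertex sets of cycles.\<close>

definition biconn :: "'a set set \<Rightarrow> 'a set \<Rightarrow> bool" where
  "biconn E S \<longleftrightarrow> 3 \<le> card S \<and> conn E S \<and> cutv E S = {}"

lemma cutv_subset: "cutv E W \<subseteq> W"
  by (auto simp: cutv_def)

lemma not_cutv_conn: "u \<in> W \<Longrightarrow> u \<notin> cutv E W \<Longrightarrow> W \<noteq> {u} \<Longrightarrow> conn E (W - {u})"
  by (auto simp: cutv_def)

lemma branch_nonempty: "branch E W v K \<Longrightarrow> K \<noteq> {}"
  by (auto simp: branch_def conn_def)

lemma branch_glued:
  assumes "branch E W v K"
  shows "glued E (W - K) (insert v K) v" "W = (W - K) \<union> insert v K"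
proof -
  have "{a, b} \<notin> E" if "a \<in> W - K - {v}" "b \<in> insert v K - {v}" for a b
  proof -
    have "{b, a} \<notin> E" using assms that by (auto simp: branch_def)
    then show ?thesis by (simp add: insert_commute)
  qed
  then show "glued E (W - K) (insert v K) v" using assms unfolding glued_def branch_def by auto
  show "W = (W - K) \<union> insert v K" using assms by (auto simp: branch_def)
qed

lemma branch_conn:
  assumes "branch E W v K" "conn E W"
  shows "conn E (W - K)" "conn E (insert v K)"
  using glued_conn_iff[OF branch_glued(1)[OF assms(1)]] branch_glued(2)[OF assms(1)] assms(2) by auto

lemma branch_exists:
  assumes "v \<in> W" "x \<in> W" "x \<noteq> v"
  obtains K where "branch E W v K" "x \<in> K"
proof -
  obtain C where "C \<subseteq> W - {v}" "x \<in> C" "conn E C" "\<And>a b. a \<in> C \<Longrightarrow> b \<in> W - {v} - C \<Longrightarrow> {a, b} \<notin> E"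
    using conn_component[of x "W - {v}" E] assms by blast
  then show ?thesis using assms by (intro that[of C]) (auto simp: branch_def)
qed

lemma cutv_branch:
  assumes "v \<in> cutv E W" "branch E W v K"
  shows "W \<noteq> insert v K"
proof
  assume "W = insert v K"
  then have "W - {v} = K" using assms by (auto simp: branch_def)
  then show False using assms by (auto simp: cutv_def branch_def)
qed

lemma branch_disjoint:
  assumes "branch E W v K" "branch E W v L" "K \<inter> L \<noteq> {}"
  shows "L \<subseteq> K"
proof (rule ccontr)
  assume "\<not> L \<subseteq> K"
  then have ne: "L \<inter> K \<noteq> L" by auto
  have "conn E L" using assms by (simp add: branch_def)
  then obtain a b where ab: "a \<in> L \<inter> K" "b \<in> L - L \<inter> K" "{a, b} \<in> E"
    by (rule conn_crossing[OF _ _ _ ne]) (use assms in auto)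
  then have "b \<in> W - K - {v}" using assms by (auto simp: branch_def)
  then show False using assms(1) ab by (auto simp: branch_def)
qed

text \<open>Deleting a vertex \<open>u \<noteq> v\<close> of \<open>A\<close> leaves a gluing at
  \<open>v\<close>, so its effect on connectedness is decided inside \<open>A\<close>. Only
  \<open>v\<close> itself can have a different status in \<open>A\<close> and in the whole.\<close>

lemma glued_cutv:
  assumes "glued E A B v" "conn E (A \<union> B)"
  shows "cutv E (A \<union> B) - B = cutv E A - {v}"
proof -
  have AB: "A \<inter> B = {v}" using assms(1) by (simp add: glued_def)
  have "u \<in> cutv E (A \<union> B) \<longleftrightarrow> u \<in> cutv E A" if u: "u \<in> A" "u \<noteq> v" for u
  proof -
    have "u \<notin> B" using u AB by auto
    then have eq: "A \<union> B - {u} = (A - {u}) \<union> B" by auto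
    have gu: "glued E (A - {u}) B v" by (rule glued_mono[OF assms(1)]) (use u AB in auto)
    have "conn E (A \<union> B - {u}) \<longleftrightarrow> conn E (A - {u})"
      unfolding eq glued_conn_iff[OF gu] using glued_conn_iff[OF assms(1)] assms(2) by simp
    moreover have "v \<in> A" using AB by auto
    ultimately show ?thesis using u by (auto simp: cutv_def)
  qed
  moreover have "x \<in> B \<and> x \<in> A \<longleftrightarrow> x = v" for x using AB by auto
  ultimately show ?thesis using cutv_subset by fastforce
qed

lemma glued_cut:
  assumes "glued E A B v" "A \<noteq> {v}" "B \<noteq> {v}"
  shows "v \<in> cutv E (A \<union> B)"
proof -
  have AB: "A \<inter> B = {v}" using assms(1) by (simp add: glued_def)
  obtain a where a: "a \<in> A" "a \<noteq> v" using assms AB by auto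
  obtain b where b: "b \<in> B" "b \<noteq> v" using assms AB by auto
  have n: "a \<notin> B" "b \<notin> A" using a b AB by auto
  have "\<not> conn E (A \<union> B - {v})"
  proof
    assume "conn E (A \<union> B - {v})"
    from glued_conn_avoiding[OF assms(1) this] show False using a b n by auto
  qed
  then show ?thesis using AB a by (auto simp: cutv_def)
qed

lemma branch_cut:
  assumes "branch E W v K" "W \<noteq> insert v K"
  shows "v \<in> cutv E W"
proof -
  have "W - K \<noteq> {v}" using assms by (auto simp: branch_def)
  moreover have "insert v K \<noteq> {v}" using branch_nonempty[OF assms(1)] assms by (auto simp: branch_def)
  ultimately show ?thesis using glued_cut[OF branch_glued(1)[OF assms(1)]] branch_glued(2)[OF assms(1)] by simp
qed

lemma branch_cutv:
  assumes "branch E W v K" "conn E W"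
  shows "cutv E W - insert v K = cutv E (W - K) - {v}" "cutv E W \<inter> K = cutv E (insert v K) - {v}"
proof -
  note g = branch_glued[OF assms(1)]
  show "cutv E W - insert v K = cutv E (W - K) - {v}"
    using glued_cutv[OF g(1)] g(2) assms(2) by simp
  have "cutv E W - (W - K) = cutv E (insert v K) - {v}"
    using glued_cutv[OF glued_commute[OF g(1)]] g(2) assms(2) by (simp add: Un_commute)
  moreover have "cutv E W - (W - K) = cutv E W \<inter> K" using cutv_subset[of E W] by auto
  ultimately show "cutv E W \<inter> K = cutv E (insert v K) - {v}" by simp
qed

text \<open>Descent on the size of the branch. A cut vertex \<open>u\<close> of
  \<open>insert v K\<close> differs from \<open>v\<close>, since deleting \<open>v\<close> leaves
  the connected set \<open>K\<close>. One branch at \<open>u\<close> misses \<open>v\<close>; it is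
  a smaller branch of all of \<open>W\<close>.\<close>

lemma end_branch:
  assumes "finite W" "conn E W" "branch E W v K"
  shows "\<exists>v' K'. branch E W v' K' \<and> K' \<subseteq> K \<and> v' \<in> insert v K \<and> cutv E (insert v' K') = {}"
  using assms(3)
proof (induction "card K" arbitrary: v K rule: less_induct)
  case less
  let ?H = "insert v K"
  have K: "v \<notin> K" "K \<subseteq> W" "conn E K" using less.prems by (auto simp: branch_def)
  show ?case
  proof (cases "cutv E ?H = {}")
    case True
    then show ?thesis using less.prems by blast
  next
    case False
    then obtain u where u: "u \<in> cutv E ?H" by blast
    have "?H - {v} = K" using K by auto
    then have "u \<noteq> v" using u K by (auto simp: cutv_def)
    then have uK: "u \<in> K" using u by (auto simp: cutv_def)
    obtain K1 where K1: "branch E ?H u K1" "v \<in> K1"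
      using branch_exists[of u ?H v E] uK \<open>u \<noteq> v\<close> by blast
    have "?H \<noteq> insert u K1" using cutv_branch u K1 by metis
    then obtain x where x: "x \<in> ?H" "x \<noteq> u" "x \<notin> K1" using K1 by (auto simp: branch_def)
    obtain K2 where K2: "branch E ?H u K2" "x \<in> K2"
      using branch_exists[of u ?H x E] uK x by blast
    have "v \<notin> K2" using branch_disjoint[OF K1(1) K2(1)] K1(2) K2(2) x by blast
    then have sub: "K2 \<subseteq> K" "u \<notin> K2" using K2(1) by (auto simp: branch_def)
    have "{a, b} \<notin> E" if "a \<in> K2" "b \<in> W - K2 - {u}" for a b
    proof (cases "b \<in> ?H")
      case True
      then show ?thesis using that K2(1) by (auto simp: branch_def)
    next
      case False
      then show ?thesis using that sub less.prems by (auto simp: branch_def)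
    qed
    then have br: "branch E W u K2" using K2(1) sub uK K by (auto simp: branch_def)
    have "card K2 < card K"
      using sub uK assms(1) K(2) by (intro psubset_card_mono) (auto intro: finite_subset)
    from less.hyps[OF this br] show ?thesis using sub uK by blast
  qed
qed

lemma branch_noncut:
  assumes "finite W" "conn E W" "branch E W v K"
  obtains x where "x \<in> K" "x \<notin> cutv E W"
proof -
  let ?H = "insert v K"
  have "v \<notin> K" "K \<subseteq> W" using assms by (auto simp: branch_def)
  obtain y where "y \<in> K" using branch_nonempty[OF assms(3)] by blast
  then have "?H \<noteq> {v}" using \<open>v \<notin> K\<close> by (metis insertCI singletonD)
  moreover have "finite ?H" using finite_subset[OF \<open>K \<subseteq> W\<close> assms(1)] by simp
  ultimately obtain x where x: "x \<in> ?H" "x \<noteq> v" "conn E (?H - {x})"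
    using conn_remove_vertex[of ?H E v] branch_conn(2)[OF assms(3,2)] by blast
  then have "x \<notin> cutv E ?H" by (simp add: cutv_def)
  then have "x \<notin> cutv E W" using branch_cutv(2)[OF assms(3,2)] x by auto
  then show ?thesis using x that by auto
qed

section \<open>Two-connected vertex sets inside a connected graph\<close>

lemma biconn_conn_remove: "biconn E S \<Longrightarrow> conn E (S - {u})"
  by (cases "u \<in> S") (auto simp: biconn_def intro!: not_cutv_conn)

lemma conn_neighbour:
  assumes "conn E W" "x \<in> W" "W \<noteq> {x}"
  obtains a where "a \<in> W" "a \<noteq> x" "{x, a} \<in> E"
proof -
  have ne: "{x} \<noteq> W" using assms by auto
  obtain a b where "a \<in> {x}" "b \<in> W - {x}" "{a, b} \<in> E"
    by (rule conn_crossing[OF assms(1) _ _ ne]) (use assms in auto)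
  then show ?thesis using that by auto
qed

lemma biconn_two_neighbours:
  assumes "biconn E S" "x \<in> S"
  obtains y z where "y \<in> S" "z \<in> S" "y \<noteq> z" "y \<noteq> x" "z \<noteq> x" "{x, y} \<in> E" "{x, z} \<in> E"
proof -
  have c: "3 \<le> card S" "conn E S" using assms by (auto simp: biconn_def)
  then have "S \<noteq> {x}" by auto
  then obtain y where y: "y \<in> S" "y \<noteq> x" "{x, y} \<in> E"
    using conn_neighbour[OF c(2) assms(2)] by metis
  have "\<not> S \<subseteq> {x, y}" using c card_mono[of "{x, y}" S] by (auto simp: card_insert_if split: if_splits)
  then have "S - {y} \<noteq> {x}" by auto
  moreover have "x \<in> S - {y}" using y assms(2) by auto
  ultimately obtain z where z: "z \<in> S - {y}" "z \<noteq> x" "{x, z} \<in> E"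
    using conn_neighbour[OF biconn_conn_remove[OF assms(1)]] by metis
  then show ?thesis using that[of y z] y by auto
qed

lemma biconn_glued:
  assumes "glued E A B v" "biconn E S" "S \<subseteq> A \<union> B"
  shows "S \<subseteq> A \<or> S \<subseteq> B"
  using glued_conn_avoiding[OF assms(1) biconn_conn_remove[OF assms(2), of v]] assms(3) glued_mem[OF assms(1)] by blast

lemma biconn_branch:
  assumes "branch E W v K" "biconn E S" "S \<subseteq> W"
  shows "S \<subseteq> W - K \<or> S \<subseteq> insert v K"
  using biconn_glued[OF branch_glued(1)[OF assms(1)] assms(2)] branch_glued(2)[OF assms(1)] assms(3) by simp

text \<open>Send a cut vertex \<open>u\<close> of \<open>S\<close> to a non-cut vertex in a branch at \<open>u\<close> that misses \<open>S\<close>.\<close>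

lemma biconn_card_le_noncut:
  assumes "finite W" "conn E W" "biconn E S" "S \<subseteq> W"
  shows "card S \<le> card (W - cutv E W)"
proof -
  \<comment> \<open>\<open>S - {u}\<close> is connected and thus lies in a single branch at
    \<open>u\<close>; the cut vertex \<open>u\<close> has a second one.\<close>
  have ex: "\<exists>K. branch E W u K \<and> K \<inter> S = {}" if u: "u \<in> S" "u \<in> cutv E W" for u
  proof -
    have "conn E (S - {u})" using biconn_conn_remove[OF assms(3)] .
    then obtain y where y: "y \<in> S - {u}" using conn_nonempty by blast
    obtain K where K: "branch E W u K" "y \<in> K" using branch_exists[of u W y E] u y assms(4) by blast
    have "S \<subseteq> insert u K" using biconn_branch[OF K(1) assms(3,4)] K(2) y by blast
    have "W \<noteq> insert u K" using cutv_branch[OF u(2) K(1)] .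
    then obtain x where x: "x \<in> W" "x \<noteq> u" "x \<notin> K" using K by (auto simp: branch_def)
    obtain L where L: "branch E W u L" "x \<in> L" using branch_exists[of u W x E] u x assms(4) by blast
    have "K \<inter> L = {}" using branch_disjoint[OF K(1) L(1)] x L(2) by blast
    moreover have "u \<notin> L" using L(1) by (simp add: branch_def)
    ultimately show ?thesis using \<open>S \<subseteq> insert u K\<close> L by blast
  qed
  define B where "B u = (SOME K. branch E W u K \<and> K \<inter> S = {})" for u
  have B: "branch E W u (B u)" "B u \<inter> S = {}" if "u \<in> S" "u \<in> cutv E W" for u
    using someI_ex[OF ex[OF that]] by (auto simp: B_def)
  define \<phi> where "\<phi> u = (if u \<in> cutv E W then SOME x. x \<in> B u \<and> x \<notin> cutv E W else u)" for u
  have \<phi>: "\<phi> u \<in> B u" "\<phi> u \<notin> cutv E W" if "u \<in> S" "u \<in> cutv E W" for u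
  proof -
    have "\<exists>x. x \<in> B u \<and> x \<notin> cutv E W" using branch_noncut[OF assms(1,2) B(1)[OF that]] by metis
    from someI_ex[OF this] show "\<phi> u \<in> B u" "\<phi> u \<notin> cutv E W" using that by (auto simp: \<phi>_def)
  qed
  \<comment> \<open>If the branches at \<open>u\<close> and \<open>u'\<close> met, the connected set
    \<open>insert u (B u)\<close>, which misses \<open>u'\<close>, would lie inside
    \<open>B u'\<close>; but \<open>u\<close> is in \<open>S\<close>, which \<open>B u'\<close>
    avoids.\<close>
  have disj: "B u \<inter> B u' = {}" if u: "u \<in> S" "u \<in> cutv E W" and u': "u' \<in> S" "u' \<in> cutv E W" and ne: "u \<noteq> u'" for u u'
  proof (rule ccontr)
    assume nd: "B u \<inter> B u' \<noteq> {}"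
    have c: "conn E (insert u (B u))" using branch_conn(2)[OF B(1)[OF u] assms(2)] .
    have n: "u' \<notin> insert u (B u)" using B(2)[OF u] u' ne by auto
    have "insert u (B u) \<subseteq> W" using B(1)[OF u] by (auto simp: branch_def)
    then have "insert u (B u) \<subseteq> (W - B u') \<union> insert u' (B u')" by auto
    from glued_conn_avoiding[OF branch_glued(1)[OF B(1)[OF u']] c this n]
    have "insert u (B u) \<subseteq> B u'" using nd by auto
    then show False using B(2)[OF u'] u by auto
  qed
  have inj: "inj_on \<phi> S"
  proof (rule inj_onI)
    fix u u' assume *: "u \<in> S" "u' \<in> S" "\<phi> u = \<phi> u'"
    have id: "\<phi> z = z" if "z \<notin> cutv E W" for z using that by (simp add: \<phi>_def)
    show "u = u'"
    proof (rule ccontr)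
      assume ne: "u \<noteq> u'"
      consider "u \<in> cutv E W" "u' \<in> cutv E W" | "u \<in> cutv E W" "u' \<notin> cutv E W"
        | "u \<notin> cutv E W" "u' \<in> cutv E W" | "u \<notin> cutv E W" "u' \<notin> cutv E W" by blast
      then show False
      proof cases
        case 1
        then show ?thesis using \<phi>(1)[of u] \<phi>(1)[of u'] disj[of u u'] * ne by auto
      next
        case 2
        then show ?thesis using \<phi>(1)[of u] B(2)[of u] id[of u'] * by auto
      next
        case 3
        then show ?thesis using \<phi>(1)[of u'] B(2)[of u'] id[of u] * by auto
      next
        case 4
        then show ?thesis using id * ne by auto
      qed
    qed
  qed
  have "\<phi> u \<in> W - cutv E W" if "u \<in> S" for u
  proof (cases "u \<in> cutv E W")
    case True
    then have "B u \<subseteq> W" using B(1)[OF that] by (simp add: branch_def)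
    then show ?thesis using \<phi>[OF that True] by auto
  next
    case False
    then show ?thesis using that assms(4) by (auto simp: \<phi>_def)
  qed
  then show ?thesis using inj assms(1) by (intro card_inj_on_le[of \<phi>]) auto
qed

text \<open>Vertices are stripped off while the set stays connected. Outside \<open>S\<close> the
  removed vertex is simply reattached; the first one inside \<open>S\<close> has two neighbours in
  \<open>S\<close>, and either of the two edges may be dropped because the other still attaches
  it.\<close>

lemma two_nonbridges:
  assumes "finite W" "conn E W" "biconn E S" "S \<subseteq> W"
  shows "\<exists>e f. e \<in> E \<inter> Pow W \<and> f \<in> E \<inter> Pow W \<and> e \<noteq> f \<and>
    conn (E \<inter> Pow W - {e}) W \<and> conn (E \<inter> Pow W - {f}) W"
  using assms(1,2,4)
proof (induction "card W" arbitrary: W rule: less_induct)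
  case less
  have "3 \<le> card S" using assms(3) by (simp add: biconn_def)
  then have "3 \<le> card W" using card_mono[OF less.prems(1,3)] by simp
  then have ns: "W \<noteq> {x}" for x by auto
  obtain v where "v \<in> W" using less.prems(2) conn_nonempty by blast
  then obtain x where x: "x \<in> W" "conn E (W - {x})" using conn_remove_vertex[OF less.prems(1,2)] ns by metis
  have attach: "conn (E \<inter> Pow W - {e}) W"
    if "conn (E \<inter> Pow W - {e}) (W - {x})" "a \<in> W - {x}" "{x, a} \<in> E" "{x, a} \<noteq> e" for e a
  proof -
    have "conn (E \<inter> Pow W - {e}) (insert x (W - {x}))"
      using that x by (intro conn_insert[of _ _ a]) (auto simp: insert_commute)
    then show ?thesis using x by (simp add: insert_absorb)
  qed
  show ?case
  proof (cases "x \<in> S")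
    case True
    obtain y z where yz: "y \<in> S" "z \<in> S" "y \<noteq> z" "y \<noteq> x" "z \<noteq> x" "{x, y} \<in> E" "{x, z} \<in> E"
      using biconn_two_neighbours[OF assms(3) True] by blast
    have c: "conn (E \<inter> Pow W - {{x, t}}) (W - {x})" for t
    proof -
      have "conn (E \<inter> Pow W - {{x, t}}) (W - {x}) \<longleftrightarrow> conn E (W - {x})"
        by (rule conn_cong) (auto simp: doubleton_eq_iff)
      then show ?thesis using x by simp
    qed
    have ne: "{x, y} \<noteq> {x, z}" using yz by (auto simp: doubleton_eq_iff)
    have "conn (E \<inter> Pow W - {{x, y}}) W" by (rule attach[where a = z, OF c]) (use yz ne less.prems in auto)
    moreover have "conn (E \<inter> Pow W - {{x, z}}) W" by (rule attach[where a = y, OF c]) (use yz ne less.prems in auto)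
    ultimately show ?thesis using yz ne x less.prems(3)
      by (intro exI[of _ "{x, y}"] exI[of _ "{x, z}"]) auto
  next
    case False
    have "card (W - {x}) < card W" using x less.prems(1) by (meson card_Diff1_less)
    then obtain e f where ef: "e \<in> E \<inter> Pow (W - {x})" "f \<in> E \<inter> Pow (W - {x})" "e \<noteq> f"
      "conn (E \<inter> Pow (W - {x}) - {e}) (W - {x})" "conn (E \<inter> Pow (W - {x}) - {f}) (W - {x})"
      using less.hyps[of "W - {x}"] x less.prems False by auto
    obtain a where a: "a \<in> W" "a \<noteq> x" "{x, a} \<in> E"
      using conn_neighbour[OF less.prems(2) x(1)] ns by blast
    have "conn (E \<inter> Pow W - {e}) (W - {x})" by (rule conn_mono[OF ef(4)]) auto
    then have "conn (E \<inter> Pow W - {e}) W" by (rule attach[of _ a]) (use a ef in auto)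
    moreover have "conn (E \<inter> Pow W - {f}) (W - {x})" by (rule conn_mono[OF ef(5)]) auto
    then have "conn (E \<inter> Pow W - {f}) W" by (rule attach[of _ a]) (use a ef in auto)
    ultimately show ?thesis using ef(1-3) by (intro exI[of _ e] exI[of _ f]) auto
  qed
qed

section \<open>Spanning connected edge sets and a first lower bound\<close>

definition spanning_edges :: "'a set set \<Rightarrow> 'a set \<Rightarrow> 'a set set set" where
  "spanning_edges E W = {D. D \<subseteq> E \<inter> Pow W \<and> conn D W}"

lemma finite_spanning_edges: "finite W \<Longrightarrow> finite (spanning_edges E W)"
  by (rule finite_subset[of _ "Pow (Pow W)"]) (auto simp: spanning_edges_def)

lemma spanning_edges_self: "conn E W \<Longrightarrow> E \<inter> Pow W \<in> spanning_edges E W"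
  by (simp add: spanning_edges_def conn_restrict)

lemma card_spanning_edges_ge_1:
  assumes "finite W" "conn E W"
  shows "1 \<le> card (spanning_edges E W)"
  using spanning_edges_self[OF assms(2)] finite_spanning_edges[OF assms(1), of E]
  by (metis One_nat_def Suc_leI card_gt_0_iff empty_iff)

lemma card_spanning_edges_ge_3:
  assumes "finite W" "conn E W" "biconn E S" "S \<subseteq> W"
  shows "3 \<le> card (spanning_edges E W)"
proof -
  let ?D = "E \<inter> Pow W"
  obtain e f where ef: "e \<in> ?D" "f \<in> ?D" "e \<noteq> f" "conn (?D - {e}) W" "conn (?D - {f}) W"
    using two_nonbridges[OF assms] by blast
  have "{?D, ?D - {e}, ?D - {f}} \<subseteq> spanning_edges E W"
    using ef spanning_edges_self[OF assms(2)] by (auto simp: spanning_edges_def)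
  moreover have "card {?D, ?D - {e}, ?D - {f}} = 3" using ef by (auto simp: card_insert_if)
  ultimately show ?thesis using card_mono[OF finite_spanning_edges[OF assms(1)]] by metis
qed

text \<open>Two disjoint families: the induced subgraphs obtained by deleting one non-cut vertex
  outside \<open>X\<close>, and the spanning subgraphs.\<close>

lemma ncs_ge_noncut:
  assumes "finite W" "conn E W" "X \<subseteq> W" "2 \<le> card W"
  shows "card (W - cutv E W - X) + card (spanning_edges E W) \<le> ncs E W X"
proof -
  let ?f = "\<lambda>x. (W - {x}, E \<inter> Pow (W - {x}))"
  let ?A = "?f ` (W - cutv E W - X)" and ?B = "Pair W ` spanning_edges E W"
  have ns: "W \<noteq> {x}" for x using assms(4) by auto
  have "?A \<subseteq> conn_subgraphs E W X"
  proof (rule image_subsetI)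
    fix x assume x: "x \<in> W - cutv E W - X"
    then have "conn E (W - {x})" using ns by (intro not_cutv_conn) auto
    then show "?f x \<in> conn_subgraphs E W X" using x assms(3) by (auto simp: conn_subgraphs_def conn_restrict)
  qed
  moreover have "?B \<subseteq> conn_subgraphs E W X"
    using assms(3) by (auto simp: conn_subgraphs_def spanning_edges_def)
  moreover have "?A \<inter> ?B = {}" by auto
  moreover have "card ?A = card (W - cutv E W - X)" by (rule card_image) (auto simp: inj_on_def)
  moreover have "card ?B = card (spanning_edges E W)" by (rule card_image) (auto simp: inj_on_def)
  moreover have "finite ?A" "finite ?B" using assms(1) finite_spanning_edges by auto
  ultimately show ?thesis unfolding ncs_def
    using assms(1) card_mono[OF finite_conn_subgraphs, of W "?A \<union> ?B" E X] by (simp add: card_Un_disjoint)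
qed

section \<open>Numberings of blocks\<close>

text \<open>One step of an st-numbering: among the neighbours \<open>x\<close> of \<open>A\<close>, take one that leaves the largest
  component around \<open>s\<close>.\<close>

lemma st_step:
  assumes "finite B" "biconn E B" "A \<subseteq> B" "A \<noteq> {}" "s \<in> B - A" "conn E (B - A)" "B - A \<noteq> {s}"
  obtains x a where "x \<in> B - A" "x \<noteq> s" "a \<in> A" "{a, x} \<in> E" "conn E (B - A - {x})"
proof -
  let ?U = "B - A"
  let ?P = "\<lambda>(x, C). x \<in> ?U \<and> x \<noteq> s \<and> (\<exists>a\<in>A. {a, x} \<in> E) \<and> C \<subseteq> ?U - {x} \<and> s \<in> C \<and> conn E C"
  have ne: "A \<noteq> B - {s}" using assms by auto
  obtain a0 x0 where "a0 \<in> A" "x0 \<in> B - {s} - A" "{a0, x0} \<in> E"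
    by (rule conn_crossing[OF biconn_conn_remove[OF assms(2), of s] _ assms(4) ne]) (use assms in auto)
  then have P0: "?P (x0, {s})" using assms(5) by auto
  have "\<forall>p. ?P p \<longrightarrow> card (snd p) < Suc (card B)"
  proof (clarify)
    fix x C assume "C \<subseteq> B - A - {x}"
    then have "C \<subseteq> B" by auto
    then show "card (snd (x, C)) < Suc (card B)" using card_mono[OF assms(1)] by (simp add: less_Suc_eq_le)
  qed
  from ex_has_greatest_nat[of ?P, OF P0 this]
  obtain p where p: "?P p" "\<And>q. ?P q \<Longrightarrow> card (snd q) \<le> card (snd p)" by blast
  obtain x C where pxC: "p = (x, C)" by (cases p)
  have x: "x \<in> ?U" "x \<noteq> s" and xa: "\<exists>a\<in>A. {a, x} \<in> E" and C: "C \<subseteq> ?U - {x}" "s \<in> C" "conn E C"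
    using p(1) pxC by auto
  have finC: "finite C" using C assms(1) by (meson finite_Diff finite_subset)
  have no_ext: "{c, y} \<notin> E" if "c \<in> C" "y \<in> ?U - {x} - C" for c y
  proof
    assume "{c, y} \<in> E"
    then have "conn E (insert y C)" using C that by (intro conn_insert[of _ _ c]) auto
    then have "?P (x, insert y C)" using x xa C that by auto
    from p(2)[OF this] show False using that finC pxC by simp
  qed
  \<comment> \<open>Otherwise the vertices left over outside \<open>C\<close> and \<open>x\<close>
    have a neighbour in \<open>A\<close>, because \<open>B - {x}\<close> is connected, say through
    \<open>y\<close>. Choosing \<open>y\<close> instead would leave \<open>C\<close> together with
    \<open>x\<close>, a larger connected set around \<open>s\<close>.\<close>
  have "C = ?U - {x}"
  proof (rule ccontr)
    assume "C \<noteq> ?U - {x}"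
    then have R: "?U - {x} - C \<noteq> {}" using C by auto
    have neR: "?U - {x} - C \<noteq> B - {x}" using C assms(5) by auto
    obtain y b where yb: "y \<in> ?U - {x} - C" "b \<in> B - {x} - (?U - {x} - C)" "{y, b} \<in> E"
      by (rule conn_crossing[OF biconn_conn_remove[OF assms(2), of x] _ R neR]) auto
    have "b \<notin> C" using no_ext[of b y] yb by (auto simp: insert_commute)
    then have bA: "b \<in> A" using yb by auto
    have neC: "C \<noteq> ?U" using x C by auto
    obtain c d where cd: "c \<in> C" "d \<in> ?U - C" "{c, d} \<in> E"
      by (rule conn_crossing[OF assms(6) _ _ neC]) (use C in auto)
    then have "d = x" using no_ext[of c d] by auto
    then have "conn E (insert x C)" using cd C by (intro conn_insert[of _ _ c]) auto
    then have "?P (y, insert x C)" using yb bA x C by (auto simp: insert_commute)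
    moreover have "x \<notin> C" using C by auto
    ultimately show False using p(2)[of "(y, insert x C)"] finC pxC by simp
  qed
  then show ?thesis using that x xa C by auto
qed

text \<open>A prefix avoiding \<open>s\<close> grows by \<open>st_step\<close>, which keeps both the
  prefix and its complement connected; \<open>s\<close> is appended last. Complements of prefixes
  are then the suffixes.\<close>

lemma st_numbering:
  assumes "finite B" "biconn E B" "v \<in> B" "s \<in> B" "{v, s} \<in> E" "v \<noteq> s"
  obtains zs where "distinct zs" "set zs = B" "zs ! 0 = v" "zs ! (card B - 1) = s"
    "\<And>i. 0 < i \<Longrightarrow> i \<le> card B \<Longrightarrow> conn E (set (take i zs))"
    "\<And>i. i < card B \<Longrightarrow> conn E (set (drop i zs))"
proof -
  have c3: "3 \<le> card B" using assms(2) by (simp add: biconn_def)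
  have "\<exists>ys. length ys = m \<and> distinct ys \<and> set ys \<subseteq> B - {s} \<and> ys ! 0 = v \<and>
      (\<forall>i. 0 < i \<longrightarrow> i \<le> m \<longrightarrow> conn E (set (take i ys))) \<and> (\<forall>i\<le>m. conn E (B - set (take i ys)))"
    if "1 \<le> m" "m \<le> card B - 1" for m
    using that
  proof (induction m rule: nat_induct_at_least)
    case base
    have "conn E (B - set (take i [v]))" if "i \<le> 1" for i
      using that assms(2) biconn_conn_remove[OF assms(2)] by (cases i) (auto simp: biconn_def)
    moreover have "conn E (set (take i [v]))" if "0 < i" for i using that by (cases i) auto
    ultimately show ?case using assms by (intro exI[of _ "[v]"]) auto
  next
    case (Suc m)
    then obtain ys where ys: "length ys = m" "distinct ys" "set ys \<subseteq> B - {s}" "ys ! 0 = v"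
      "\<And>i. 0 < i \<Longrightarrow> i \<le> m \<Longrightarrow> conn E (set (take i ys))" "\<And>i. i \<le> m \<Longrightarrow> conn E (B - set (take i ys))"
      by auto
    have cys: "card (set ys) = m" using ys distinct_card by blast
    have "B - set ys \<noteq> {s}"
    proof
      assume "B - set ys = {s}"
      then have "B = insert s (set ys)" using ys by auto
      then have "card B \<le> Suc m" using cys card_insert_le_m1 by (metis card_insert_if finite_set le_SucI order_refl)
      then show False using Suc.prems by simp
    qed
    moreover have "conn E (B - set ys)" using ys(1) ys(6)[of m] by simp
    moreover have "set ys \<noteq> {}" using Suc.hyps ys(1) by auto
    ultimately obtain x a where x: "x \<in> B - set ys" "x \<noteq> s" "a \<in> set ys" "{a, x} \<in> E" "conn E (B - set ys - {x})"
      using st_step[OF assms(1,2), of "set ys" s] ys(3) assms(4) by blast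
    have "conn E (set ys)" using ys(5)[of m] ys(1) Suc.hyps by simp
    then have cx: "conn E (insert x (set ys))" using x by (intro conn_insert[of _ _ a]) auto
    have "conn E (set (take i (ys @ [x])))" if "0 < i" "i \<le> Suc m" for i
      using that ys cx by (cases "i = Suc m") auto
    moreover have "conn E (B - set (take i (ys @ [x])))" if "i \<le> Suc m" for i
    proof (cases "i = Suc m")
      case True
      have "B - insert x (set ys) = B - set ys - {x}" by auto
      then show ?thesis using True ys(1) x by simp
    next
      case False
      then show ?thesis using that ys by auto
    qed
    moreover have "(ys @ [x]) ! 0 = v" using ys Suc.hyps by (simp add: nth_append)
    ultimately show ?case using ys x by (intro exI[of _ "ys @ [x]"]) auto
  qed
  moreover have "1 \<le> card B - 1" using c3 by simp
  ultimately obtain ys where ys: "length ys = card B - 1" "distinct ys" "set ys \<subseteq> B - {s}" "ys ! 0 = v"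
      "\<And>i. 0 < i \<Longrightarrow> i \<le> card B - 1 \<Longrightarrow> conn E (set (take i ys))" "\<And>i. i \<le> card B - 1 \<Longrightarrow> conn E (B - set (take i ys))"
    by (meson order_refl)
  have "set ys = B - {s}"
    using assms(1,4) ys by (intro card_subset_eq) (auto simp: distinct_card)
  then have setz: "set (ys @ [s]) = B" using assms(4) by auto
  have dz: "distinct (ys @ [s])" using ys by auto
  have lz: "length (ys @ [s]) = card B" using ys c3 by simp
  have "conn E (set (take i (ys @ [s])))" if "0 < i" "i \<le> card B" for i
  proof (cases "i = card B")
    case True
    then show ?thesis using lz setz assms(2) by (simp add: biconn_def)
  next
    case False
    then have "i \<le> card B - 1" using that by simp
    then show ?thesis using ys(1,5) that by simp
  qed
  moreover have "conn E (set (drop i (ys @ [s])))" if "i < card B" for i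
  proof -
    have "set (drop i (ys @ [s])) = B - set (take i (ys @ [s]))"
      using dz setz by (metis Diff_cancel append_take_drop_id distinct_append set_append Un_Diff Diff_triv
          Int_commute Un_empty_left)
    moreover have "take i (ys @ [s]) = take i ys" using that ys(1) by simp
    ultimately show ?thesis using ys(6)[of i] that by simp
  qed
  moreover have "(ys @ [s]) ! (card B - 1) = s" using ys(1) by (simp add: nth_append)
  moreover have "(ys @ [s]) ! 0 = v" using ys(1,4) c3 by (simp add: nth_append)
  ultimately show ?thesis using that[OF dz setz] by blast
qed

text \<open>Every cut is crossed by a second edge besides \<open>{a, b}\<close>: if
  \<open>A = {a}\<close>, by another neighbour of \<open>a\<close>; otherwise by connectedness of
  \<open>B - {a}\<close>, applied to \<open>A - {a}\<close>.\<close>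

lemma biconn_nonbridge:
  assumes "biconn E B"
  shows "conn (E \<inter> Pow B - {e}) B"
proof (rule connI)
  have c: "3 \<le> card B" "conn E B" using assms by (auto simp: biconn_def)
  then show "B \<noteq> {}" by auto
  fix A assume A: "A \<subseteq> B" "A \<noteq> {}" "A \<noteq> B"
  obtain a b where ab: "a \<in> A" "b \<in> B - A" "{a, b} \<in> E"
    by (rule conn_crossing[OF c(2) A])
  have *: "\<exists>a\<in>A. \<exists>b\<in>B - A. {a, b} \<in> E \<inter> Pow B - {e}"
    if xy: "x \<in> A" "y \<in> B - A" "{x, y} \<in> E" "{x, y} \<noteq> {a, b}" for x y
  proof (cases "e = {a, b}")
    case True
    then show ?thesis using xy A by (intro bexI[of _ x] bexI[of _ y]) auto
  next
    case False
    then show ?thesis using ab A by (intro bexI[of _ a] bexI[of _ b]) auto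
  qed
  show "\<exists>a\<in>A. \<exists>b\<in>B - A. {a, b} \<in> E \<inter> Pow B - {e}"
  proof (cases "A = {a}")
    case True
    obtain y z where "y \<in> B" "z \<in> B" "y \<noteq> z" "y \<noteq> a" "z \<noteq> a" "{a, y} \<in> E" "{a, z} \<in> E"
      using biconn_two_neighbours[OF assms, of a] ab A by blast
    then obtain y where "y \<in> B - A" "{a, y} \<in> E" "y \<noteq> b" using True by auto
    then show ?thesis by (intro *[of a y]) (use ab in \<open>auto simp: doubleton_eq_iff\<close>)
  next
    case False
    then have n1: "A - {a} \<noteq> {}" using ab by auto
    have n2: "A - {a} \<noteq> B - {a}" using ab by auto
    obtain x y where "x \<in> A - {a}" "y \<in> B - {a} - (A - {a})" "{x, y} \<in> E"
      by (rule conn_crossing[OF biconn_conn_remove[OF assms, of a] _ n1 n2]) (use A in auto)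
    then show ?thesis by (intro *[of x y]) (use ab in \<open>auto simp: doubleton_eq_iff\<close>)
  qed
qed

lemma card_spanning_edges_biconn:
  assumes "finite B" "biconn E B"
  shows "card (E \<inter> Pow B) + 1 \<le> card (spanning_edges E B)"
proof -
  let ?D = "E \<inter> Pow B"
  have fin: "finite ?D" using assms(1) by simp
  have "insert ?D ((\<lambda>e. ?D - {e}) ` ?D) \<subseteq> spanning_edges E B"
    using biconn_nonbridge[OF assms(2)] spanning_edges_self[of E B] assms(2)
    by (auto simp: spanning_edges_def biconn_def)
  moreover have "card (insert ?D ((\<lambda>e. ?D - {e}) ` ?D)) = card ?D + 1"
  proof -
    have "inj_on (\<lambda>e. ?D - {e}) ?D" by (auto simp: inj_on_def)
    moreover have "?D \<notin> (\<lambda>e. ?D - {e}) ` ?D" by auto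
    ultimately show ?thesis using fin by (simp add: card_image)
  qed
  ultimately show ?thesis using card_mono[OF finite_spanning_edges[OF assms(1)]] by metis
qed

lemma card_pairs: "2 * card (Sigma {1..b} (\<lambda>j. {1..<j})) = b * (b - 1)" for b :: nat
proof -
  have "2 * (\<Sum>j\<in>{1..b}. j - 1) = b * (b - 1)"
    by (induction b) (auto simp: algebra_simps diff_mult_distrib2)
  then show ?thesis by (simp add: card_SigmaI)
qed

text \<open>For \<open>1 \<le> i < j \<le> b\<close> the first \<open>i\<close> vertices of the
  numbering and those from position \<open>j\<close> on form a connected set: the prefix contains
  \<open>v\<close>, a nonempty suffix contains the neighbour \<open>s\<close> of \<open>v\<close>.
  These \<open>b (b - 1) / 2\<close> sets are proper and distinct, and the spanning subgraphs
  contribute the number of edges plus one.\<close>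

lemma biconn_ncs:
  assumes "finite B" "biconn E B" "v \<in> B"
  shows "card B * (card B - 1) + 2 * card (E \<inter> Pow B) + 2 \<le> 2 * ncs E B {v}"
proof -
  obtain s t where "s \<in> B" "{v, s} \<in> E" "s \<noteq> v"
    using biconn_two_neighbours[OF assms(2,3)] by metis
  then obtain zs where zs: "distinct zs" "set zs = B" "zs ! 0 = v" "zs ! (card B - 1) = s"
    "\<And>i. 0 < i \<Longrightarrow> i \<le> card B \<Longrightarrow> conn E (set (take i zs))"
    "\<And>i. i < card B \<Longrightarrow> conn E (set (drop i zs))"
    using st_numbering[OF assms] by metis
  let ?b = "card B"
  have len: "length zs = ?b" using zs(1,2) distinct_card by metis
  have c3: "3 \<le> ?b" using assms(2) by (simp add: biconn_def)
  define U where "U = (\<lambda>(j, i). set (take i zs) \<union> set (drop j zs))"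
  let ?P = "Sigma {1..?b} (\<lambda>j. {1..<j})"
  have Uc: "conn E (U (j, i))" "v \<in> U (j, i)" if "1 \<le> i" "i < j" "j \<le> ?b" for i j
  proof -
    have "zs ! 0 \<in> set (take i zs)" using that len c3 by (auto simp: in_set_conv_nth intro!: exI[of _ 0])
    then have vt: "v \<in> set (take i zs)" using zs by simp
    then show "v \<in> U (j, i)" by (simp add: U_def)
    have ci: "conn E (set (take i zs))" using zs(5) that by simp
    show "conn E (U (j, i))"
    proof (cases "j = ?b")
      case True
      then show ?thesis using ci len by (simp add: U_def)
    next
      case False
      then have jb: "j < ?b" using that by simp
      have "zs ! (?b - 1) = drop j zs ! (?b - 1 - j)" using jb len by simp
      moreover have "drop j zs ! (?b - 1 - j) \<in> set (drop j zs)" using jb len by (intro nth_mem) auto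
      ultimately have "s \<in> set (drop j zs)" using zs(4) by simp
      then show ?thesis unfolding U_def
        using conn_Un_edge[OF ci zs(6)[OF jb] vt _ \<open>{v, s} \<in> E\<close>] by simp
    qed
  qed
  \<comment> \<open>The omitted vertices occupy a nonempty interval of positions, from which both
    \<open>i\<close> and \<open>j\<close> can be read off.\<close>
  have compl: "B - U (j, i) = (!) zs ` {i..<j}" if "i < j" "j \<le> ?b" for i j
  proof -
    have "set (take i zs) = (!) zs ` {..<i}" using that len nth_image[of i zs] by (simp add: atLeast0LessThan)
    moreover have "set (drop j zs) = (!) zs ` {j..<?b}"
    proof -
      have "set (drop j zs) = (\<lambda>k. zs ! (j + k)) ` {0..<?b - j}"
        using that len nth_image[of "?b - j" "drop j zs"] by (simp cong: image_cong)
      also have "\<dots> = (!) zs ` ((+) j ` {0..<?b - j})" by (simp only: image_image)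
      also have "(+) j ` {0..<?b - j} = {j..<?b}" using that by (simp add: image_add_atLeastLessThan)
      finally show ?thesis .
    qed
    moreover have "B = (!) zs ` {..<?b}" using zs(2) len nth_image[of ?b zs] by (simp add: atLeast0LessThan)
    moreover have inj: "inj_on ((!) zs) {..<?b}" using zs(1) len by (simp add: inj_on_nth)
    moreover have "(!) zs ` ({..<?b} - ({..<i} \<union> {j..<?b})) = (!) zs ` {..<?b} - (!) zs ` ({..<i} \<union> {j..<?b})"
      by (rule inj_on_image_set_diff[OF inj]) (use that in auto)
    ultimately have "B - U (j, i) = (!) zs ` ({..<?b} - ({..<i} \<union> {j..<?b}))"
      by (simp add: U_def image_Un)
    moreover have "{..<?b} - ({..<i} \<union> {j..<?b}) = {i..<j}" using that by auto
    ultimately show ?thesis by simp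
  qed
  have injU: "inj_on U ?P"
  proof (rule inj_onI, clarify)
    fix j i j' i' assume *: "j \<in> {1..?b}" "i \<in> {1..<j}" "j' \<in> {1..?b}" "i' \<in> {1..<j'}" "U (j, i) = U (j', i')"
    then have "(!) zs ` {i..<j} = (!) zs ` {i'..<j'}" using compl[of i j] compl[of i' j'] by simp
    moreover have "inj_on ((!) zs) {..<?b}" using zs(1) len by (simp add: inj_on_nth)
    ultimately have "{i..<j} = {i'..<j'}" using * by (subst (asm) inj_on_image_eq_iff) auto
    then show "j = j' \<and> i = i'" using * by (auto simp: atLeastLessThan_eq_iff)
  qed
  have proper: "U p \<noteq> B" if "p \<in> ?P" for p
  proof -
    obtain j i where p: "p = (j, i)" by (cases p)
    have "(!) zs ` {i..<j} \<noteq> {}" using that p by auto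
    then show ?thesis using compl[of i j] that p by auto
  qed
  let ?f = "\<lambda>p. (U p, E \<inter> Pow (U p))"
  have "?f ` ?P \<subseteq> conn_subgraphs E B {v}"
  proof (rule image_subsetI)
    fix p assume p: "p \<in> ?P"
    obtain j i where ji: "p = (j, i)" by (cases p)
    have "U p \<subseteq> B" using zs(2) set_take_subset set_drop_subset by (fastforce simp: U_def ji)
    then show "?f p \<in> conn_subgraphs E B {v}" using Uc[of i j] p ji by (auto simp: conn_subgraphs_def conn_restrict)
  qed
  moreover have "Pair B ` spanning_edges E B \<subseteq> conn_subgraphs E B {v}"
    using assms(3) by (auto simp: conn_subgraphs_def spanning_edges_def)
  moreover have "?f ` ?P \<inter> Pair B ` spanning_edges E B = {}" using proper by auto
  moreover have "card (?f ` ?P) = card ?P"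
    using injU unfolding inj_on_def by (intro card_image inj_onI) blast
  moreover have "card (Pair B ` spanning_edges E B) = card (spanning_edges E B)" by (rule card_image) (auto simp: inj_on_def)
  ultimately have "card ?P + card (spanning_edges E B) \<le> ncs E B {v}"
    unfolding ncs_def using assms(1) finite_spanning_edges[OF assms(1), of E]
      card_mono[OF finite_conn_subgraphs[OF assms(1)], of "?f ` ?P \<union> Pair B ` spanning_edges E B" E "{v}"]
    by (simp add: card_Un_disjoint)
  then show ?thesis using card_pairs[of ?b] card_spanning_edges_biconn[OF assms(1,2)] by linarith
qed

lemma conn_card_edges:
  assumes "finite W" "conn E W"
  shows "card W \<le> card (E \<inter> Pow W) + 1"
  using assms
proof (induction "card W" arbitrary: W rule: less_induct)
  case less
  obtain v where v: "v \<in> W" using less.prems conn_nonempty by blast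
  show ?case
  proof (cases "W = {v}")
    case False
    then obtain x where x: "x \<in> W" "x \<noteq> v" "conn E (W - {x})"
      using conn_remove_vertex[OF less.prems v] by blast
    have "card (W - {x}) < card W" using x less.prems(1) by (meson card_Diff1_less)
    then have IH: "card (W - {x}) \<le> card (E \<inter> Pow (W - {x})) + 1" using less x by blast
    obtain a where a: "a \<in> W" "a \<noteq> x" "{x, a} \<in> E"
      using conn_neighbour[OF less.prems(2) x(1)] x v by blast
    have "insert {x, a} (E \<inter> Pow (W - {x})) \<subseteq> E \<inter> Pow W" using a x by auto
    then have "card (insert {x, a} (E \<inter> Pow (W - {x}))) \<le> card (E \<inter> Pow W)"
      using less.prems(1) by (intro card_mono) auto
    moreover have "card (insert {x, a} (E \<inter> Pow (W - {x}))) = Suc (card (E \<inter> Pow (W - {x})))"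
      using less.prems(1) by (intro card_insert_disjoint) auto
    ultimately show ?thesis using IH x less.prems(1) by (simp add: card_Diff_singleton)
  qed simp
qed

lemma biconn_card_edges:
  assumes "finite B" "biconn E B"
  shows "card B \<le> card (E \<inter> Pow B)"
proof -
  have "B \<noteq> {}" using assms(2) by (auto simp: biconn_def)
  then obtain v where v: "v \<in> B" by blast
  obtain s where s: "s \<in> B" "{v, s} \<in> E" "s \<noteq> v"
    using biconn_two_neighbours[OF assms(2) v] by metis
  let ?D = "E \<inter> Pow B - {{v, s}}"
  have "card B \<le> card (?D \<inter> Pow B) + 1"
    by (rule conn_card_edges[OF assms(1) biconn_nonbridge[OF assms(2)]])
  moreover have "?D \<inter> Pow B = ?D" by auto
  moreover have "card ?D = card (E \<inter> Pow B) - 1" "0 < card (E \<inter> Pow B)"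
    using s v assms(1) by (auto simp: card_gt_0_iff)
  ultimately show ?thesis by simp
qed

section \<open>The rooted bound\<close>

text \<open>A cycle is represented by a two-connected vertex set. That this agrees with the
  existence of a \<open>graph_cycle\<close> is shown by \<open>graph_cycle_nontree\<close> and
  \<open>biconn_graph_cycle\<close>.\<close>

definition nontree :: "'a set set \<Rightarrow> 'a set \<Rightarrow> bool" where
  "nontree E W \<longleftrightarrow> (\<exists>S\<subseteq>W. biconn E S)"

lemma branch_remove_cutv:
  assumes "branch E W v K" "conn E W" "W \<noteq> insert v K" "cutv E (insert v K) = {}"
  shows "cutv E W = insert v (cutv E (W - K) - {v})"
    and "W - cutv E W = K \<union> (W - K - cutv E (W - K) - {v})"
proof -
  have v: "v \<in> cutv E W" using branch_cut[OF assms(1,3)] .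
  have 1: "cutv E W - insert v K = cutv E (W - K) - {v}" using branch_cutv(1)[OF assms(1,2)] .
  have 2: "cutv E W \<inter> K = {}" using branch_cutv(2)[OF assms(1,2)] assms(4) by simp
  have "cutv E W = insert v (cutv E W - insert v K)" using v 2 by auto
  then show eq: "cutv E W = insert v (cutv E (W - K) - {v})" unfolding 1 .
  have K: "K \<subseteq> W" "v \<notin> K" using assms(1) by (auto simp: branch_def)
  then show "W - cutv E W = K \<union> (W - K - cutv E (W - K) - {v})"
    unfolding eq using cutv_subset[of E "W - K"] by blast
qed

text \<open>A cut vertex has at least two branches, so one of them misses \<open>w\<close>;
  \<open>end_branch\<close> shrinks that one to an end block.\<close>

lemma end_branch_avoiding:
  assumes "finite W" "conn E W" "cutv E W \<noteq> {}" "w \<in> W"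
  obtains v K where "branch E W v K" "w \<notin> K" "cutv E (insert v K) = {}" "W \<noteq> insert v K"
proof -
  obtain u where u: "u \<in> cutv E W" "u \<in> W" using assms(3) cutv_subset by fast
  have "W \<noteq> {u}" using u by (auto simp: cutv_def)
  then obtain x where x: "x \<in> W" "x \<noteq> u" using u by auto
  obtain K where K: "branch E W u K" "x \<in> K" using branch_exists[of u W x E] u x by blast
  obtain L where L: "branch E W u L" "w \<notin> L"
  proof (cases "w \<in> K")
    case True
    obtain y where y: "y \<in> W" "y \<noteq> u" "y \<notin> K" using cutv_branch[OF u(1) K(1)] K(1) by (auto simp: branch_def)
    obtain L where "branch E W u L" "y \<in> L" using branch_exists[of u W y E] u y by blast
    moreover have "w \<notin> L" using branch_disjoint[OF K(1) calculation(1)] True y calculation(2) by blast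
    ultimately show ?thesis using that by blast
  next
    case False
    then show ?thesis using that K by blast
  qed
  obtain v' K' where e: "branch E W v' K'" "K' \<subseteq> L" "cutv E (insert v' K') = {}"
    using end_branch[OF assms(1,2) L(1)] by blast
  moreover have "W \<noteq> insert v' K'" using e(3) assms(3) by auto
  ultimately show ?thesis using that L(2) by blast
qed

lemma leaf_nontree:
  assumes "branch E W v {u}" "nontree E W"
  shows "nontree E (W - {u})"
proof -
  obtain S where S: "S \<subseteq> W" "biconn E S" using assms(2) by (auto simp: nontree_def)
  have "\<not> S \<subseteq> {v, u}"
  proof
    assume "S \<subseteq> {v, u}"
    then have "card S \<le> card {v, u}" by (intro card_mono) auto
    then show False using S(2) card_insert_le_m1[of 2 "{u}" v] by (auto simp: biconn_def card_insert_if split: if_splits)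
  qed
  then have "S \<subseteq> W - {u}" using biconn_branch[OF assms(1) S(2,1)] by auto
  then show ?thesis using S by (auto simp: nontree_def)
qed

context edges
begin

lemma leaf_edge:
  assumes "branch E W v {u}" "conn E W"
  shows "{v, u} \<in> E" "u \<noteq> v"
proof -
  show uv: "u \<noteq> v" using assms(1) by (auto simp: branch_def)
  have "conn E {v, u}" using branch_conn(2)[OF assms] by simp
  then obtain a where "a \<in> {v, u}" "a \<noteq> v" "{v, a} \<in> E"
    by (rule conn_neighbour[of E _ v]) (use uv in auto)
  then show "{v, u} \<in> E" by auto
qed

lemma ncs_edge:
  assumes "{v, u} \<in> E" "u \<noteq> v"
  shows "ncs E {v, u} {v} = 2"
proof -
  have "conn_subgraphs E {v, u} {u, v} = {({v, u}, {{v, u}})}" (is "?L = ?R")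
  proof
    show "?L \<subseteq> ?R"
    proof (rule subrelI)
      fix U D assume "(U, D) \<in> ?L"
      then have *: "U = {v, u}" "D \<subseteq> E" "D \<subseteq> Pow {v, u}" "conn D U" by (auto simp: conn_subgraphs_def)
      have "D \<subseteq> {{v, u}}"
      proof
        fix e assume "e \<in> D"
        then have "e \<subseteq> {v, u}" "card e = 2" using * edge_card by auto
        then have "e = {v, u}" using assms(2) by (intro card_subset_eq) auto
        then show "e \<in> {{v, u}}" by simp
      qed
      moreover have "D \<noteq> {}"
      proof -
        obtain a where "a \<in> U" "a \<noteq> v" "{v, a} \<in> D"
          by (rule conn_neighbour[OF *(4), of v]) (use * assms(2) in auto)
        then show ?thesis by auto
      qed
      ultimately have "D = {{v, u}}" by auto
      then show "(U, D) \<in> ?R" using * by simp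
    qed
    show "?R \<subseteq> ?L" using assms conn_edge[of v u "{{v, u}}"] by (auto simp: conn_subgraphs_def)
  qed
  then have "ncs E {v, u} {u, v} = 1" by (simp add: ncs_def)
  moreover have "{v, u} - {u} = {v}" using assms(2) by auto
  ultimately show ?thesis using ncs_split[of "{v, u}" u "{v}" E] assms(2) ncs_singleton[of "{v}" v] by simp
qed

text \<open>The pendant edge has two connected subgraphs through \<open>v\<close>, so gluing it on
  doubles whatever contains \<open>v\<close>. The summand \<open>1\<close> is the leaf
  alone.\<close>

lemma leaf_ncs:
  assumes "finite W" "conn E W" "branch E W v {u}"
  shows "ncs E W {} = ncs E (W - {u}) {} + 1 + ncs E (W - {u}) {v}"
    and "w \<in> W \<Longrightarrow> w \<noteq> u \<Longrightarrow> w \<noteq> v \<Longrightarrow> ncs E W {w} = ncs E (W - {u}) {w} + ncs E (W - {u}) {v, w}"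
    and "ncs E W {v} = 2 * ncs E (W - {u}) {v}"
    and "ncs E W {u} = 1 + ncs E (W - {u}) {v}"
proof -
  note e = leaf_edge[OF assms(3,2)] and g = branch_glued[OF assms(3)]
  have "{v, u} - {v} = {u}" using e by auto
  then have s: "ncs E ({v, u} - {v}) {} = 1" using ncs_singleton[of "{}" u] by simp
  have f: "finite (W - {u})" using assms(1) by simp
  show 1: "ncs E W {} = ncs E (W - {u}) {} + 1 + ncs E (W - {u}) {v}"
    using ncs_glued_total[OF g(1) f] g(2) ncs_edge[OF e] s by simp
  show "ncs E W {w} = ncs E (W - {u}) {w} + ncs E (W - {u}) {v, w}" if "w \<in> W" "w \<noteq> u" "w \<noteq> v"
    using ncs_glued_containing[OF g(1) f _ _ that(3)] g(2) ncs_edge[OF e] that by simp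
  show "ncs E W {v} = 2 * ncs E (W - {u}) {v}"
    using ncs_glued[OF g(1), of "{v}" "{v}"] glued_mem[OF g(1)] g(2) ncs_edge[OF e] by simp
  show "ncs E W {u} = 1 + ncs E (W - {u}) {v}"
    using 1 ncs_split[OF assms(1), of u "{}" E] by simp
qed

lemma biconn_ncs':
  assumes "finite B" "biconn E B" "v \<in> B"
  shows "card B * (card B + 1) + 2 \<le> 2 * ncs E B {v}"
proof -
  have "card B * (card B - 1) + 2 * card B = card B * (card B + 1)"
    by (cases "card B") (auto simp: algebra_simps)
  then show ?thesis using biconn_ncs[OF assms] biconn_card_edges[OF assms(1,2)] by linarith
qed

text \<open>Twice the bound, to avoid halves. A lollipop with cycle length \<open>g\<close> and
  \<open>k\<close> tail edges, rooted at the end of its tail, has \<open>k\<close> other cut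
  vertices and \<open>P = g - 1\<close>, and attains \<open>2 * k + g * (g + 1) + 2\<close>, the
  value in \<open>lolli_ncs\<close>.\<close>

definition rooted_bound :: "'a set \<Rightarrow> 'a \<Rightarrow> nat" where
  "rooted_bound W w = (let P = card (W - cutv E W - {w}) in
     2 * card (cutv E W - {w}) + P * (P + 1) + 2 + (if nontree E W then 2 * P + 2 else 0))"

text \<open>Only the status of \<open>v\<close> is in doubt once the end block is gone. Hence
  \<open>c\<close> and \<open>q\<close> leave out \<open>v\<close> as well as the root
  \<open>w\<close>, and \<open>v\<close> is added back in one of two cases.\<close>

lemma end_branch_counts:
  assumes "finite W" "conn E W" "branch E W v K" "cutv E (insert v K) = {}" "W \<noteq> insert v K"
    and "w \<in> W" "w \<notin> K" "w \<noteq> v"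
  defines "H \<equiv> W - K"
  defines "q \<equiv> card (H - cutv E H - {v, w})" and "c \<equiv> card (cutv E H - {v, w})"
  shows "card (cutv E W - {w}) = c + 1" "card (W - cutv E W - {w}) = card K + q"
    and "v \<in> cutv E H \<Longrightarrow> card (cutv E H - {w}) = c + 1 \<and> card (H - cutv E H - {w}) = q"
    and "v \<notin> cutv E H \<Longrightarrow> card (cutv E H - {w}) = c \<and> card (H - cutv E H - {w}) = q + 1"
    and "q + card (spanning_edges E H) \<le> ncs E H {v, w}"
proof -
  note r = branch_remove_cutv[OF assms(3,2,5,4), folded H_def]
  have K: "K \<subseteq> W" "v \<in> W" "v \<notin> K" using assms(3) by (auto simp: branch_def)
  then have vH: "v \<in> H" "w \<in> H" using assms by (auto simp: H_def)
  have fin: "finite H" "finite K" "finite (cutv E H)"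
    using assms(1) K finite_subset cutv_subset by (auto simp: H_def cutv_def)
  have "cutv E W - {w} = insert v (cutv E H - {v, w})" unfolding r(1) using assms(8) by auto
  then show "card (cutv E W - {w}) = c + 1" using fin by (simp add: c_def)
  have "W - cutv E W - {w} = K \<union> (H - cutv E H - {v, w})"
    unfolding r(2) using assms(7) by auto
  moreover have "K \<inter> (H - cutv E H - {v, w}) = {}" by (auto simp: H_def)
  ultimately show "card (W - cutv E W - {w}) = card K + q" using fin by (simp add: card_Un_disjoint q_def)
  show "card (cutv E H - {w}) = c + 1 \<and> card (H - cutv E H - {w}) = q" if "v \<in> cutv E H"
  proof -
    have 1: "cutv E H - {w} = insert v (cutv E H - {v, w})" and 2: "H - cutv E H - {w} = H - cutv E H - {v, w}"
      using that assms(8) by blast+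
    show ?thesis unfolding 1 2 c_def q_def using fin by simp
  qed
  show "card (cutv E H - {w}) = c \<and> card (H - cutv E H - {w}) = q + 1" if "v \<notin> cutv E H"
  proof -
    have 1: "cutv E H - {w} = cutv E H - {v, w}" and 2: "H - cutv E H - {w} = insert v (H - cutv E H - {v, w})"
      using that assms(8) vH by blast+
    show ?thesis unfolding 1 2 c_def q_def using fin by simp
  qed
  have "card {v, w} \<le> card H" using vH fin by (intro card_mono) auto
  then show "q + card (spanning_edges E H) \<le> ncs E H {v, w}"
    unfolding q_def using ncs_ge_noncut[OF fin(1), of E "{v, w}"] branch_conn(1)[OF assms(3,2)] vH assms(8)
    by (simp add: H_def)
qed

text \<open>A cycle provides three spanning connected edge sets instead of one, which pays for more
  than the growth of the cycle term. The remaining \<open>2\<close> is kept because it decides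
  equality: in a graph with a cycle and a leaf, a root other than the leaf or its neighbour never
  attains the bound.\<close>

lemma leaf_rooted_step:
  assumes "finite W" "conn E W" "branch E W v {u}" "W \<noteq> {v, u}" "w \<in> W" "w \<noteq> u" "w \<noteq> v"
    and "rooted_bound (W - {u}) w \<le> 2 * ncs E (W - {u}) {w}"
  shows "rooted_bound W w + (if nontree E W then 2 else 0) \<le> 2 * ncs E W {w}"
proof -
  let ?H = "W - {u}"
  define q where "q = card (?H - cutv E ?H - {v, w})"
  define c where "c = card (cutv E ?H - {v, w})"
  have uv: "u \<noteq> v" using assms(3) by (auto simp: branch_def)
  have "cutv E (insert v {u}) = {}" using uv by (auto simp: cutv_def insert_Diff_if)
  note cnt = end_branch_counts[OF assms(1-3) this assms(4,5) _ assms(7), folded q_def c_def]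
  have cnt1: "card (cutv E W - {w}) = c + 1" "card (W - cutv E W - {w}) = q + 1"
    using cnt(1,2) assms(6) by auto
  have fin: "finite ?H" using assms(1) by simp
  have cH: "conn E ?H" using branch_conn(1)[OF assms(3,2)] .
  have N: "ncs E W {w} = ncs E ?H {w} + ncs E ?H {v, w}" using leaf_ncs(2)[OF assms(1-3)] assms by simp
  define t where "t = (if nontree E W then 1 else 0 :: nat)"
  have nt: "nontree E ?H \<longleftrightarrow> nontree E W" using leaf_nontree[OF assms(3)] by (auto simp: nontree_def)
  have "1 + 2 * t \<le> card (spanning_edges E ?H)"
  proof (cases "nontree E W")
    case True
    then obtain S where "S \<subseteq> ?H" "biconn E S" using nt by (auto simp: nontree_def)
    then have "3 \<le> card (spanning_edges E ?H)" using card_spanning_edges_ge_3[OF fin cH] by blast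
    then show ?thesis using True by (simp add: t_def)
  next
    case False
    then show ?thesis using card_spanning_edges_ge_1[OF fin cH] by (simp add: t_def)
  qed
  then have M: "q + 1 + 2 * t \<le> ncs E ?H {v, w}" using cnt(5) assms(6) by simp
  have bW: "rooted_bound W w = 2 * (c + 1) + (q + 1) * (q + 2) + 2 + t * (2 * q + 4)"
    using cnt1 by (simp add: rooted_bound_def t_def Let_def)
  show ?thesis
  proof (cases "v \<in> cutv E ?H")
    case True
    then have "rooted_bound ?H w = 2 * (c + 1) + q * (q + 1) + 2 + t * (2 * q + 2)"
      using cnt(3) assms(6) nt by (simp add: rooted_bound_def t_def Let_def)
    then have "2 * (c + 1) + q * (q + 1) + 2 + t * (2 * q + 2) + 2 * (q + 1 + 2 * t) \<le> 2 * ncs E W {w}"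
      using N M assms(8) by simp
    moreover have "rooted_bound W w + 2 * t \<le> 2 * (c + 1) + q * (q + 1) + 2 + t * (2 * q + 2) + 2 * (q + 1 + 2 * t)"
      unfolding bW by (simp add: algebra_simps)
    ultimately show ?thesis by (simp add: t_def split: if_splits)
  next
    case False
    then have "rooted_bound ?H w = 2 * c + (q + 1) * (q + 2) + 2 + t * (2 * q + 4)"
      using cnt(4) assms(6) nt by (simp add: rooted_bound_def t_def Let_def)
    then have "2 * c + (q + 1) * (q + 2) + 2 + t * (2 * q + 4) + 2 * (1 + 2 * t) \<le> 2 * ncs E W {w}"
      using N M assms(8) by simp
    then show ?thesis unfolding bW by (simp add: t_def split: if_splits)
  qed
qed

text \<open>Without cut vertices \<open>W\<close> is a vertex, an edge or a block. Otherwise an end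
  block at \<open>v\<close> not containing \<open>w\<close>, except possibly as \<open>v\<close>, is
  removed. If \<open>w = v\<close> the rooted counts multiply; if not, only the subgraphs through
  both \<open>v\<close> and \<open>w\<close> do, and \<open>end_branch_counts\<close> bounds their
  number.\<close>

lemma rooted_bound_le_ncs:
  assumes "finite W" "conn E W" "w \<in> W"
  shows "rooted_bound W w \<le> 2 * ncs E W {w}"
  using assms
proof (induction "card W" arbitrary: W w rule: less_induct)
  case less
  note fin = less.prems(1) and con = less.prems(2) and w = less.prems(3)
  show ?case
  proof (cases "cutv E W = {}")
    case True
    have P: "card (W - cutv E W - {w}) = card W - 1" using True fin w by simp
    have "0 < card W" using fin w by (auto simp: card_gt_0_iff)
    have small: "3 \<le> card W" if nt: "nontree E W"
    proof -
      obtain S where "S \<subseteq> W" "3 \<le> card S" using nt unfolding nontree_def biconn_def by blast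
      then show ?thesis using card_mono[OF fin] by (meson order_trans)
    qed
    consider "card W = 1" | "card W = 2" | "3 \<le> card W" using \<open>0 < card W\<close> by linarith
    then show ?thesis
    proof cases
      case 1
      then have W: "W = {w}" using w by (auto simp: card_1_singleton_iff)
      have "\<not> nontree E W" using small 1 by auto
      then show ?thesis using P True 1 ncs_singleton[of "{w}" w] W by (simp add: rooted_bound_def)
    next
      case 2
      then obtain a b where "W = {a, b}" "a \<noteq> b" by (auto simp: card_2_iff)
      then obtain x where W: "W = {w, x}" "x \<noteq> w" using w by (cases "w = a") auto
      have "\<not> nontree E W" using small 2 by auto
      moreover obtain a where "a \<in> W" "a \<noteq> w" "{w, a} \<in> E"
        using conn_neighbour[OF con w] W by auto
      then have "ncs E W {w} = 2" using ncs_edge[of w x] W by auto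
      ultimately show ?thesis using P True 2 by (simp add: rooted_bound_def)
    next
      case 3
      then have B: "biconn E W" using True con by (simp add: biconn_def)
      then have "nontree E W" by (auto simp: nontree_def)
      moreover obtain m where m: "card W = Suc m" using 3 by (cases "card W") auto
      ultimately have "rooted_bound W w = m * (m + 1) + 2 + (2 * m + 2)" using P True by (simp add: rooted_bound_def Let_def)
      also have "\<dots> = card W * (card W + 1) + 2" using m by (simp add: algebra_simps)
      finally show ?thesis using biconn_ncs'[OF fin B w] by simp
    qed
  next
    case False
    obtain v K where br: "branch E W v K" "w \<notin> K" "cutv E (insert v K) = {}" "W \<noteq> insert v K"
      using end_branch_avoiding[OF fin con False w] by blast
    let ?H = "W - K" and ?B = "insert v K"
    have K: "K \<subseteq> W" "v \<in> W" "v \<notin> K" "K \<noteq> {}" using br(1) branch_nonempty[OF br(1)] by (auto simp: branch_def)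
    have finK: "finite K" "finite ?H" "finite ?B" using finite_subset[OF K(1) fin] fin by auto
    have cH: "conn E ?H" and cB: "conn E ?B" using branch_conn[OF br(1) con] by auto
    have "card ?H < card W" using K fin by (intro psubset_card_mono) auto
    then have IH: "rooted_bound ?H w \<le> 2 * ncs E ?H {w}" using less.hyps[of ?H w] finK cH w br(2) by simp
    note g = branch_glued[OF br(1)]
    show ?thesis
    proof (cases "card K = 1")
      case True
      then obtain u where Ku: "K = {u}" by (auto simp: card_1_singleton_iff)
      show ?thesis
      proof (cases "w = v")
        case False
        then show ?thesis using leaf_rooted_step[OF fin con br(1)[unfolded Ku] _ w _ False] br IH Ku by simp
      next
        case wv: True
        define q where "q = card (?H - cutv E ?H - {v})"
        define J where "J = card (cutv E ?H - {v})"
        note r = branch_remove_cutv[OF br(1) con br(4,3)]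
        have "cutv E W - {v} = cutv E ?H - {v}" unfolding r(1) by auto
        then have J: "card (cutv E W - {v}) = J" by (simp add: J_def)
        have "W - cutv E W - {v} = insert u (?H - cutv E ?H - {v})" unfolding r(2) using Ku K by auto
        then have P: "card (W - cutv E W - {v}) = q + 1" using finK Ku by (simp add: q_def)
        define t where "t = (if nontree E W then 1 else 0 :: nat)"
        have nt: "nontree E ?H \<longleftrightarrow> nontree E W"
          using leaf_nontree[of E W v u] br(1) Ku by (auto simp: nontree_def)
        have "2 * J + q * (q + 1) + 2 + t * (2 * q + 2) \<le> 2 * ncs E ?H {v}"
          using IH nt wv by (simp add: rooted_bound_def q_def J_def t_def Let_def split: if_splits)
        moreover have "ncs E W {v} = 2 * ncs E ?H {v}" using leaf_ncs(3)[OF fin con] br(1) Ku by simp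
        moreover have "2 * J + (q + 1) * (q + 2) + 2 + t * (2 * q + 4) \<le> 2 * (2 * J + q * (q + 1) + 2 + t * (2 * q + 2))"
        proof -
          have "q \<le> q * q + (J * 2 + q * (t * 2))" by (rule trans_le_add1) simp
          then show ?thesis by (simp add: algebra_simps del: le_square)
        qed
        moreover have "rooted_bound W w = 2 * J + (q + 1) * (q + 2) + 2 + t * (2 * q + 4)"
          using J P wv by (simp add: rooted_bound_def t_def Let_def)
        ultimately show ?thesis using wv by simp
      qed
    next
      case False
      have "card K \<noteq> 0" using finK K by simp
      then have cK: "2 \<le> card K" using False by simp
      define b where "b = card ?B"
      have bK: "b = card K + 1" using finK K by (simp add: b_def)
      have B: "biconn E ?B" using br(3) cB bK cK by (simp add: biconn_def b_def)
      then have nt: "nontree E W" using K by (auto simp: nontree_def intro!: exI[of _ ?B])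
      define n1 where "n1 = ncs E ?B {v}"
      have n1: "b * (b + 1) + 2 \<le> 2 * n1" using biconn_ncs'[OF finK(3) B] by (simp add: b_def n1_def)
      show ?thesis
      proof (cases "w = v")
        case wv: True
        define q where "q = card (?H - cutv E ?H - {v})"
        define J where "J = card (cutv E ?H - {v})"
        note r = branch_remove_cutv[OF br(1) con br(4,3)]
        have "cutv E W - {v} = cutv E ?H - {v}" unfolding r(1) by auto
        then have J: "card (cutv E W - {v}) = J" by (simp add: J_def)
        have "W - cutv E W - {v} = K \<union> (?H - cutv E ?H - {v})" unfolding r(2) using K by auto
        moreover have "K \<inter> (?H - cutv E ?H - {v}) = {}" by auto
        ultimately have P: "card (W - cutv E W - {v}) = card K + q" using finK by (simp add: q_def card_Un_disjoint)
        have "2 * J + q * (q + 1) + 2 \<le> rooted_bound ?H v"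
          by (simp add: rooted_bound_def q_def J_def Let_def)
        then have NH: "2 * J + q * (q + 1) + 2 \<le> 2 * ncs E ?H {v}" using IH wv by simp
        have N: "ncs E W {v} = ncs E ?H {v} * n1"
          using ncs_glued[OF g(1), of "{v}" "{v}"] glued_mem[OF g(1)] g(2) by (simp add: n1_def)
        have "(2 * J + q * (q + 1) + 2) * (b * (b + 1) + 2) \<le> (2 * ncs E ?H {v}) * (2 * n1)"
          by (rule mult_le_mono[OF NH n1])
        then have 1: "(2 * J + q * (q + 1) + 2) * (b * (b + 1) + 2) \<le> 4 * ncs E W {v}" by (simp add: N)
        have bd: "rooted_bound W w = 2 * J + (q + b) * (q + b + 1) + 2"
          using J P wv nt bK by (simp add: rooted_bound_def Let_def algebra_simps)
        \<comment> \<open>The expansion of \<open>2 * ((q + b) * (q + b + 1))\<close> contains the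
          mixed term \<open>4 * q * b\<close>, absorbed here by the product of the two quadratic
          factors.\<close>
        have "4 \<le> (q + 1) * (b + 1)" using bK cK by (simp add: algebra_simps)
        then have "q * b * 4 \<le> q * b * ((q + 1) * (b + 1))" by (rule mult_le_mono2)
        then have "4 * q * b \<le> q * (q + 1) * (b * (b + 1))" by (simp add: algebra_simps)
        then have "2 * (2 * J + (q + b) * (q + b + 1) + 2) \<le> (2 * J + q * (q + 1) + 2) * (b * (b + 1) + 2)"
          by (simp add: algebra_simps)
        then show ?thesis using 1 bd wv by simp
      next
        case wv: False
        define q where "q = card (?H - cutv E ?H - {v, w})"
        define c where "c = card (cutv E ?H - {v, w})"
        note cnt = end_branch_counts[OF fin con br(1,3,4) w br(2) wv, folded q_def c_def]
        define M where "M = ncs E ?H {v, w}"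
        have M: "q + 1 \<le> M" using cnt(5) card_spanning_edges_ge_1[OF finK(2) cH] by (simp add: M_def)
        \<comment> \<open>One estimate for both cases: if \<open>v\<close> is non-cut in the smaller
          graph, its linear contribution covers that of a cut vertex. The cycle term is dropped
          again.\<close>
        have NH: "2 * (c + 1) + q * (q + 1) + 2 \<le> 2 * ncs E ?H {w}"
        proof (cases "v \<in> cutv E ?H")
          case True
          then have "2 * (c + 1) + q * (q + 1) + 2 \<le> rooted_bound ?H w" using cnt(3) by (simp add: rooted_bound_def Let_def)
          then show ?thesis using IH by simp
        next
          case False
          then have "2 * c + (q + 1) * (q + 2) + 2 \<le> rooted_bound ?H w" using cnt(4) by (simp add: rooted_bound_def Let_def)
          then show ?thesis using IH by simp
        qed
        have "ncs E W {w} + M = ncs E ?H {w} + M * n1"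
          using ncs_glued_containing[OF g(1) finK(2,3) _ wv] g(2) w br(2) by (simp add: M_def n1_def)
        moreover obtain m where m: "n1 = m + 1" using n1 by (cases n1) auto
        ultimately have N: "ncs E W {w} = ncs E ?H {w} + M * m" by simp
        have "b * (b + 1) \<le> 2 * m" using n1 m by simp
        then have "(q + 1) * (b * (b + 1)) \<le> M * (2 * m)" by (rule mult_le_mono[OF M])
        then have 1: "2 * (c + 1) + q * (q + 1) + 2 + (q + 1) * (b * (b + 1)) \<le> 2 * ncs E W {w}"
          using N NH by simp
        have bd: "rooted_bound W w = 2 * (c + 1) + (q + b) * (q + b + 1) + 2"
          using cnt(1,2) nt bK by (simp add: rooted_bound_def Let_def algebra_simps)
        have "2 \<le> b + 1" using bK cK by simp
        then have "q * b * 2 \<le> q * b * (b + 1)" by (rule mult_le_mono2)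
        then have "rooted_bound W w \<le> 2 * (c + 1) + q * (q + 1) + 2 + (q + 1) * (b * (b + 1))"
          unfolding bd by (simp add: algebra_simps)
        then show ?thesis using 1 by simp
      qed
    qed
  qed
qed

lemma card_le_ncs:
  assumes "finite W" "conn E W" "w \<in> W"
  shows "card W \<le> ncs E W {w}"
proof -
  define P where "P = card (W - cutv E W - {w})"
  define J where "J = card (cutv E W - {w})"
  have fc: "finite (cutv E W)" using assms(1) cutv_subset finite_subset by metis
  have "W - {w} = (W - cutv E W - {w}) \<union> (cutv E W - {w})" using cutv_subset[of E W] by auto
  moreover have "card ((W - cutv E W - {w}) \<union> (cutv E W - {w})) = P + J"
    unfolding P_def J_def using assms(1) fc by (intro card_Un_disjoint) auto
  ultimately have "card W = P + J + 1" using assms(1,3) by (metis One_nat_def Suc_eq_plus1 card_Suc_Diff1)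
  moreover have "2 * J + P * (P + 1) + 2 \<le> rooted_bound W w" by (simp add: rooted_bound_def P_def J_def Let_def)
  moreover have "2 * P \<le> P * (P + 1)" by (cases P) auto
  ultimately show ?thesis using rooted_bound_le_ncs[OF assms] by linarith
qed

text \<open>Deleting a non-cut vertex loses at least \<open>card W\<close> subgraphs, by
  \<open>card_le_ncs\<close>. The resulting \<open>n (n + 1) / 2\<close> is the count for a path,
  see \<open>path_ncs\<close>.\<close>

lemma ncs_total_ge:
  assumes "finite W" "conn E W"
  shows "card W * (card W + 1) \<le> 2 * ncs E W {}"
  using assms
proof (induction "card W" arbitrary: W rule: less_induct)
  case less
  obtain v where v: "v \<in> W" using less.prems conn_nonempty by blast
  show ?case
  proof (cases "W = {v}")
    case True
    then show ?thesis using ncs_singleton[of "{}" v] by simp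
  next
    case False
    then obtain x where x: "x \<in> W" "conn E (W - {x})"
      using conn_remove_vertex[OF less.prems v] by blast
    have c: "card W = card (W - {x}) + 1" using x less.prems(1) by (metis Suc_eq_plus1 card_Suc_Diff1)
    then have "card (W - {x}) * (card (W - {x}) + 1) \<le> 2 * ncs E (W - {x}) {}"
      by (intro less.hyps) (use less.prems(1) x(2) in simp_all)
    moreover have "card W \<le> ncs E W {x}" using card_le_ncs[OF less.prems x(1)] .
    ultimately show ?thesis using ncs_split[OF less.prems(1), of x "{}" E] c by simp
  qed
qed

end

section \<open>Labelled models\<close>

text \<open>On \<open>{0, \<dots>, n - 1}\<close> this is \<open>L\<^bsub>n,g\<^esub>\<close>, and the path \<open>P\<^bsub>n\<^esub>\<close> for \<open>g = 2\<close>.\<close>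

definition lolli_adj :: "nat \<Rightarrow> nat \<Rightarrow> nat \<Rightarrow> bool" where
  "lolli_adj g i j \<longleftrightarrow> j = Suc i \<or> i = Suc j \<or> (i = 0 \<and> Suc j = g) \<or> (j = 0 \<and> Suc i = g)"

definition pendant_adj :: "nat \<Rightarrow> nat \<Rightarrow> (nat \<Rightarrow> nat \<Rightarrow> bool) \<Rightarrow> nat \<Rightarrow> nat \<Rightarrow> bool" where
  "pendant_adj n p R i j \<longleftrightarrow> (i < n \<and> j < n \<and> R i j) \<or> (i = n \<and> j = p) \<or> (j = n \<and> i = p)"

text \<open>\<open>Q\<^bsub>n,k\<^esub>\<close> with \<open>n = m + 1\<close> and \<open>h = n - k - 1\<close>: a second leaf next to the end of a lollipop.\<close>

definition fork_adj :: "nat \<Rightarrow> nat \<Rightarrow> nat \<Rightarrow> nat \<Rightarrow> bool" where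
  "fork_adj m h = pendant_adj m (m - 2) (lolli_adj h)"

definition models :: "'a set set \<Rightarrow> 'a set \<Rightarrow> nat \<Rightarrow> (nat \<Rightarrow> nat \<Rightarrow> bool) \<Rightarrow> (nat \<Rightarrow> 'a) \<Rightarrow> bool" where
  "models E W n R f \<longleftrightarrow> bij_betw f {..<n} W \<and> (\<forall>i<n. \<forall>j<n. {f i, f j} \<in> E \<longleftrightarrow> R i j)"

lemma models_card: "models E W n R f \<Longrightarrow> card W = n \<and> finite W"
  unfolding models_def by (metis bij_betw_finite bij_betw_same_card card_lessThan finite_lessThan)

lemma models_inj: "models E W n R f \<Longrightarrow> i < n \<Longrightarrow> j < n \<Longrightarrow> f i = f j \<longleftrightarrow> i = j"
  unfolding models_def bij_betw_def inj_on_def by auto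

lemma models_mem: "models E W n R f \<Longrightarrow> i < n \<Longrightarrow> f i \<in> W"
  unfolding models_def bij_betw_def by auto

lemma models_obtain:
  assumes "models E W n R f" "x \<in> W" obtains i where "i < n" "x = f i"
  using assms unfolding models_def bij_betw_def by auto

lemma models_edge: "models E W n R f \<Longrightarrow> i < n \<Longrightarrow> j < n \<Longrightarrow> {f i, f j} \<in> E \<longleftrightarrow> R i j"
  unfolding models_def by auto

lemma models_cong:
  assumes "models E W n R f" "\<And>i j. i < n \<Longrightarrow> j < n \<Longrightarrow> R i j \<longleftrightarrow> R' i j"
  shows "models E W n R' f"
  using assms unfolding models_def by auto

lemma models_restrict:
  assumes "models E W (Suc n) R f"
  shows "models E (W - {f n}) n R f"
proof -
  have "bij_betw f ({..<Suc n} - {n}) (W - {f n})"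
    using assms unfolding models_def bij_betw_def by (auto simp: inj_on_def)
  moreover have "{..<Suc n} - {n} = {..<n}" by auto
  ultimately show ?thesis using assms by (auto simp: models_def)
qed

lemma pendant_lolli:
  assumes "g \<le> n" "2 \<le> g" "i < Suc n" "j < Suc n"
  shows "pendant_adj n (n - 1) (lolli_adj g) i j \<longleftrightarrow> lolli_adj g i j"
  using assms unfolding pendant_adj_def lolli_adj_def by auto

lemma lolli_cycle_adj:
  assumes "2 \<le> g" "i < g" "j < g"
  shows "lolli_adj g i j \<longleftrightarrow> Suc i mod g = j \<or> Suc j mod g = i"
  using assms unfolding lolli_adj_def by (auto simp: mod_Suc)

lemma models_rotate1:
  assumes "models E W g (lolli_adj g) f" "2 \<le> g"
  shows "models E W g (lolli_adj g) (\<lambda>i. f (Suc i mod g))"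
proof -
  have inj: "inj_on (\<lambda>i. Suc i mod g) {..<g}"
    using assms(2) by (auto simp: inj_on_def mod_Suc split: if_splits)
  have sub: "(\<lambda>i. Suc i mod g) ` {..<g} \<subseteq> {..<g}" using assms(2) by auto
  have "bij_betw (\<lambda>i. Suc i mod g) {..<g} {..<g}"
    using endo_inj_surj[OF _ sub inj] inj by (simp add: bij_betw_def)
  then have "bij_betw (f \<circ> (\<lambda>i. Suc i mod g)) {..<g} W"
    using assms(1) bij_betw_trans unfolding models_def by blast
  then have bij: "bij_betw (\<lambda>i. f (Suc i mod g)) {..<g} W" by (simp add: comp_def)
  have "{f (Suc i mod g), f (Suc j mod g)} \<in> E \<longleftrightarrow> lolli_adj g i j" if "i < g" "j < g" for i j
  proof -
    have m: "Suc i mod g < g" "Suc j mod g < g" using assms(2) by auto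
    have *: "Suc (Suc a mod g) mod g = Suc c mod g \<longleftrightarrow> Suc a mod g = c" if "a < g" "c < g" for a c
      using inj that assms(2) unfolding inj_on_def by (metis lessThan_iff mod_less_divisor order_less_le_trans pos2)
    show ?thesis
      unfolding models_edge[OF assms(1) m] lolli_cycle_adj[OF assms(2) m] lolli_cycle_adj[OF assms(2) that]
      using *[OF that] *[OF that(2,1)] by blast
  qed
  then show ?thesis using bij by (simp add: models_def)
qed

text \<open>Each rotation lowers the label of \<open>v\<close> by one, and label \<open>0\<close>
  becomes \<open>g - 1\<close>. The last label is where \<open>pendant_lolli\<close> attaches the
  first tail vertex.\<close>

lemma models_rotate:
  assumes "models E W g (lolli_adj g) f" "2 \<le> g" "v \<in> W"
  shows "\<exists>f'. models E W g (lolli_adj g) f' \<and> f' (g - 1) = v"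
proof -
  have "\<exists>f'. models E W g (lolli_adj g) f' \<and> f' (g - 1) = v"
    if "models E W g (lolli_adj g) f" "i < g" "f i = v" for i f
    using that
  proof (induction i arbitrary: f)
    case 0
    then show ?case using models_rotate1[OF 0(1) assms(2)] assms(2) by (intro exI[of _ "\<lambda>i. f (Suc i mod g)"]) auto
  next
    case (Suc i)
    show ?case by (rule Suc.IH[OF models_rotate1[OF Suc.prems(1) assms(2)]]) (use Suc.prems in auto)
  qed
  then show ?thesis using models_obtain[OF assms(1,3)] assms(1) by metis
qed

context edges
begin

lemma models_extend:
  assumes "models E H n R f" "u \<notin> H" "p < n"
    and "\<And>x. x \<in> H \<Longrightarrow> {x, u} \<in> E \<longleftrightarrow> x = f p"
  shows "models E (insert u H) (Suc n) (pendant_adj n p R) (f(n := u))"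
proof -
  have "bij_betw (f(n := u)) {..<n} H"
    using assms(1) by (subst bij_betw_cong[of _ _ f]) (auto simp: models_def)
  moreover have "{..<Suc n} = insert n {..<n}" by auto
  ultimately have "bij_betw (f(n := u)) {..<Suc n} (insert u H)"
    using assms(2) notIn_Un_bij_betw[of n "{..<n}" "f(n := u)" H] by simp
  moreover have "{(f(n := u)) i, (f(n := u)) j} \<in> E \<longleftrightarrow> pendant_adj n p R i j" if ij: "i < Suc n" "j < Suc n" for i j
  proof -
    have m: "f i \<in> H" if "i < n" for i using models_mem[OF assms(1) that] .
    have e: "{f i, u} \<in> E \<longleftrightarrow> i = p" if "i < n" for i
      using assms(4)[OF m[OF that]] models_inj[OF assms(1) that assms(3)] by simp
    consider "i < n" "j < n" | "i < n" "j = n" | "i = n" "j < n" | "i = n" "j = n" using ij by linarith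
    then show ?thesis
    proof cases
      case 1
      then show ?thesis using models_edge[OF assms(1)] by (simp add: pendant_adj_def)
    next
      case 2
      then show ?thesis using e[of i] assms(3) by (auto simp: pendant_adj_def)
    next
      case 3
      then show ?thesis using e[of j] assms(3) by (auto simp: pendant_adj_def insert_commute)
    next
      case 4
      then show ?thesis using assms(3) no_loop by (auto simp: pendant_adj_def)
    qed
  qed
  ultimately show ?thesis by (simp add: models_def)
qed

lemma leaf_models_extend:
  assumes "branch E W v {u}" "conn E W" "models E (W - {u}) n R f" "p < n" "f p = v"
  shows "models E W (Suc n) (pendant_adj n p R) (f(n := u))"
proof -
  have "{x, u} \<in> E \<longleftrightarrow> x = f p" if "x \<in> W - {u}" for x
  proof (cases "x = v")
    case True
    then show ?thesis using leaf_edge[OF assms(1,2)] assms(5) by simp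
  next
    case False
    then have "{u, x} \<notin> E" using assms(1) that by (auto simp: branch_def)
    then show ?thesis using False assms(5) by (simp add: insert_commute)
  qed
  then have "models E (insert u (W - {u})) (Suc n) (pendant_adj n p R) (f(n := u))"
    using assms(3,4) by (intro models_extend) auto
  moreover have "insert u (W - {u}) = W" using assms(1) by (auto simp: branch_def)
  ultimately show ?thesis by simp
qed

lemma pendant_branch:
  assumes "models E W (Suc n) R f" "p < n" "\<And>i. i < n \<Longrightarrow> R n i \<longleftrightarrow> i = p"
  shows "branch E W (f p) {f n}"
proof -
  have "{f n, b} \<notin> E" if b: "b \<in> W - {f n} - {f p}" for b
  proof -
    obtain i where i: "i < Suc n" "b = f i" by (rule models_obtain[OF assms(1), of b]) (use b in auto)
    then have "i < n" "i \<noteq> p" using b by (auto simp: less_Suc_eq)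
    then show ?thesis using models_edge[OF assms(1), of n i] assms(3)[of i] i by simp
  qed
  moreover have "f n \<in> W" "f p \<in> W" "f p \<noteq> f n"
    using models_mem[OF assms(1)] models_inj[OF assms(1), of p n] assms(2) by auto
  ultimately show ?thesis by (auto simp: branch_def)
qed

lemma lolli_branch:
  assumes "models E W (Suc n) (lolli_adj g) f" "2 \<le> g" "g \<le> n"
  shows "branch E W (f (n - 1)) {f n}"
  by (rule pendant_branch[OF assms(1)]) (use assms in \<open>auto simp: lolli_adj_def\<close>)

text \<open>In a block with as many edges as vertices all degrees are at most two, so an st-numbering
  runs once around a cycle.\<close>

lemma biconn_cycle:
  assumes "finite B" "biconn E B" "card (E \<inter> Pow B) \<le> card B"
  shows "\<exists>f. models E B (card B) (lolli_adj (card B)) f"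
proof -
  let ?b = "card B"
  have c3: "3 \<le> ?b" using assms(2) by (simp add: biconn_def)
  \<comment> \<open>Three edges at \<open>x\<close> and at least \<open>b - 2\<close> edges of the
    connected set \<open>B - {x}\<close> would make \<open>b + 1\<close> edges.\<close>
  have deg: "False" if x: "x \<in> B" "y1 \<in> B" "y2 \<in> B" "y3 \<in> B" "{x, y1} \<in> E" "{x, y2} \<in> E" "{x, y3} \<in> E"
    and ne: "y1 \<noteq> y2" "y1 \<noteq> y3" "y2 \<noteq> y3" for x y1 y2 y3
  proof -
    let ?D = "{{x, y1}, {x, y2}, {x, y3}}"
    have "?D \<union> (E \<inter> Pow (B - {x})) \<subseteq> E \<inter> Pow B" using x by auto
    then have "card (?D \<union> (E \<inter> Pow (B - {x}))) \<le> card (E \<inter> Pow B)"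
      using assms(1) by (intro card_mono) auto
    moreover have "card (?D \<union> (E \<inter> Pow (B - {x}))) = card ?D + card (E \<inter> Pow (B - {x}))"
      using assms(1) by (intro card_Un_disjoint) auto
    moreover have "card ?D = 3" using ne by (auto simp: doubleton_eq_iff card_insert_if)
    moreover have "card (B - {x}) \<le> card (E \<inter> Pow (B - {x})) + 1"
      using assms(1) biconn_conn_remove[OF assms(2)] by (intro conn_card_edges) auto
    ultimately show False using assms(1,3) x(1) c3 by (simp add: card_Diff_singleton)
  qed
  have "B \<noteq> {}" using c3 by auto
  then obtain v where v: "v \<in> B" by blast
  obtain s where s: "s \<in> B" "{v, s} \<in> E" "s \<noteq> v" using biconn_two_neighbours[OF assms(2) v] by metis
  obtain zs where zs: "distinct zs" "set zs = B" "zs ! 0 = v" "zs ! (card B - 1) = s"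
    "\<And>i. 0 < i \<Longrightarrow> i \<le> card B \<Longrightarrow> conn E (set (take i zs))"
    "\<And>i. i < card B \<Longrightarrow> conn E (set (drop i zs))"
    using st_numbering[OF assms(1,2) v s(1,2)] s(3) by metis
  define f where "f = (!) zs"
  have len: "length zs = ?b" using zs(1,2) distinct_card by metis
  have inj: "f i = f j \<longleftrightarrow> i = j" if "i < ?b" "j < ?b" for i j
    using that zs(1) len by (simp add: f_def nth_eq_iff_index_eq)
  have mem: "f i \<in> B" if "i < ?b" for i using that zs(2) len by (auto simp: f_def)
  have d3: False if "i < ?b" "j1 < ?b" "j2 < ?b" "j3 < ?b" "{f i, f j1} \<in> E" "{f i, f j2} \<in> E" "{f i, f j3} \<in> E"
    "j1 \<noteq> j2" "j1 \<noteq> j3" "j2 \<noteq> j3" for i j1 j2 j3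
    by (rule deg[of "f i" "f j1" "f j2" "f j3"]) (use that mem inj in auto)
  have close: "{f 0, f (?b - 1)} \<in> E" using zs(3,4) s by (simp add: f_def)
  have lower: "\<exists>l<j. {f j, f l} \<in> E" if j: "0 < j" "j < ?b" for j
  proof -
    have "f j \<in> set (take (Suc j) zs)" using that len by (auto simp: f_def take_Suc_conv_app_nth)
    moreover have "f 0 \<in> set (take (Suc j) zs)" using that len by (auto simp: f_def in_set_conv_nth intro!: exI[of _ 0])
    moreover have "f 0 \<noteq> f j" using inj[of 0 j] that by auto
    ultimately have m: "f j \<in> set (take (Suc j) zs)" "set (take (Suc j) zs) \<noteq> {f j}" by auto
    have "conn E (set (take (Suc j) zs))" using zs(5)[of "Suc j"] j by simp
    from conn_neighbour[OF this m] obtain a where a: "a \<in> set (take (Suc j) zs)" "a \<noteq> f j" "{f j, a} \<in> E" .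
    then obtain l where "l < Suc j" "a = f l" using j len by (auto simp: f_def in_set_conv_nth)
    then show ?thesis using a by (auto simp: less_Suc_eq)
  qed
  \<comment> \<open>Some earlier \<open>f l\<close> is adjacent to \<open>f (Suc i)\<close>. If
    \<open>l < i\<close>, it is already adjacent to its successor and also to an earlier vertex or,
    for \<open>l = 0\<close>, to the last one; a third neighbour is impossible.\<close>
  have step: "{f i, f (Suc i)} \<in> E" if "Suc i < ?b - 1" for i
    using that
  proof (induction i rule: less_induct)
    case (less i)
    have ib: "Suc i < ?b" using less.prems by simp
    obtain l where l: "l < Suc i" "{f (Suc i), f l} \<in> E" using lower[OF _ ib] by auto
    then have l': "{f l, f (Suc i)} \<in> E" by (simp add: insert_commute)
    show ?case
    proof (cases "l = i")
      case True
      then show ?thesis using l' by simp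
    next
      case False
      then have li: "l < i" using l by simp
      then have up: "{f l, f (Suc l)} \<in> E" using less by simp
      show ?thesis
      proof (cases "l = 0")
        case True
        have False
          by (rule d3[of 0 "?b - 1" "Suc 0" "Suc i"]) (use close up l' True li less.prems in auto)
        then show ?thesis ..
      next
        case False
        moreover have "l < ?b" using li ib by simp
        ultimately obtain m where m: "m < l" "{f l, f m} \<in> E" using lower[of l] by auto
        have False
          by (rule d3[of l m "Suc l" "Suc i"]) (use up l' m li ib in auto)
        then show ?thesis ..
      qed
    qed
  qed
  have last: "{f (?b - 2), f (?b - 1)} \<in> E"
  proof -
    have dr: "drop (?b - 2) zs = [f (?b - 2), f (?b - 1)]"
      using c3 len by (intro nth_equalityI) (auto simp: f_def less_Suc_eq nth_Cons' Suc_diff_Suc numeral_2_eq_2)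
    have "conn E (set (drop (?b - 2) zs))" using zs(6)[of "?b - 2"] c3 by simp
    then have cc: "conn E {f (?b - 2), f (?b - 1)}" using dr by simp
    have ne: "f (?b - 2) \<noteq> f (?b - 1)" using inj[of "?b - 2" "?b - 1"] c3 by auto
    obtain a where "a \<in> {f (?b - 2), f (?b - 1)}" "a \<noteq> f (?b - 2)" "{f (?b - 2), a} \<in> E"
      by (rule conn_neighbour[OF cc, of "f (?b - 2)"]) (use ne in auto)
    then show ?thesis by auto
  qed
  have consec: "{f i, f (Suc i)} \<in> E" if "Suc i < ?b" for i
  proof (cases "Suc i < ?b - 1")
    case True
    then show ?thesis using step by simp
  next
    case False
    then have "i = ?b - 2" "Suc i = ?b - 1" using that by auto
    then show ?thesis using last by simp
  qed
  have fwd: "{f i, f j} \<in> E" if ij: "i < ?b" "j < ?b" "lolli_adj ?b i j" for i j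
  proof -
    consider "j = Suc i" | "i = Suc j" | "i = 0" "j = ?b - 1" | "j = 0" "i = ?b - 1"
      using ij(3) unfolding lolli_adj_def by force
    then show ?thesis
      by cases (use consec[of i] consec[of j] close ij in \<open>simp_all add: insert_commute\<close>)
  qed
  have bwd: "lolli_adj ?b i j" if ij: "i < ?b" "j < ?b" "{f i, f j} \<in> E" for i j
  proof (rule ccontr)
    assume nl: "\<not> lolli_adj ?b i j"
    obtain p r where pr: "p < ?b" "r < ?b" "p \<noteq> r" "lolli_adj ?b i p" "lolli_adj ?b i r"
    proof (cases "i = 0 \<or> Suc i = ?b")
      case True
      then show ?thesis
      proof
        assume "i = 0" then show ?thesis using c3 by (intro that[of 1 "?b - 1"]) (auto simp: lolli_adj_def)
      next
        assume "Suc i = ?b" then show ?thesis using c3 by (intro that[of 0 "i - 1"]) (auto simp: lolli_adj_def)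
      qed
    next
      case False
      then show ?thesis using ij by (intro that[of "i - 1" "Suc i"]) (auto simp: lolli_adj_def)
    qed
    show False
      by (rule d3[of i p r j]) (use fwd[of i p] fwd[of i r] pr ij nl in auto)
  qed
  have "bij_betw f {..<?b} B" unfolding f_def using zs(1,2) len by (intro bij_betw_nth) auto
  then have "models E B ?b (lolli_adj ?b) f" using fwd bwd by (auto simp: models_def)
  then show ?thesis by blast
qed

end

section \<open>The extremal bound\<close>

text \<open>Twice the number of connected subgraphs of the lollipop with a cycle of length \<open>g\<close> and a tail of \<open>k\<close> edges.\<close>

definition lolli_count :: "nat \<Rightarrow> nat \<Rightarrow> nat" where
  "lolli_count g k = 2 * (g * g) + 2 + k * (k + 1) + k * (g * (g + 1) + 2)"

text \<open>\<open>p\<close>, \<open>q\<close> count the non-cut and \<open>x\<close>,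
  \<open>y\<close> the cut vertices other than \<open>v\<close> on the two sides of a cut vertex
  \<open>v\<close>, the first side containing a cycle. \<open>L\<close> is the product of the
  doubled rooted bounds, and \<open>R\<close> is four times the required
  \<open>2 * h + k * (h + 1)\<close> with \<open>h = p + q\<close> and
  \<open>k = x + y + 1\<close>.\<close>

lemma cut_leaf_arith:
  fixes p q x y :: nat
  assumes "2 \<le> p" "1 \<le> q" "x + y \<le> p"
  defines "L \<equiv> (2 * x + (p + 1) * (p + 2) + 2) * (2 * y + q * (q + 1) + 2)"
    and "R \<equiv> 4 * (2 * (p + q) + (x + y + 1) * (p + q + 1))"
  shows "R \<le> L" and "L = R \<Longrightarrow> q = 1 \<and> y = 0 \<and> x = p"
proof -
  have "R \<le> L \<and> (L = R \<longrightarrow> q = 1 \<and> y = 0 \<and> x = p)"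
  proof (cases "q = 1")
    case True
    obtain d where d: "p = x + y + d" using assms(3) le_Suc_ex by blast
    have eq: "L = R + (4 * (x * y) + 4 * (p * (y + d)) + 2 * (y * ((p + 1) * p)))"
      unfolding L_def R_def True d by (simp add: algebra_simps)
    have "q = 1 \<and> y = 0 \<and> x = p" if "L = R"
    proof -
      have "p * (y + d) = 0" using eq that by simp
      then have "y + d = 0" using assms(1) by simp
      then show ?thesis using d True by simp
    qed
    moreover have "R \<le> L" using eq by linarith
    ultimately show ?thesis by blast
  next
    case False
    \<comment> \<open>After substituting \<open>q = r + 2\<close> and \<open>p = s + 2\<close> the
      strict inequality becomes one between polynomials whose difference has nonnegative
      coefficients.\<close>
    define r s where "r = q - 2" and "s = p - 2"
    then have r: "q = r + 2" and s: "p = s + 2" using False assms(1,2) by linarith+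
    have "(x + y + 1) * (p + q + 1) \<le> (p + 1) * (p + q + 1)" using assms(3) by (intro mult_le_mono1) simp
    then have "R \<le> 4 * (2 * (p + q) + (p + 1) * (p + q + 1))" unfolding R_def by simp
    also have "\<dots> < ((p + 1) * (p + 2) + 2) * (q * (q + 1) + 2)"
      unfolding r s by (simp add: algebra_simps)
    also have "\<dots> \<le> L" unfolding L_def by (rule mult_le_mono) simp_all
    finally show ?thesis by simp
  qed
  then show "R \<le> L" "L = R \<Longrightarrow> q = 1 \<and> y = 0 \<and> x = p" by auto
qed

text \<open>\<open>c\<close> counts the vertices other than \<open>v\<close> of the removed end
  block and \<open>q\<close> the non-cut vertices other than \<open>v\<close> of the rest. On the
  right are the bounds for the two parts avoiding each other and for their product, all scaled by
  four; \<open>k \<le> c + 1\<close> is the girth condition for the block.\<close>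

lemma no_leaf_arith:
  fixes c q k :: nat
  assumes "1 \<le> q" "2 \<le> c" "1 \<le> k" "k \<le> c + 1"
  shows "2 * lolli_count (q + c) k
    < 2 * ((k + q) * (k + q + 1)) + 2 * ((c + 1) * c) + (2 * k + (q + 1) * (q + 2)) * ((c + 1) * (c + 2))"
    (is "?R < ?L")
proof -
  define C Q k' where "C = int c" and "Q = int q" and "k' = int k"
  \<comment> \<open>The difference of the sides is an exact combination of these nonnegative terms,
    computed over the integers; \<open>8 * Q\<close> makes it strict. The girth condition is needed
    for \<open>Z\<close>.\<close>
  define X Y Z where "X = (Q * Q - Q) * ((C + 1) * C - 2)"
    and "Y = (C + 1) * (C + 2) - 2" and "Z = (C + 1 - k') * (Q - 1) * (2 * C + Q)"
  have eq: "int ?L - int ?R = X + 8 * Q + 4 * Y + 2 * Z"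
    unfolding lolli_count_def X_def Y_def Z_def C_def Q_def k'_def by (simp add: algebra_simps)
  have "0 \<le> X" unfolding X_def
  proof (rule mult_nonneg_nonneg)
    show "0 \<le> Q * Q - Q" using assms(1) mult_mono[of 1 Q Q Q] by (simp add: Q_def)
    show "0 \<le> (C + 1) * C - 2" using assms(2) mult_mono[of 1 "C + 1" 2 C] by (simp add: C_def)
  qed
  moreover have "0 \<le> Z" unfolding Z_def
    using assms by (intro mult_nonneg_nonneg) (auto simp: C_def Q_def k'_def)
  moreover have "0 \<le> Y" unfolding Y_def using mult_mono[of 1 "C + 1" 2 "C + 2"] by (simp add: C_def)
  moreover have "0 < Q" using assms(1) by (simp add: Q_def)
  ultimately have "0 < int ?L - int ?R" unfolding eq by linarith
  then have "int ?R < int ?L" by (simp only: diff_gt_0_iff_gt)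
  then show ?thesis by (simp only: of_nat_less_iff)
qed

context edges
begin

text \<open>A leaf added at a cut vertex must pay for a cycle longer by one:
  \<open>2 * h + k * (h + 1)\<close> is the growth of the extremal count from cycle length
  \<open>h\<close> to \<open>h + 1\<close>, minus the leaf itself. The two sides of \<open>v\<close>
  multiply, and \<open>k \<le> card S \<le> p + 1\<close> gives
  \<open>x + y \<le> p\<close>.\<close>

lemma cut_leaf_bound:
  assumes fin: "finite H" and con: "conn E H" and v: "v \<in> cutv E H" and S: "S \<subseteq> H" "biconn E S"
    and girth: "\<And>S. S \<subseteq> H \<Longrightarrow> biconn E S \<Longrightarrow> card (cutv E H) \<le> card S"
  defines "k \<equiv> card (cutv E H)" and "h \<equiv> card (H - cutv E H)"
  shows "2 * h + k * (h + 1) \<le> ncs E H {v}"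
    and "ncs E H {v} = 2 * h + k * (h + 1) \<Longrightarrow> h = k \<and> card S = k \<and> (\<exists>x. branch E H v {x})"
proof -
  have vH: "v \<in> H" "H \<noteq> {v}" using v by (auto simp: cutv_def)
  obtain y where "y \<in> H" "y \<noteq> v" using vH by auto
  then obtain K where K: "branch E H v K" using branch_exists[of v H y E] vH(1) by blast
  have HK: "H \<noteq> insert v K" using cutv_branch[OF v K] .
  note gK = branch_glued[OF K]
  obtain A B where AB: "glued E A B v" "H = A \<union> B" "S \<subseteq> A" "A \<noteq> {v}" "B \<noteq> {v}"
    and br: "branch E H v (A - {v}) \<or> branch E H v (B - {v})"
  proof -
    have v1: "v \<in> H - K" using K by (auto simp: branch_def)
    then have n: "insert v K \<noteq> {v}" "H - K \<noteq> {v}" "insert v K - {v} = K"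
      using HK branch_nonempty[OF K] K by (auto simp: branch_def)
    from biconn_branch[OF K S(2,1)] show ?thesis
    proof
      assume "S \<subseteq> H - K"
      then show ?thesis using n gK K by (intro that[of "H - K" "insert v K"]) auto
    next
      assume "S \<subseteq> insert v K"
      then show ?thesis using n glued_commute[OF gK(1)] gK(2) K
        by (intro that[of "insert v K" "H - K"]) (auto simp: Un_commute)
    qed
  qed
  have ABv: "A \<inter> B = {v}" using AB(1) by (simp add: glued_def)
  have finA: "finite A" "finite B" using fin AB(2) by auto
  have cA: "conn E A" "conn E B" using glued_conn_iff[OF AB(1)] con AB(2) by auto
  define p where "p = card (A - cutv E A - {v})"
  define x where "x = card (cutv E A - {v})"
  define q where "q = card (B - cutv E B - {v})"
  define y where "y = card (cutv E B - {v})"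
  have c1: "cutv E H - B = cutv E A - {v}" using glued_cutv[OF AB(1)] con AB(2) by simp
  have c2: "cutv E H - A = cutv E B - {v}"
    using glued_cutv[OF glued_commute[OF AB(1)]] con AB(2) by (simp add: Un_commute)
  have fc: "finite (cutv E A)" "finite (cutv E B)" using finA cutv_subset finite_subset by metis+
  have sub: "cutv E A \<subseteq> A" "cutv E B \<subseteq> B" by (rule cutv_subset)+
  have only: "z = v" if "z \<in> A" "z \<in> B" for z using that ABv by auto
  have "cutv E H = insert v ((cutv E H - B) \<union> (cutv E H - A))" using v only cutv_subset[of E H] AB(2) by auto
  then have cH: "cutv E H = insert v ((cutv E A - {v}) \<union> (cutv E B - {v}))" unfolding c1 c2 .
  have k: "k = x + y + 1"
  proof -
    have "card ((cutv E A - {v}) \<union> (cutv E B - {v})) = x + y"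
      unfolding x_def y_def using fc sub only by (intro card_Un_disjoint) auto
    then show ?thesis unfolding k_def cH using fc by simp
  qed
  have "A \<union> B - insert v ((cutv E A - {v}) \<union> (cutv E B - {v})) = (A - cutv E A - {v}) \<union> (B - cutv E B - {v})"
    using only sub by blast
  then have "H - cutv E H = (A - cutv E A - {v}) \<union> (B - cutv E B - {v})"
    unfolding cH using AB(2) by simp
  moreover have "card ((A - cutv E A - {v}) \<union> (B - cutv E B - {v})) = p + q"
    unfolding p_def q_def using finA only by (intro card_Un_disjoint) auto
  ultimately have h: "h = p + q" by (simp add: h_def)
  have ntA: "nontree E A" using S(2) AB(3) by (auto simp: nontree_def)
  have "card S \<le> card (A - cutv E A)" using biconn_card_le_noncut[OF finA(1) cA(1) S(2) AB(3)] .
  also have "\<dots> \<le> card (insert v (A - cutv E A - {v}))" using finA by (intro card_mono) auto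
  also have "\<dots> = p + 1" unfolding p_def using finA by (subst card_insert_disjoint) auto
  finally have Sp: "card S \<le> p + 1" .
  have "k \<le> card S" using girth[OF S] by (simp add: k_def)
  then have xyp: "x + y \<le> p" using Sp k by simp
  have p2: "2 \<le> p" using Sp S(2) by (auto simp: biconn_def)
  have vB: "v \<in> B" "v \<in> A" using ABv by auto
  obtain z where "z \<in> B" "z \<noteq> v" "conn E (B - {z})" using conn_remove_vertex[OF finA(2) cA(2) vB(1) AB(5)] by blast
  then have "z \<in> B - cutv E B - {v}" by (simp add: cutv_def)
  then have q1: "1 \<le> q" unfolding q_def using finA by (metis One_nat_def Suc_leI card_gt_0_iff empty_iff finite_Diff)
  have NA: "2 * x + (p + 1) * (p + 2) + 2 \<le> 2 * ncs E A {v}"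
  proof -
    have "rooted_bound A v = 2 * x + p * (p + 1) + 2 + (2 * p + 2)"
      using ntA by (simp add: rooted_bound_def p_def x_def Let_def)
    then show ?thesis using rooted_bound_le_ncs[OF finA(1) cA(1) vB(2)] by (simp add: algebra_simps)
  qed
  have NB: "2 * y + q * (q + 1) + 2 \<le> 2 * ncs E B {v}"
  proof -
    have "2 * y + q * (q + 1) + 2 \<le> rooted_bound B v"
      by (simp add: rooted_bound_def q_def y_def Let_def)
    then show ?thesis using rooted_bound_le_ncs[OF finA(2) cA(2) vB(1)] by simp
  qed
  have N: "ncs E H {v} = ncs E A {v} * ncs E B {v}"
    using ncs_glued[OF AB(1), of "{v}" "{v}"] vB AB(2) by simp
  let ?L = "(2 * x + (p + 1) * (p + 2) + 2) * (2 * y + q * (q + 1) + 2)"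
  have "?L \<le> (2 * ncs E A {v}) * (2 * ncs E B {v})" by (rule mult_le_mono[OF NA NB])
  then have L: "?L \<le> 4 * ncs E H {v}" by (simp add: N)
  have R: "4 * (2 * (p + q) + (x + y + 1) * (p + q + 1)) = 4 * (2 * h + k * (h + 1))" by (simp add: h k)
  note ar = cut_leaf_arith[OF p2 q1 xyp]
  have "4 * (2 * h + k * (h + 1)) \<le> 4 * ncs E H {v}" using order_trans[OF ar(1) L] unfolding R .
  then show "2 * h + k * (h + 1) \<le> ncs E H {v}" by simp
  assume eq: "ncs E H {v} = 2 * h + k * (h + 1)"
  then have "?L \<le> 4 * (2 * (p + q) + (x + y + 1) * (p + q + 1))" using L unfolding R by simp
  then have "q = 1 \<and> y = 0 \<and> x = p" by (intro ar(2) antisym ar(1))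
  then have qy: "q = 1" "y = 0" "x = p" by auto
  then have "h = k" "card S = k" using h k Sp \<open>k \<le> card S\<close> by auto
  moreover have "\<exists>x. branch E H v {x}"
  proof -
    \<comment> \<open>Equality leaves one non-cut vertex and no cut vertex besides \<open>v\<close>
      on the side \<open>B\<close>, so \<open>B\<close> is a pendant edge.\<close>
    obtain t where t: "B - cutv E B - {v} = {t}" using qy(1) unfolding q_def by (auto simp: card_1_singleton_iff)
    have "cutv E B - {v} = {}" using qy(2) fc unfolding y_def by simp
    then have Bt: "B = {v, t}" using t vB by auto
    then have tv: "t \<noteq> v" using AB(5) by auto
    have "{t, b} \<notin> E" if "b \<in> H - {t} - {v}" for b
    proof -
      have "b \<in> A - {v}" "t \<in> B - {v}" using that Bt AB(2) tv by auto
      then have "{b, t} \<notin> E" using AB(1) by (simp add: glued_def)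
      then show ?thesis by (simp add: insert_commute)
    qed
    then have "branch E H v {t}" using Bt AB(2) tv vH by (auto simp: branch_def)
    then show ?thesis by blast
  qed
  ultimately show "h = k \<and> card S = k \<and> (\<exists>x. branch E H v {x})" by simp
qed

text \<open>Every end block is now two-connected, so the removed one satisfies the block bound, and
  the rest, containing another one, satisfies the rooted bound with its cycle term.\<close>

lemma no_leaf_bound:
  assumes fin: "finite W" and con: "conn E W" and cut: "cutv E W \<noteq> {}"
    and girth: "\<And>S. S \<subseteq> W \<Longrightarrow> biconn E S \<Longrightarrow> card (cutv E W) \<le> card S"
    and no_leaf: "\<And>v u. \<not> branch E W v {u}"
  shows "lolli_count (card W - card (cutv E W)) (card (cutv E W)) < 2 * ncs E W {}"
proof -
  obtain w where "w \<in> W" using conn_nonempty[OF con] by blast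
  then obtain v K where br: "branch E W v K" "cutv E (insert v K) = {}" "W \<noteq> insert v K"
    using end_branch_avoiding[OF fin con cut] by metis
  let ?H = "W - K" and ?B = "insert v K"
  have bic: "biconn E (insert v' K')" if b: "branch E W v' K'" "cutv E (insert v' K') = {}" for v' K'
  proof -
    have K': "K' \<subseteq> W" "v' \<notin> K'" using b by (auto simp: branch_def)
    then have fK: "finite K'" using fin finite_subset by blast
    have "card K' \<noteq> 1" using no_leaf b(1) by (auto simp: card_1_singleton_iff)
    moreover have "card K' \<noteq> 0" using branch_nonempty[OF b(1)] fK by simp
    ultimately have "2 \<le> card K'" by linarith
    then show ?thesis using b(2) branch_conn(2)[OF b(1) con] K' fK by (simp add: biconn_def)
  qed
  have K: "K \<subseteq> W" "v \<in> W" "v \<notin> K" "K \<noteq> {}" using br(1) branch_nonempty[OF br(1)] by (auto simp: branch_def)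
  have finK: "finite K" "finite ?H" "finite ?B" using finite_subset[OF K(1) fin] fin by auto
  have cH: "conn E ?H" and cB: "conn E ?B" using branch_conn[OF br(1) con] by auto
  have vH: "v \<in> ?H" using K by auto
  have Hv: "?H \<noteq> {v}" using br(3) K by auto
  have B: "biconn E ?B" using bic[OF br(1,2)] .
  \<comment> \<open>A second branch at \<open>v\<close> contains an end block that is disjoint from
    \<open>K\<close>.\<close>
  have ntH: "nontree E ?H"
  proof -
    obtain x where x: "x \<in> W" "x \<noteq> v" "x \<notin> K" using Hv vH by auto
    obtain L where L: "branch E W v L" "x \<in> L" using branch_exists[of v W x E] K x by blast
    have KL: "K \<inter> L = {}" using branch_disjoint[OF br(1) L(1)] x L(2) by blast
    obtain v' K' where e: "branch E W v' K'" "K' \<subseteq> L" "v' \<in> insert v L" "cutv E (insert v' K') = {}"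
      using end_branch[OF fin con L(1)] by blast
    have "L \<subseteq> W" using L(1) by (simp add: branch_def)
    then have "insert v L \<subseteq> ?H" using KL K by blast
    then have "insert v' K' \<subseteq> ?H" using e by blast
    then show ?thesis using bic[OF e(1,4)] unfolding nontree_def by blast
  qed
  define c where "c = card K"
  define q where "q = card (?H - cutv E ?H - {v})"
  define j where "j = card (cutv E ?H - {v})"
  define k where "k = card (cutv E W)"
  note r = branch_remove_cutv[OF br(1) con br(3,2)]
  have fc: "finite (cutv E ?H)" using finK cutv_subset finite_subset by metis
  have k: "k = j + 1" unfolding k_def r(1) j_def using fc by (subst card_insert_disjoint) auto
  have g: "card W - k = q + c"
  proof -
    have "card W - k = card (W - cutv E W)" unfolding k_def
      using fin cutv_subset finite_subset by (metis card_Diff_subset)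
    also have "\<dots> = c + q" unfolding r(2) c_def q_def using finK by (intro card_Un_disjoint) auto
    finally show ?thesis by simp
  qed
  have "?H - {v} = (?H - cutv E ?H - {v}) \<union> (cutv E ?H - {v})" using cutv_subset[of E ?H] by auto
  moreover have "card ((?H - cutv E ?H - {v}) \<union> (cutv E ?H - {v})) = q + j"
    unfolding q_def j_def using finK fc by (intro card_Un_disjoint) auto
  ultimately have cardH: "card ?H = k + q" using card_Suc_Diff1[OF finK(2) vH] k by simp
  have cB3: "card ?B = c + 1" using finK K by (simp add: c_def)
  then have c2: "2 \<le> c" using B by (simp add: biconn_def)
  have kc: "k \<le> c + 1" using girth[of ?B] B K cB3 by (simp add: k_def)
  obtain z where "z \<in> ?H" "z \<noteq> v" "conn E (?H - {z})" using conn_remove_vertex[OF finK(2) cH vH Hv] by blast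
  then have "z \<in> ?H - cutv E ?H - {v}" by (simp add: cutv_def)
  then have q1: "1 \<le> q" unfolding q_def using finK by (metis One_nat_def Suc_leI card_gt_0_iff empty_iff finite_Diff)
  define N where "N = ncs E ?H {v}"
  have N: "2 * k + (q + 1) * (q + 2) \<le> 2 * N"
  proof -
    have "rooted_bound ?H v = 2 * j + q * (q + 1) + 2 + (2 * q + 2)"
      using ntH by (simp add: rooted_bound_def q_def j_def Let_def)
    then show ?thesis using rooted_bound_le_ncs[OF finK(2) cH vH] k by (simp add: N_def algebra_simps)
  qed
  have n1: "(c + 1) * (c + 2) + 2 \<le> 2 * ncs E ?B {v}" using biconn_ncs'[OF finK(3) B, of v] cB3 by simp
  then obtain m where m: "ncs E ?B {v} = m + 1" by (cases "ncs E ?B {v}") auto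
  then have m2: "(c + 1) * (c + 2) \<le> 2 * m" using n1 by simp
  have "?B - {v} = K" using K by auto
  then have "ncs E W {} + N = ncs E ?H {} + ncs E K {} + N * (m + 1)"
    using ncs_glued_total[OF branch_glued(1)[OF br(1)] finK(2,3)] branch_glued(2)[OF br(1)] m by (simp add: N_def)
  then have F: "ncs E W {} = ncs E ?H {} + ncs E K {} + N * m" by simp
  have FH: "(k + q) * (k + q + 1) \<le> 2 * ncs E ?H {}" using ncs_total_ge[OF finK(2) cH] cardH by simp
  have "conn E K" using br(1) by (simp add: branch_def)
  then have FK: "(c + 1) * c \<le> 2 * ncs E K {}" using ncs_total_ge[OF finK(1)] by (simp add: c_def mult.commute)
  have "(2 * k + (q + 1) * (q + 2)) * ((c + 1) * (c + 2)) \<le> (2 * N) * (2 * m)" by (rule mult_le_mono[OF N m2])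
  then have "2 * ((k + q) * (k + q + 1)) + 2 * ((c + 1) * c) + (2 * k + (q + 1) * (q + 2)) * ((c + 1) * (c + 2))
      \<le> 2 * (2 * ncs E W {})" using F FH FK by simp
  moreover have "1 \<le> k" using k by simp
  ultimately show ?thesis using no_leaf_arith[OF q1 c2 _ kc] g by (simp add: k_def)
qed

text \<open>The fork alternative also records a two-connected set of size \<open>k\<close>. This is
  what excludes it as an intermediate graph: if a leaf raises the number of cut vertices to
  \<open>k + 1\<close>, the girth assumption forbids such a set.\<close>

definition extremal_shape :: "'a set \<Rightarrow> nat \<Rightarrow> bool" where
  "extremal_shape W k \<longleftrightarrow> (\<exists>f. models E W (card W) (lolli_adj (card W - k)) f) \<or>
     (card W = 2 * k + 1 \<and> (\<exists>S\<subseteq>W. biconn E S \<and> card S = k) \<and> (\<exists>f. models E W (card W) (fork_adj (2 * k) k) f))"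

text \<open>Removing a leaf never raises the number of cut vertices, so the assumption on
  two-connected sets is inherited. A leaf at a vertex that was not a cut vertex is compared with a
  longer tail, a leaf at a cut vertex with a longer cycle.\<close>

theorem lolli_count_le_ncs:
  assumes "finite W" "conn E W" "nontree E W"
    and "\<And>S. S \<subseteq> W \<Longrightarrow> biconn E S \<Longrightarrow> card (cutv E W) \<le> card S"
  shows "lolli_count (card W - card (cutv E W)) (card (cutv E W)) \<le> 2 * ncs E W {} \<and>
    (2 * ncs E W {} = lolli_count (card W - card (cutv E W)) (card (cutv E W)) \<longrightarrow> extremal_shape W (card (cutv E W)))"
  using assms
proof (induction "card W" arbitrary: W rule: less_induct)
  case less
  note fin = less.prems(1) and con = less.prems(2) and nt = less.prems(3) and girth = less.prems(4)
  obtain S where S: "S \<subseteq> W" "biconn E S" using nt by (auto simp: nontree_def)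
  have W3: "3 \<le> card W" using S card_mono[OF fin S(1)] by (auto simp: biconn_def)
  consider (block) "cutv E W = {}" | (leaf) v u where "cutv E W \<noteq> {}" "branch E W v {u}"
    | (no_leaf) "cutv E W \<noteq> {}" "\<And>v u. \<not> branch E W v {u}" by blast
  then show ?case
  proof cases
    case no_leaf
    then show ?thesis using no_leaf_bound[OF fin con no_leaf(1) girth no_leaf(2)] by simp
  next
    case block
    then have B: "biconn E W" using con W3 by (simp add: biconn_def)
    obtain v where v: "v \<in> W" using conn_nonempty[OF con] by blast
    obtain b where b: "card W = Suc b" using W3 by (cases "card W") auto
    \<comment> \<open>Subgraphs avoiding \<open>v\<close> are bounded as in a path, those through
      \<open>v\<close> by the block bound. The slack left is the excess of edges over vertices, so
      equality means a cycle.\<close>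
    have "b * (b + 1) \<le> 2 * ncs E (W - {v}) {}"
      using ncs_total_ge[of "W - {v}"] biconn_conn_remove[OF B] fin v b by (simp add: card_Diff_singleton)
    moreover have "(b + 1) * b + 2 * card (E \<inter> Pow W) + 2 \<le> 2 * ncs E W {v}" using biconn_ncs[OF fin B v] b by simp
    moreover have "ncs E W {} = ncs E (W - {v}) {} + ncs E W {v}" using ncs_split[OF fin, of v "{}" E] by simp
    ultimately have 1: "b * (b + 1) + (b + 1) * b + 2 * card (E \<inter> Pow W) + 2 \<le> 2 * ncs E W {}" by simp
    have 2: "lolli_count (card W) 0 = b * (b + 1) + (b + 1) * b + 2 * card W + 2"
      using b by (simp add: lolli_count_def algebra_simps)
    have 3: "card W \<le> card (E \<inter> Pow W)" using biconn_card_edges[OF fin B] .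
    have "extremal_shape W 0" if "2 * ncs E W {} = lolli_count (card W) 0"
    proof -
      have "card (E \<inter> Pow W) \<le> card W" using that 1 2 by simp
      from biconn_cycle[OF fin B this] show ?thesis by (simp add: extremal_shape_def)
    qed
    then show ?thesis using 1 2 3 block by simp
  next
    case leaf
    let ?H = "W - {u}"
    have uv: "u \<noteq> v" "u \<in> W" "v \<in> W" using leaf(2) by (auto simp: branch_def)
    have c0: "cutv E (insert v {u}) = {}" using uv by (auto simp: cutv_def insert_Diff_if)
    then have Wuv: "W \<noteq> insert v {u}" using leaf(1) by metis
    have finH: "finite ?H" using fin by simp
    have cH: "conn E ?H" using branch_conn(1)[OF leaf(2) con] .
    have vH: "v \<in> ?H" using uv by auto
    have ntH: "nontree E ?H" using leaf_nontree[OF leaf(2) nt] .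
    have cardW: "card W = card ?H + 1" using fin uv(2) by (metis Suc_eq_plus1 card_Suc_Diff1)
    then have ltH: "card ?H < card W" by simp
    have F: "ncs E W {} = ncs E ?H {} + 1 + ncs E ?H {v}" using leaf_ncs(1)[OF fin con leaf(2)] .
    have cW: "cutv E W = insert v (cutv E ?H - {v})"
      using branch_remove_cutv(1)[OF leaf(2) con Wuv c0] .
    have fc: "finite (cutv E ?H)" using finH cutv_subset finite_subset by metis
    define k where "k = card (cutv E ?H)"
    define h where "h = card (?H - cutv E ?H)"
    have hk: "card ?H - k = h" unfolding k_def h_def using fc cutv_subset by (metis card_Diff_subset)
    have cardH: "card ?H = h + k"
      unfolding k_def h_def using finH cutv_subset[of E ?H] by (metis card_mono card_Diff_subset fc le_add_diff_inverse2)
    show ?thesis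
    proof (cases "v \<in> cutv E ?H")
      case False
      then have kW: "card (cutv E W) = k + 1" unfolding cW k_def using fc by simp
      have gW: "card W - card (cutv E W) = h" using cardW cardH kW by simp
      have girthH: "card (cutv E ?H) \<le> card S" if "S \<subseteq> ?H" "biconn E S" for S
      proof -
        have "card (cutv E W) \<le> card S" using that by (intro girth) auto
        then show ?thesis using kW by (simp add: k_def)
      qed
      have IH: "lolli_count h k \<le> 2 * ncs E ?H {}"
        "2 * ncs E ?H {} = lolli_count h k \<Longrightarrow> extremal_shape ?H k"
        using less.hyps[OF ltH finH cH ntH girthH] hk by (auto simp: k_def)
      have "?H - cutv E ?H = insert v (?H - cutv E ?H - {v})" using vH False by auto
      then have P: "card (?H - cutv E ?H - {v}) + 1 = h" unfolding h_def
        using finH by (metis Diff_insert_absorb Suc_eq_plus1 card_insert_disjoint finite_Diff insert_absorb Diff_iff singletonI)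
      have J: "card (cutv E ?H - {v}) = k" using False by (simp add: k_def)
      define p where "p = card (?H - cutv E ?H - {v})"
      then have p: "card (?H - cutv E ?H - {v}) = p" "h = p + 1" using P by simp_all
      have rb: "rooted_bound ?H v = 2 * (k + 1) + h * (h + 1)"
        using ntH J p by (simp add: rooted_bound_def Let_def algebra_simps)
      have N: "2 * (k + 1) + h * (h + 1) \<le> 2 * ncs E ?H {v}"
        using rooted_bound_le_ncs[OF finH cH vH] rb by simp
      \<comment> \<open>The increment is one leaf plus exactly the rooted bound at \<open>v\<close>;
        equality therefore forces equality in the induction hypothesis and in the rooted
        bound.\<close>
      have lc: "lolli_count h (k + 1) = lolli_count h k + 2 + (2 * (k + 1) + h * (h + 1))"
        by (simp add: lolli_count_def algebra_simps)
      have "extremal_shape W (k + 1)" if eq: "2 * ncs E W {} = lolli_count h (k + 1)"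
      proof -
        have eH: "2 * ncs E ?H {} = lolli_count h k" and eN: "2 * ncs E ?H {v} = rooted_bound ?H v"
          using eq lc F IH(1) N rb by linarith+
        have "\<exists>f. models E ?H (card ?H) (lolli_adj h) f"
        proof -
          have "card S \<noteq> k" if "S \<subseteq> ?H" "biconn E S" for S
          proof -
            have "card (cutv E W) \<le> card S" using that by (intro girth) auto
            then show ?thesis using kW by simp
          qed
          then show ?thesis using IH(2)[OF eH] hk unfolding extremal_shape_def by metis
        qed
        then obtain f0 where f0: "models E ?H (card ?H) (lolli_adj h) f0" by blast
        obtain S' where S': "S' \<subseteq> ?H" "biconn E S'" using ntH by (auto simp: nontree_def)
        then have h3: "3 \<le> h" using biconn_card_le_noncut[OF finH cH S'(2,1)] by (simp add: biconn_def h_def)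
        \<comment> \<open>\<open>v\<close> must carry the last label. On a cycle a rotation achieves
          this. With a tail, \<open>v\<close> is not the neighbour of the tail end, which is a cut
          vertex, and every other position is excluded by the surplus in
          \<open>leaf_rooted_step\<close>.\<close>
        obtain f where f: "models E ?H (card ?H) (lolli_adj h) f" "f (card ?H - 1) = v"
        proof (cases "k = 0")
          case True
          then have "card ?H = h" using cardH by simp
          then show ?thesis using models_rotate[of E ?H h f0 v] f0 vH h3 that by auto
        next
          case k0: False
          define m where "m = card ?H - 1"
          have m: "card ?H = Suc m" "h \<le> m" using cardH k0 by (auto simp: m_def)
          have br: "branch E ?H (f0 (m - 1)) {f0 m}"
            using lolli_branch[of ?H m h f0] f0 m h3 by simp
          have ne: "?H \<noteq> insert (f0 (m - 1)) {f0 m}"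
          proof
            assume "?H = insert (f0 (m - 1)) {f0 m}"
            moreover have "card {f0 (m - 1), f0 m} \<le> 2" by (simp add: card_insert_if)
            ultimately have "card ?H \<le> 2" by metis
            then show False using m h3 by simp
          qed
          have "v \<noteq> f0 (m - 1)" using branch_cut[OF br ne] False by auto
          moreover have "v = f0 m \<or> v = f0 (m - 1)"
          proof (rule ccontr)
            assume a: "\<not> ?thesis"
            have cH': "conn E (?H - {f0 m})" using branch_conn(1)[OF br cH] .
            have "rooted_bound (?H - {f0 m}) v \<le> 2 * ncs E (?H - {f0 m}) {v}"
              using rooted_bound_le_ncs[OF _ cH', of v] finH vH a by auto
            then have "rooted_bound ?H v + (if nontree E ?H then 2 else 0) \<le> 2 * ncs E ?H {v}"
              using leaf_rooted_step[OF finH cH br ne vH] a by auto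
            then show False using eN ntH by simp
          qed
          ultimately have "f0 (card ?H - 1) = v" using m by simp
          then show ?thesis using that f0 by blast
        qed
        have "0 < card ?H" using cardH h3 by simp
        then have "models E W (Suc (card ?H)) (pendant_adj (card ?H) (card ?H - 1) (lolli_adj h)) (f(card ?H := u))"
          using leaf_models_extend[OF leaf(2) con f(1), of "card ?H - 1"] f(2) by simp
        then have "models E W (Suc (card ?H)) (lolli_adj h) (f(card ?H := u))"
          by (rule models_cong) (use pendant_lolli[of h "card ?H"] cardH h3 in auto)
        then show ?thesis using cardW gW kW unfolding extremal_shape_def by auto
      qed
      then show ?thesis using kW gW lc F IH(1) N by auto
    next
      case True
      then have cWH: "cutv E W = cutv E ?H" unfolding cW by auto
      then have kW: "card (cutv E W) = k" by (simp add: k_def)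
      have gW: "card W - card (cutv E W) = h + 1" using cardW cardH kW by simp
      have girthH: "card (cutv E ?H) \<le> card S" if "S \<subseteq> ?H" "biconn E S" for S
      proof -
        have "card (cutv E W) \<le> card S" using that by (intro girth) auto
        then show ?thesis using cWH by simp
      qed
      have IH: "lolli_count h k \<le> 2 * ncs E ?H {}"
        "2 * ncs E ?H {} = lolli_count h k \<Longrightarrow> extremal_shape ?H k"
        using less.hyps[OF ltH finH cH ntH girthH] hk by (auto simp: k_def)
      obtain S' where S': "S' \<subseteq> ?H" "biconn E S'" using ntH by (auto simp: nontree_def)
      define t where "t = 2 * h + k * (h + 1)"
      have cb: "t \<le> ncs E ?H {v}"
        "ncs E ?H {v} = t \<Longrightarrow> h = k \<and> card S' = k \<and> (\<exists>x. branch E ?H v {x})"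
        unfolding t_def k_def h_def by (rule cut_leaf_bound[OF finH cH True S']; use girthH in blast)+
      have lc: "lolli_count (h + 1) k = lolli_count h k + 2 + 2 * t"
        by (simp add: lolli_count_def t_def algebra_simps)
      have "extremal_shape W k" if eq: "2 * ncs E W {} = lolli_count (h + 1) k"
      proof -
        have eH: "2 * ncs E ?H {} = lolli_count h k" and eN: "ncs E ?H {v} = t"
          using eq lc F IH(1) cb(1) by linarith+
        from cb(2)[OF eN] obtain x where hk2: "h = k" "card S' = k" and x: "branch E ?H v {x}" by blast
        have k3: "3 \<le> k" using S'(2) hk2 by (simp add: biconn_def)
        have cH2: "card ?H = 2 * k" using cardH hk2 by simp
        \<comment> \<open>Parity rules out the fork alternative for the smaller graph.\<close>
        then have "card ?H \<noteq> 2 * k + 1" by simp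
        then obtain f where f: "models E ?H (card ?H) (lolli_adj k) f"
          using IH(2)[OF eH] hk hk2 unfolding extremal_shape_def by metis
        have xH: "x \<in> ?H" using x by (auto simp: branch_def)
        obtain i where i: "i < 2 * k" "x = f i" using models_obtain[OF f xH] cH2 by metis
        obtain j where j: "j < 2 * k" "v = f j" using models_obtain[OF f vH] cH2 by metis
        have only: "lolli_adj k i l \<Longrightarrow> l = j" if l: "l < 2 * k" for l
        proof (rule ccontr)
          assume a: "lolli_adj k i l" "l \<noteq> j"
          then have "{x, f l} \<in> E" using models_edge[OF f, of i l] i l cH2 by simp
          moreover have "f l \<noteq> v" using models_inj[OF f, of l j] a j l cH2 by simp
          moreover have "f l \<noteq> x" using models_edge[OF f, of i l] a i l cH2 no_loop by auto
          moreover have "f l \<in> ?H" using models_mem[OF f, of l] l cH2 by simp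
          ultimately show False using x by (auto simp: branch_def)
        qed
        \<comment> \<open>The leaf \<open>x\<close> has degree one, and in the lollipop only the
          last label does. So \<open>v\<close> is the vertex before it, and the new leaf
          \<open>u\<close> creates the fork.\<close>
        have i': "i = 2 * k - 1"
        proof (rule ccontr)
          assume a: "i \<noteq> 2 * k - 1"
          then have s: "Suc i < 2 * k" using i by simp
          then have j1: "j = Suc i" using only[OF s] by (simp add: lolli_adj_def)
          show False
          proof (cases "i = 0")
            case True
            then have "k - 1 = j" using only[of "k - 1"] k3 by (simp add: lolli_adj_def)
            then show False using j1 True k3 by simp
          next
            case False
            then have "i - 1 = j" using only[of "i - 1"] s by (simp add: lolli_adj_def)
            then show False using j1 by simp
          qed
        qed
        then have "lolli_adj k i (2 * k - 2)" using k3 by (auto simp: lolli_adj_def)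
        then have j': "j = 2 * k - 2" using only[of "2 * k - 2"] k3 by simp
        have "models E W (Suc (card ?H)) (pendant_adj (card ?H) (2 * k - 2) (lolli_adj k)) (f(card ?H := u))"
          using leaf_models_extend[OF leaf(2) con f(1), of "2 * k - 2"] j j' cH2 by simp
        then have "models E W (card W) (fork_adj (2 * k) k) (f(card ?H := u))" using cH2 cardW by (simp add: fork_adj_def)
        moreover have "S' \<subseteq> W" using S' by auto
        ultimately show ?thesis unfolding extremal_shape_def using S'(2) hk2 cH2 cardW by auto
      qed
      then show ?thesis using kW gW lc F IH(1) cb(1) by auto
    qed
  qed
qed

end

section \<open>Counting in the extremal graphs\<close>

lemma models_conn:
  assumes "models E W n R f" "0 < n" "\<And>i. Suc i < n \<Longrightarrow> R i (Suc i)"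
  shows "conn E W"
  using assms
proof (induction n arbitrary: W)
  case (Suc n)
  show ?case
  proof (cases "n = 0")
    case True
    then have "W = {f 0}" using Suc.prems(1) by (auto simp: models_def bij_betw_def)
    then show ?thesis by simp
  next
    case False
    have "conn E (W - {f n})" by (rule Suc.IH[OF models_restrict[OF Suc.prems(1)]]) (use False Suc.prems(3) in auto)
    moreover have "f (n - 1) \<in> W - {f n}"
      using models_mem[OF Suc.prems(1), of "n - 1"] models_inj[OF Suc.prems(1), of "n - 1" n] False by auto
    moreover have "{f (n - 1), f n} \<in> E"
      using models_edge[OF Suc.prems(1), of "n - 1" n] Suc.prems(3)[of "n - 1"] False by simp
    ultimately have "conn E (insert (f n) (W - {f n}))" by (rule conn_insert)
    moreover have "f n \<in> W" using models_mem[OF Suc.prems(1)] by simp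
    ultimately show ?thesis by (simp add: insert_absorb)
  qed
qed simp

lemma lolli_conn: "models E W n (lolli_adj g) f \<Longrightarrow> 0 < n \<Longrightarrow> conn E W"
  by (erule models_conn) (auto simp: lolli_adj_def)

lemma models_rotate_by:
  assumes "models E W g (lolli_adj g) f" "2 \<le> g"
  shows "models E W g (lolli_adj g) (\<lambda>i. f ((i + c) mod g))"
proof (induction c)
  case 0
  show ?case
    using assms(1) unfolding models_def by (subst bij_betw_cong[of _ _ f]) auto
next
  case (Suc c)
  have "(Suc i mod g + c) mod g = (i + Suc c) mod g" for i by (simp add: mod_simps)
  then show ?case using models_rotate1[OF Suc assms(2)] by simp
qed

context edges
begin

lemma path_ncs:
  assumes "models E W n (lolli_adj 2) f" "2 \<le> n"
  shows "ncs E W {f (n - 1)} = n \<and> 2 * ncs E W {} = n * (n + 1)"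
  using assms(2,1)
proof (induction n arbitrary: W rule: nat_induct_at_least)
  case base
  have W: "W = {f 1, f 0}" using base by (auto simp: models_def bij_betw_def lessThan_nat_numeral lessThan_Suc)
  have e: "{f 1, f 0} \<in> E" "f 0 \<noteq> f 1"
    using models_edge[OF base, of 1 0] models_inj[OF base, of 0 1] by (auto simp: lolli_adj_def)
  have 1: "ncs E W {f 1} = 2" using ncs_edge[OF e] W by simp
  have "W - {f 1} = {f 0}" using W e by auto
  then have "ncs E W {} = 3" using ncs_split[of W "f 1" "{}" E] W 1 ncs_singleton[of "{}" "f 0"] by simp
  then show ?case using 1 by simp
next
  case (Suc n)
  have c: "conn E W" using lolli_conn[OF Suc.prems] by simp
  have fin: "finite W" using models_card[OF Suc.prems] by simp
  have br: "branch E W (f (n - 1)) {f n}" using lolli_branch[OF Suc.prems] Suc.hyps by simp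
  note IH = Suc.IH[OF models_restrict[OF Suc.prems]]
  show ?case using leaf_ncs(1,4)[OF fin c br] IH by simp
qed

lemma cycle_minus_edge:
  assumes "models E W g (lolli_adj g) f" "3 \<le> g"
  shows "models (E - {{f (g - 1), f 0}}) W g (lolli_adj 2) f"
proof -
  have "{f i, f j} \<in> E - {{f (g - 1), f 0}} \<longleftrightarrow> lolli_adj 2 i j" if ij: "i < g" "j < g" for i j
  proof -
    have "{f i, f j} = {f (g - 1), f 0} \<longleftrightarrow> (i = g - 1 \<and> j = 0) \<or> (i = 0 \<and> j = g - 1)"
      using models_inj[OF assms(1)] ij assms(2) by (auto simp: doubleton_eq_iff)
    then show ?thesis using models_edge[OF assms(1) ij] ij assms(2) by (auto simp: lolli_adj_def)
  qed
  then show ?thesis using assms(1) by (simp add: models_def)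
qed

text \<open>Every connected subgraph of a cycle other than the cycle itself has a last vertex in cyclic order.\<close>

lemma cycle_ncs_le:
  assumes m: "models E W g (lolli_adj g) f" and g: "3 \<le> g"
  shows "ncs E W {} \<le> g * g + 1"
proof -
  have fin: "finite W" using models_card[OF m] by simp
  define e where "e i = {f i, f (Suc i mod g)}" for i
  let ?S = "\<lambda>i. conn_subgraphs (E - {e i}) W {f i}"
  \<comment> \<open>Without the edge \<open>e i\<close> the cycle is a path ending in
    \<open>f i\<close>, and a path on \<open>g\<close> vertices has \<open>g\<close> connected
    subgraphs through an end.\<close>
  have cS: "card (?S i) = g" if i: "i < g" for i
  proof -
    define f' where "f' = (\<lambda>j. f ((j + Suc i) mod g))"
    have m': "models E W g (lolli_adj g) f'" unfolding f'_def by (rule models_rotate_by[OF m]) (use g in simp)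
    have "g - 1 + Suc i = i + g" using g by simp
    then have f': "f' (g - 1) = f i" "f' 0 = f (Suc i mod g)" using i by (simp_all add: f'_def)
    interpret E': edges "E - {e i}" by unfold_locales (use edge_card in auto)
    have "models (E - {e i}) W g (lolli_adj 2) f'" using cycle_minus_edge[OF m' g] f' by (simp add: e_def)
    from E'.path_ncs[OF this] show ?thesis using g f' by (simp add: ncs_def)
  qed
  have "conn_subgraphs E W {} \<subseteq> insert (W, E \<inter> Pow W) (\<Union>i<g. ?S i)"
  proof (rule subrelI)
    fix U D assume UD: "(U, D) \<in> conn_subgraphs E W {}"
    then have *: "U \<subseteq> W" "D \<subseteq> E" "D \<subseteq> Pow U" "conn D U" by (auto simp: conn_subgraphs_def)
    show "(U, D) \<in> insert (W, E \<inter> Pow W) (\<Union>i<g. ?S i)"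
    proof (cases "\<exists>i<g. f i \<in> U \<and> e i \<notin> D")
      case True
      then obtain i where "i < g" "f i \<in> U" "e i \<notin> D" by blast
      then have "(U, D) \<in> ?S i" using * by (auto simp: conn_subgraphs_def)
      then show ?thesis using \<open>i < g\<close> by blast
    next
      \<comment> \<open>No last vertex exists: each vertex of \<open>U\<close> has its successor
        edge in \<open>D\<close>, and going round collects all vertices and all edges.\<close>
      case False
      then have cl: "e i \<in> D" if "i < g" "f i \<in> U" for i using that by blast
      have nx: "f (Suc i mod g) \<in> U" if "i < g" "f i \<in> U" for i
        using cl[OF that] *(3) by (auto simp: e_def)
      obtain z where "z \<in> U" using conn_nonempty[OF *(4)] by blast
      moreover obtain i0 where i0: "i0 < g" "z = f i0" by (rule models_obtain[OF m, of z]) (use \<open>z \<in> U\<close> *(1) in auto)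
      ultimately have z: "f i0 \<in> U" by simp
      have all: "f ((i0 + t) mod g) \<in> U" for t
      proof (induction t)
        case 0
        then show ?case using z i0 by simp
      next
        case (Suc t)
        have "f (Suc ((i0 + t) mod g) mod g) \<in> U" using nx[OF _ Suc] g by simp
        then show ?case by (simp add: mod_Suc_eq)
      qed
      have in_U: "f j \<in> U" if j: "j < g" for j
      proof -
        have "i0 + (g - i0 + j) = j + g" using i0 by simp
        then have "(i0 + (g - i0 + j)) mod g = j" using j by simp
        then show ?thesis using all[of "g - i0 + j"] by simp
      qed
      have "U = W"
      proof
        show "W \<subseteq> U"
        proof
          fix y assume "y \<in> W"
          then obtain j where "j < g" "y = f j" using models_obtain[OF m] by metis
          then show "y \<in> U" using in_U by simp
        qed
      qed (use * in simp)
      moreover have "E \<inter> Pow W \<subseteq> D"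
      proof
        fix y assume y: "y \<in> E \<inter> Pow W"
        then obtain a b where ab: "y = {a, b}" using edge_card[of y] by (auto simp: card_2_iff)
        obtain i where i: "i < g" "a = f i" by (rule models_obtain[OF m, of a]) (use y ab in auto)
        obtain j where j: "j < g" "b = f j" by (rule models_obtain[OF m, of b]) (use y ab in auto)
        have "lolli_adj g i j" using models_edge[OF m i(1) j(1)] y ab i j by simp
        then have "y = e i \<or> y = e j" using lolli_cycle_adj[of g i j] i j ab g by (auto simp: e_def)
        then show "y \<in> D" using cl in_U i j by blast
      qed
      ultimately show ?thesis using * by auto
    qed
  qed
  then have "card (conn_subgraphs E W {}) \<le> card (insert (W, E \<inter> Pow W) (\<Union>i<g. ?S i))"
    using fin by (intro card_mono) auto
  also have "\<dots> \<le> Suc (card (\<Union>i<g. ?S i))" by (rule card_insert_le_m1) simp_all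
  also have "card (\<Union>i<g. ?S i) \<le> (\<Sum>i<g. card (?S i))" by (rule card_UN_le) simp
  also have "(\<Sum>i<g. card (?S i)) = g * g" using cS by simp
  finally show ?thesis by (simp add: ncs_def)
qed

lemma cycle_biconn:
  assumes m: "models E W g (lolli_adj g) f" and g: "3 \<le> g"
  shows "biconn E W"
proof -
  have "conn E (W - {v})" if v: "v \<in> W" for v
  proof -
    obtain f' where f': "models E W g (lolli_adj g) f'" "f' (g - 1) = v"
      using models_rotate[OF m _ v] g by auto
    have "models E (W - {f' (g - 1)}) (g - 1) (lolli_adj g) f'"
      using models_restrict[of E W "g - 1" "lolli_adj g" f'] f' g by simp
    then show ?thesis using lolli_conn g f' by fastforce
  qed
  then have "cutv E W = {}" by (auto simp: cutv_def)
  moreover have "conn E W" using lolli_conn[OF m] g by simp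
  ultimately show ?thesis using models_card[OF m] g by (simp add: biconn_def)
qed

text \<open>The upper bound is \<open>cycle_ncs_le\<close>, the lower one is the extremal bound
  itself for a graph without cut vertices. The rooted count is what remains after subtracting the
  path left by deleting a vertex.\<close>

lemma cycle_ncs:
  assumes m: "models E W g (lolli_adj g) f" and g: "3 \<le> g"
  shows "2 * ncs E W {} = lolli_count g 0" "2 * ncs E W {f (g - 1)} = g * (g + 1) + 2"
proof -
  have fin: "finite W" and cW: "card W = g" using models_card[OF m] by auto
  have B: "biconn E W" using cycle_biconn[OF m g] .
  then have "conn E W" "cutv E W = {}" "nontree E W" by (auto simp: biconn_def nontree_def)
  then have "lolli_count g 0 \<le> 2 * ncs E W {}" using lolli_count_le_ncs[OF fin, of] cW by simp
  then show 1: "2 * ncs E W {} = lolli_count g 0" using cycle_ncs_le[OF m g] by (simp add: lolli_count_def)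
  obtain p where p: "g = Suc p" "2 \<le> p" using g by (cases g) auto
  have "models E (W - {f p}) p (lolli_adj g) f" using models_restrict[of E W p "lolli_adj g" f] m p by simp
  then have "models E (W - {f p}) p (lolli_adj 2) f"
    by (rule models_cong) (use p in \<open>auto simp: lolli_adj_def\<close>)
  then have "2 * ncs E (W - {f p}) {} = p * (p + 1)" using path_ncs p by blast
  then show "2 * ncs E W {f (g - 1)} = g * (g + 1) + 2"
    using 1 ncs_split[OF fin, of "f p" "{}" E] p by (simp add: lolli_count_def)
qed

text \<open>Both counts go through one induction, since lengthening the tail adds the count rooted
  at its old end.\<close>

lemma lolli_ncs:
  assumes "models E W n (lolli_adj g) f" "3 \<le> g" "g \<le> n"
  shows "2 * ncs E W {} = lolli_count g (n - g) \<and> 2 * ncs E W {f (n - 1)} = 2 * (n - g) + g * (g + 1) + 2"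
  using assms(3,1)
proof (induction n arbitrary: W rule: nat_induct_at_least)
  case base
  then show ?case using cycle_ncs[OF base assms(2)] by simp
next
  case (Suc n)
  have c: "conn E W" using lolli_conn[OF Suc.prems] by simp
  have fin: "finite W" using models_card[OF Suc.prems] by simp
  have br: "branch E W (f (n - 1)) {f n}" using lolli_branch[OF Suc.prems] Suc.hyps assms(2) by simp
  note IH = Suc.IH[OF models_restrict[OF Suc.prems]]
  have k: "Suc n - g = (n - g) + 1" using Suc.hyps by simp
  have lc: "lolli_count g ((n - g) + 1) = lolli_count g (n - g) + 2 + (2 * (n - g) + g * (g + 1) + 2)"
    by (simp add: lolli_count_def algebra_simps)
  have "2 * ncs E W {} = 2 * ncs E (W - {f n}) {} + 2 + 2 * ncs E (W - {f n}) {f (n - 1)}"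
    using leaf_ncs(1)[OF fin c br] by simp
  then have "2 * ncs E W {} = lolli_count g (Suc n - g)" unfolding k lc using IH by simp
  moreover have "2 * ncs E W {f n} = 2 * (Suc n - g) + g * (g + 1) + 2"
    unfolding k using leaf_ncs(4)[OF fin c br] IH by simp
  ultimately show ?case by simp
qed

text \<open>Labels \<open>m - 1\<close> and \<open>m\<close> are twin leaves at
  \<open>m - 2\<close>. Removing one gives a lollipop; removing the other as well doubles the rooted
  count at their common neighbour.\<close>

lemma fork_ncs_eq:
  assumes "models E W (Suc m) (fork_adj m h) f" "2 \<le> h" "h < m"
  obtains H H' where "models E H m (lolli_adj h) f" "models E H' (m - 1) (lolli_adj h) f"
    "ncs E W {} = ncs E H {} + 1 + 2 * ncs E H' {f (m - 2)}"
proof -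
  let ?H = "W - {f m}"
  have "models E ?H m (fork_adj m h) f" using models_restrict[OF assms(1)] .
  then have mH: "models E ?H m (lolli_adj h) f" by (rule models_cong) (auto simp: fork_adj_def pendant_adj_def)
  have cH: "conn E ?H" using lolli_conn[OF mH] assms by simp
  obtain p where p: "m = Suc p" "h \<le> p" using assms(3) by (cases m) auto
  have m2: "m - 2 < m" using assms by simp
  have br: "branch E W (f (m - 2)) {f m}"
    by (rule pendant_branch[OF assms(1) m2]) (auto simp: fork_adj_def pendant_adj_def)
  have finH: "finite ?H" using models_card[OF mH] by simp
  have fin: "finite W" using models_card[OF assms(1)] by simp
  have "conn E (insert (f m) ?H)"
    by (rule conn_insert[OF cH, of "f (m - 2)"])
      (use br models_edge[OF assms(1), of "m - 2" m] m2 in \<open>auto simp: branch_def fork_adj_def pendant_adj_def\<close>)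
  moreover have "insert (f m) ?H = W" using models_mem[OF assms(1), of m] by auto
  ultimately have c: "conn E W" by simp
  have brH: "branch E ?H (f (m - 2)) {f p}" using lolli_branch[of ?H p h f] mH p assms(2) by (simp add: numeral_2_eq_2)
  have "models E (?H - {f p}) p (lolli_adj h) f" using models_restrict[of E ?H p] mH p by simp
  moreover have "ncs E W {} = ncs E ?H {} + 1 + 2 * ncs E (?H - {f p}) {f (m - 2)}"
    using leaf_ncs(1)[OF fin c br] leaf_ncs(3)[OF finH cH brH] by simp
  ultimately show ?thesis using that[OF mH, of "?H - {f p}"] p by simp
qed

lemma fork_ncs:
  assumes "models E W (2 * k + 1) (fork_adj (2 * k) k) f" "3 \<le> k"
  shows "2 * ncs E W {} = lolli_count (k + 1) k"
proof -
  obtain H H' where H: "models E H (2 * k) (lolli_adj k) f" and H': "models E H' (2 * k - 1) (lolli_adj k) f"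
    and N: "ncs E W {} = ncs E H {} + 1 + 2 * ncs E H' {f (2 * k - 2)}"
    by (rule fork_ncs_eq[of W "2 * k" k f]) (use assms in auto)
  have 1: "2 * ncs E H {} = lolli_count k k" using lolli_ncs[OF H] assms(2) by simp
  have e: "2 * k - 1 - 1 = 2 * k - 2" "2 * k - 1 - k = k - 1" by auto
  have 2: "2 * ncs E H' {f (2 * k - 2)} = 2 * (k - 1) + k * (k + 1) + 2"
    using lolli_ncs[OF H' assms(2)] assms(2) unfolding e by simp
  have "2 * ncs E W {} = lolli_count k k + 2 + 2 * (2 * (k - 1) + k * (k + 1) + 2)" using N 1 2 by simp
  moreover obtain j where "k = Suc j" using assms(2) by (cases k) auto
  ultimately show ?thesis by (simp add: lolli_count_def algebra_simps)
qed

text \<open>The degenerate fork for \<open>k = 2\<close>: its cycle of length two is a single edge,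
  so it is a tree on five vertices.\<close>

lemma small_fork_ncs:
  assumes "models E W 5 (fork_adj 4 2) f"
  shows "ncs E W {} = 17"
proof -
  obtain H H' where H: "models E H 4 (lolli_adj 2) f" and H': "models E H' 3 (lolli_adj 2) f"
    and N: "ncs E W {} = ncs E H {} + 1 + 2 * ncs E H' {f 2}"
    by (rule fork_ncs_eq[of W 4 2 f]) (use assms in auto)
  have "ncs E H {} = 10" using path_ncs[OF H] by simp
  moreover have "ncs E H' {f 2} = 3" using path_ncs[OF H'] by simp
  ultimately show ?thesis using N by simp
qed

end

section \<open>Transfer to symmetric digraphs\<close>

definition uedges :: "'a rel \<Rightarrow> 'a set set" where
  "uedges A = (\<lambda>(u, v). {u, v}) ` A"

lemma uedges_iff: "{u, v} \<in> uedges A \<longleftrightarrow> (u, v) \<in> A \<or> (v, u) \<in> A"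
  by (auto simp: uedges_def doubleton_eq_iff image_iff split: prod.splits)

lemma uedges_mono: "A \<subseteq> B \<Longrightarrow> uedges A \<subseteq> uedges B"
  by (auto simp: uedges_def)

lemma symcl_uedges: "(u, v) \<in> symcl A \<longleftrightarrow> {u, v} \<in> uedges A"
  by (auto simp: symcl_def uedges_iff)

text \<open>A walk from \<open>A\<close> to a vertex outside must cross the boundary of
  \<open>A\<close>; conversely the set of vertices reachable from \<open>u\<close> would be a cut
  without crossing edges.\<close>

lemma connected_iff_conn: "connected G \<longleftrightarrow> conn (uedges (arcs_ends G)) (verts G)"
proof
  assume c: "connected G"
  show "conn (uedges (arcs_ends G)) (verts G)"
  proof (rule connI)
    show "verts G \<noteq> {}" using c by (simp add: connected_conv)
    fix A assume A: "A \<subseteq> verts G" "A \<noteq> {}" "A \<noteq> verts G"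
    then obtain u v where u: "u \<in> A" and v: "v \<in> verts G" "v \<notin> A" by blast
    have "(u, v) \<in> rtrancl_on (verts G) (symcl (arcs_ends G))" using c u v A by (auto simp: connected_conv)
    then have "v \<in> A \<or> (\<exists>a\<in>A. \<exists>b\<in>verts G - A. {a, b} \<in> uedges (arcs_ends G))"
    proof (induction rule: rtrancl_on_induct)
      case base
      then show ?case using u by simp
    next
      case (step y z)
      then have "{y, z} \<in> uedges (arcs_ends G)" by (simp add: symcl_uedges)
      then show ?case using step by (cases "z \<in> A") auto
    qed
    then show "\<exists>a\<in>A. \<exists>b\<in>verts G - A. {a, b} \<in> uedges (arcs_ends G)" using v by blast
  qed
next
  assume c: "conn (uedges (arcs_ends G)) (verts G)"
  let ?R = "rtrancl_on (verts G) (symcl (arcs_ends G))"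
  have "(u, v) \<in> ?R" if uv: "u \<in> verts G" "v \<in> verts G" for u v
  proof (rule ccontr)
    assume n: "(u, v) \<notin> ?R"
    let ?A = "{x \<in> verts G. (u, x) \<in> ?R}"
    have ne: "?A \<noteq> verts G" using n uv by auto
    obtain a b where ab: "a \<in> ?A" "b \<in> verts G - ?A" "{a, b} \<in> uedges (arcs_ends G)"
      by (rule conn_crossing[OF c _ _ ne]) (use uv in auto)
    then have ab': "(u, a) \<in> ?R" "(a, b) \<in> symcl (arcs_ends G)" "b \<in> verts G" by (simp_all add: symcl_uedges)
    then have "(u, b) \<in> ?R" by (rule rtrancl_on_into_rtrancl_on)
    then show False using ab(2) by simp
  qed
  then show "connected G" using conn_nonempty[OF c] by (simp add: connected_conv)
qed

lemma pair_graph_iff: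
  "pair_graph G \<longleftrightarrow> parcs G \<subseteq> pverts G \<times> pverts G \<and> finite (pverts G) \<and> sym (parcs G) \<and> irrefl (parcs G)"
proof
  assume "pair_graph G"
  then interpret pair_graph G .
  show "parcs G \<subseteq> pverts G \<times> pverts G \<and> finite (pverts G) \<and> sym (parcs G) \<and> irrefl (parcs G)"
    using wellformed' pair_finite_verts pair_sym_arcs pair_no_loops
    by (fastforce simp: symmetric_def irrefl_def)
next
  assume *: "parcs G \<subseteq> pverts G \<times> pverts G \<and> finite (pverts G) \<and> sym (parcs G) \<and> irrefl (parcs G)"
  then have "finite (parcs G)" using finite_subset by blast
  then show "pair_graph G" using * by unfold_locales (auto simp: symmetric_def irrefl_def)
qed

context
  fixes G :: "'a pair_pre_digraph"
  assumes G: "pair_graph G"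
begin

lemma parcs_uedges: "{u, v} \<in> uedges (parcs G) \<longleftrightarrow> (u, v) \<in> parcs G"
  using G by (auto simp: uedges_iff pair_graph_iff dest: symD)

lemma uedges_edges: "edges (uedges (parcs G))"
proof
  fix e assume "e \<in> uedges (parcs G)"
  then obtain u v where "e = {u, v}" "(u, v) \<in> parcs G" by (auto simp: uedges_def)
  moreover from this have "u \<noteq> v" using G by (auto simp: pair_graph_iff irrefl_def)
  ultimately show "card e = 2" by simp
qed

lemma connected_pair_iff: "connected (with_proj G) \<longleftrightarrow> conn (uedges (parcs G)) (pverts G)"
  by (simp add: connected_iff_conn)

lemma cut_vertex_iff: "cut_vertex G v \<longleftrightarrow> v \<in> cutv (uedges (parcs G)) (pverts G)"
proof -
  let ?D = "pre_digraph.del_vert (with_proj G) v"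
  have v: "verts ?D = pverts G - {v}" by (simp add: pre_digraph.del_vert_def)
  have a: "arcs_ends ?D = {(x, y) \<in> parcs G. x \<noteq> v \<and> y \<noteq> v}"
    by (auto simp: pre_digraph.del_vert_def arcs_ends_conv image_iff)
  have "conn (uedges (arcs_ends ?D)) (verts ?D) \<longleftrightarrow> conn (uedges (parcs G)) (pverts G - {v})"
    unfolding v by (rule conn_cong) (auto simp: a uedges_iff)
  then show ?thesis by (simp add: cut_vertex_def cutv_def connected_iff_conn)
qed

text \<open>A symmetric arc relation is recovered from its unordered edges, and a set of two-element
  edges from its symmetric arcs, so subgraphs of either kind correspond one to one.\<close>

lemma num_connected_subgraphs_ncs:
  "num_connected_subgraphs G = ncs (uedges (parcs G)) (pverts G) {}"
proof -
  let ?X = "{H :: 'a pair_pre_digraph.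
       pair_graph H \<and> subgraph (with_proj H) (with_proj G) \<and> connected (with_proj H)}"
  let ?f = "\<lambda>H :: 'a pair_pre_digraph. (pverts H, uedges (parcs H))"
  let ?g = "\<lambda>(U, D). \<lparr>pverts = U, parcs = {(u, v). {u, v} \<in> D}\<rparr> :: 'a pair_pre_digraph"
  interpret edges "uedges (parcs G)" by (rule uedges_edges)
  have wf: "wf_digraph (with_proj H) \<longleftrightarrow> parcs H \<subseteq> pverts H \<times> pverts H" for H :: "'a pair_pre_digraph"
    by (auto simp: wf_digraph_def)
  have sub: "subgraph (with_proj H) (with_proj G) \<longleftrightarrow> pverts H \<subseteq> pverts G \<and> parcs H \<subseteq> parcs G"
    if "pair_graph H" for H :: "'a pair_pre_digraph"
    using that G by (auto simp: subgraph_def wf compatible_def pair_graph_iff)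
  have con: "connected (with_proj H) \<longleftrightarrow> conn (uedges (parcs H)) (pverts H)" for H :: "'a pair_pre_digraph"
    by (simp add: connected_iff_conn)
  have gD: "uedges {(u, v). {u, v} \<in> D} = D" if D: "D \<subseteq> uedges (parcs G)" for D
  proof
    show "uedges {(u, v). {u, v} \<in> D} \<subseteq> D" by (auto simp: uedges_def)
    show "D \<subseteq> uedges {(u, v). {u, v} \<in> D}"
    proof
      fix e assume e: "e \<in> D"
      then have "card e = 2" using D edge_card by auto
      then obtain u v where "e = {u, v}" by (auto simp: card_2_iff)
      then show "e \<in> uedges {(u, v). {u, v} \<in> D}" using e by (simp add: uedges_iff)
    qed
  qed
  have "bij_betw ?f ?X (conn_subgraphs (uedges (parcs G)) (pverts G) {})"
  proof (rule bij_betw_byWitness[where f' = ?g])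
    show "\<forall>H\<in>?X. ?g (?f H) = H"
    proof
      fix H assume "H \<in> ?X"
      then have "sym (parcs H)" by (simp add: pair_graph_iff)
      then have "{(u, v). {u, v} \<in> uedges (parcs H)} = parcs H" by (auto simp: uedges_iff dest: symD)
      then show "?g (?f H) = H" by simp
    qed
    show "\<forall>p\<in>conn_subgraphs (uedges (parcs G)) (pverts G) {}. ?f (?g p) = p"
      using gD by (auto simp: conn_subgraphs_def)
    show "?f ` ?X \<subseteq> conn_subgraphs (uedges (parcs G)) (pverts G) {}"
    proof (rule image_subsetI)
      fix H assume "H \<in> ?X"
      then have H: "pair_graph H" "pverts H \<subseteq> pverts G" "parcs H \<subseteq> parcs G" "conn (uedges (parcs H)) (pverts H)"
        using sub con by auto
      moreover have "uedges (parcs H) \<subseteq> Pow (pverts H)" using H(1) by (auto simp: uedges_def pair_graph_iff)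
      ultimately show "?f H \<in> conn_subgraphs (uedges (parcs G)) (pverts G) {}"
        using uedges_mono[OF H(3)] by (auto simp: conn_subgraphs_def)
    qed
    show "?g ` conn_subgraphs (uedges (parcs G)) (pverts G) {} \<subseteq> ?X"
    proof (rule image_subsetI)
      fix p assume p: "p \<in> conn_subgraphs (uedges (parcs G)) (pverts G) {}"
      obtain U D where UD: "p = (U, D)" by (cases p)
      have *: "U \<subseteq> pverts G" "D \<subseteq> uedges (parcs G)" "D \<subseteq> Pow U" "conn D U"
        using p UD by (auto simp: conn_subgraphs_def)
      have fin: "finite U" using * G finite_subset by (auto simp: pair_graph_iff)
      have pg: "pair_graph (?g p)"
        unfolding pair_graph_iff using * fin no_loop by (auto simp: UD sym_def irrefl_def insert_commute)
      have "parcs (?g p) \<subseteq> parcs G" using * parcs_uedges by (auto simp: UD)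
      then show "?g p \<in> ?X" using pg sub[OF pg] con[of "?g p"] * gD[OF *(2)] by (simp add: UD)
    qed
  qed
  then show ?thesis unfolding num_connected_subgraphs_def ncs_def by (rule bij_betw_same_card)
qed

end

section \<open>Cycles as arc lists and two-connected vertex sets\<close>

lemma biconn_mono: "biconn D S \<Longrightarrow> D \<subseteq> E \<Longrightarrow> biconn E S"
  unfolding biconn_def cutv_def using conn_mono by blast

lemma pcas_nth:
  assumes "pcas u p v" "Suc i < length p"
  shows "fst (p ! Suc i) = snd (p ! i)"
  using assms
proof (induction p arbitrary: u i)
  case (Cons e p)
  show ?case
  proof (cases i)
    case 0
    then show ?thesis using Cons.prems by (cases p) auto
  next
    case (Suc j)
    then show ?thesis using Cons.IH[of "snd e" j] Cons.prems by simp
  qed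
qed simp

lemma pcas_last: "pcas u p v \<Longrightarrow> p \<noteq> [] \<Longrightarrow> snd (last p) = v \<and> fst (hd p) = u"
  by (induction p arbitrary: u) auto

lemma tl_pawalk_verts: "pcas u p v \<Longrightarrow> tl (pawalk_verts u p) = map snd p"
proof (induction p arbitrary: u)
  case (Cons e p)
  then show ?case by (cases p) auto
qed simp

text \<open>The edges of the cycle alone form a labelled cycle \<open>D\<close>, which is
  two-connected by \<open>cycle_biconn\<close>. Chords in the full edge set only help.\<close>

lemma graph_cycle_nontree:
  assumes G: "pair_graph G" and p: "graph_cycle G p"
  shows "nontree (uedges (parcs G)) (pverts G)"
proof -
  interpret pair_graph G by (rule G)
  let ?E = "uedges (parcs G)"
  obtain u where u: "pcas u p u" "set p \<subseteq> parcs G" "distinct (tl (pawalk_verts u p))" and l: "3 \<le> length p"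
    using p unfolding graph_cycle_def by (auto simp: cycle_def awalk_def)
  define m where "m = length p"
  have m3: "3 \<le> m" using l by (simp add: m_def)
  define f where "f i = snd (p ! i)" for i
  have d: "distinct (map snd p)" using u(3) tl_pawalk_verts[OF u(1)] by simp
  have inj: "f i = f j \<longleftrightarrow> i = j" if "i < m" "j < m" for i j
    using d that by (simp add: f_def m_def distinct_conv_nth) metis
  have step: "(f i, f (Suc i mod m)) \<in> parcs G" if i: "i < m" for i
  proof -
    have "fst (p ! (Suc i mod m)) = f i"
    proof (cases "Suc i = m")
      case True
      have ne: "p \<noteq> []" using m3 by (auto simp: m_def)
      have "i = length p - 1" using True by (simp add: m_def)
      then have "last p = p ! i" using ne by (simp add: last_conv_nth)
      then show ?thesis using pcas_last[OF u(1) ne] True ne by (simp add: f_def hd_conv_nth)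
    next
      case False
      then show ?thesis using pcas_nth[OF u(1), of i] i by (simp add: f_def m_def)
    qed
    moreover have "Suc i mod m < m" using m3 by (intro mod_less_divisor) simp
    then have "Suc i mod m < length p" by (simp add: m_def)
    then have "p ! (Suc i mod m) \<in> parcs G" using u(2) nth_mem by blast
    ultimately show ?thesis by (metis f_def prod.collapse)
  qed
  define D where "D = (\<lambda>i. {f i, f (Suc i mod m)}) ` {..<m}"
  have DE: "D \<subseteq> ?E" using step by (auto simp: D_def uedges_iff)
  interpret D: edges D using DE edges.edge_card[OF uedges_edges[OF G]] by unfold_locales auto
  let ?S = "f ` {..<m}"
  have bij: "bij_betw f {..<m} ?S" using inj by (auto simp: bij_betw_def inj_on_def)
  have "{f i, f j} \<in> D \<longleftrightarrow> lolli_adj m i j" if ij: "i < m" "j < m" for i j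
  proof -
    have "{f i, f j} = {f a, f (Suc a mod m)} \<longleftrightarrow> (i = a \<and> j = Suc a mod m) \<or> (j = a \<and> i = Suc a mod m)" if "a < m" for a
      using inj ij that m3 by (auto simp: doubleton_eq_iff)
    then have "{f i, f j} \<in> D \<longleftrightarrow> Suc i mod m = j \<or> Suc j mod m = i"
      unfolding D_def image_iff using ij by (metis lessThan_iff)
    then show ?thesis using lolli_cycle_adj[of m i j] ij m3 by simp
  qed
  then have "models D ?S m (lolli_adj m) f" using bij by (simp add: models_def)
  then have "biconn ?E ?S" using D.cycle_biconn m3 biconn_mono[OF _ DE] by blast
  moreover have "?S \<subseteq> pverts G" using step G by (auto simp: pair_graph_iff)
  ultimately show ?thesis by (auto simp: nontree_def)
qed

lemma pcas_map: "pcas (f a) (map (\<lambda>j. (f j, f (Suc j))) [a..<a + n]) (f (a + n))"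
  by (induction n arbitrary: a) (simp_all add: upt_conv_Cons del: upt_Suc, metis add_Suc)

lemma graph_cycleI:
  assumes G: "pair_graph G" and n: "3 \<le> n" and inj: "inj_on f {..<n}" and cl: "f n = f 0"
    and step: "\<And>j. j < n \<Longrightarrow> (f j, f (Suc j)) \<in> parcs G"
  shows "graph_cycle G (map (\<lambda>j. (f j, f (Suc j))) [0..<n])"
proof -
  interpret pair_graph G by (rule G)
  let ?p = "map (\<lambda>j. (f j, f (Suc j))) [0..<n]"
  have c: "pcas (f 0) ?p (f 0)" using pcas_map[of f 0 n] cl by simp
  have "f 0 \<in> pverts G" using step[of 0] n G by (auto simp: pair_graph_iff)
  moreover have "set ?p \<subseteq> parcs G" using step by auto
  moreover have "distinct (map (\<lambda>j. f (Suc j)) [0..<n])"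
  proof -
    have "f (Suc i) \<noteq> f (Suc j)" if "i < j" "j < n" for i j
    proof (cases "Suc j = n")
      case True
      then show ?thesis using inj_onD[OF inj, of "Suc i" 0] that cl by auto
    next
      case False
      then show ?thesis using inj_onD[OF inj, of "Suc i" "Suc j"] that by auto
    qed
    then have "inj_on (\<lambda>j. f (Suc j)) {..<n}" by (intro linorder_inj_onI) (auto simp: lessThan_iff)
    then show ?thesis by (simp add: distinct_map atLeast0LessThan)
  qed
  then have "distinct (tl (pawalk_verts (f 0) ?p))" unfolding tl_pawalk_verts[OF c] by (simp add: comp_def)
  ultimately show ?thesis unfolding graph_cycle_def cycle_def awalk_def using c n by auto
qed

text \<open>The first vertex of a longest path in a block has two neighbours on that path.\<close>

lemma biconn_graph_cycle:
  assumes G: "pair_graph G" and S: "biconn (uedges (parcs G)) S" "S \<subseteq> pverts G"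
  shows "\<exists>p. graph_cycle G p \<and> length p \<le> card S"
proof -
  let ?E = "uedges (parcs G)"
  have fin: "finite S" using S(1) by (metis biconn_def card.infinite not_numeral_le_zero)
  let ?P = "\<lambda>xs. xs \<noteq> [] \<and> distinct xs \<and> set xs \<subseteq> S \<and> (\<forall>i. Suc i < length xs \<longrightarrow> {xs ! i, xs ! Suc i} \<in> ?E)"
  have bound: "length xs \<le> card S" if "?P xs" for xs
    using that card_mono[OF fin, of "set xs"] by (simp add: distinct_card)
  obtain z where "z \<in> S" using S(1) conn_nonempty unfolding biconn_def by blast
  then have "?P [z]" by simp
  moreover have "\<forall>xs. ?P xs \<longrightarrow> length xs < Suc (card S)" using bound by (auto simp: less_Suc_eq_le)
  ultimately obtain xs where xs: "?P xs" and mx: "\<And>ys. ?P ys \<Longrightarrow> length ys \<le> length xs"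
    using ex_has_greatest_nat[of ?P "[z]" length "Suc (card S)"] by blast
  have x0: "xs ! 0 \<in> S" using xs by (metis length_greater_0_conv nth_mem subsetD)
  have on: "y \<in> set xs" if y: "y \<in> S" "{xs ! 0, y} \<in> ?E" for y
  proof (rule ccontr)
    assume n: "y \<notin> set xs"
    have "?P (y # xs)"
      using xs y n by (auto simp: nth_Cons' insert_commute) (metis Suc_pred insert_commute)+
    then show False using mx[of "y # xs"] by simp
  qed
  obtain y z where yz: "y \<in> S" "z \<in> S" "y \<noteq> z" "y \<noteq> xs ! 0" "z \<noteq> xs ! 0" "{xs ! 0, y} \<in> ?E" "{xs ! 0, z} \<in> ?E"
    using biconn_two_neighbours[OF S(1) x0] by blast
  obtain i j where i: "i < length xs" "y = xs ! i" and j: "j < length xs" "z = xs ! j"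
    using on yz by (metis in_set_conv_nth)
  have "i \<noteq> 0" "j \<noteq> 0" "i \<noteq> j" using yz(3-5) i j by metis+
  \<comment> \<open>Two different nonzero positions cannot both be \<open>1\<close>, so one
    neighbour closes up a prefix of at least three vertices.\<close>
  then obtain l where l: "2 \<le> l" "l < length xs" "{xs ! 0, xs ! l} \<in> ?E"
  proof (cases "2 \<le> i")
    case True
    then show ?thesis using that[of i] i yz by simp
  next
    case False
    then have "2 \<le> j" using \<open>i \<noteq> 0\<close> \<open>j \<noteq> 0\<close> \<open>i \<noteq> j\<close> by simp
    then show ?thesis using that[of j] j yz by simp
  qed
  define f where "f = (\<lambda>t. if t = Suc l then xs ! 0 else xs ! t)"
  have "graph_cycle G (map (\<lambda>t. (f t, f (Suc t))) [0..<Suc l])"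
  proof (rule graph_cycleI[OF G])
    show "3 \<le> Suc l" using l by simp
    show "inj_on f {..<Suc l}" using xs l by (auto simp: inj_on_def f_def nth_eq_iff_index_eq)
    show "f (Suc l) = f 0" by (simp add: f_def)
    fix t assume t: "t < Suc l"
    show "(f t, f (Suc t)) \<in> parcs G"
    proof (cases "t = l")
      case True
      then have "{f t, f (Suc t)} \<in> ?E" using l by (simp add: f_def insert_commute)
      then show ?thesis by (simp add: parcs_uedges[OF G])
    next
      case False
      then have "{f t, f (Suc t)} \<in> ?E" using xs t l by (simp add: f_def)
      then show ?thesis by (simp add: parcs_uedges[OF G])
    qed
  qed
  moreover have "Suc l \<le> card S" using l bound[OF xs] by simp
  ultimately show ?thesis by (intro exI[of _ "map (\<lambda>t. (f t, f (Suc t))) [0..<Suc l]"]) simp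
qed

section \<open>Isomorphisms and the graphs \<open>L\<close> and \<open>Q\<close>\<close>

text \<open>The counterpart of \<open>models\<close> for arcs. It presupposes no symmetry, so that
  \<open>pair_graph\<close> can be derived from it for the graphs \<open>L\<close> and
  \<open>Q\<close>.\<close>

definition arc_models :: "'a pair_pre_digraph \<Rightarrow> nat \<Rightarrow> (nat \<Rightarrow> nat \<Rightarrow> bool) \<Rightarrow> (nat \<Rightarrow> 'a) \<Rightarrow> bool" where
  "arc_models G n R f \<longleftrightarrow> bij_betw f {..<n} (pverts G) \<and> (\<forall>i<n. \<forall>j<n. (f i, f j) \<in> parcs G \<longleftrightarrow> R i j)"

lemma arc_models_iff:
  "pair_graph G \<Longrightarrow> arc_models G n R f \<longleftrightarrow> models (uedges (parcs G)) (pverts G) n R f"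
  by (simp add: arc_models_def models_def parcs_uedges)

lemma arc_models_pair_graph:
  assumes "arc_models G n R f" "parcs G \<subseteq> pverts G \<times> pverts G"
    and "\<And>i j. R i j \<Longrightarrow> R j i" "\<And>i. \<not> R i i"
  shows "pair_graph G"
proof -
  have ex: "\<exists>i<n. x = f i" if "x \<in> pverts G" for x using assms(1) that by (auto simp: arc_models_def bij_betw_def)
  have "finite (pverts G)" using assms(1) bij_betw_finite by (auto simp: arc_models_def)
  moreover have "(y, x) \<in> parcs G \<and> x \<noteq> y" if xy: "(x, y) \<in> parcs G" for x y
  proof -
    have "x \<in> pverts G" "y \<in> pverts G" using xy assms(2) by auto
    then obtain i j where ij: "i < n" "x = f i" "j < n" "y = f j" using ex by blast
    then have "R i j" using xy assms(1) by (simp add: arc_models_def)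
    then have "R j i" "i \<noteq> j" using assms(3,4) by auto
    then show ?thesis using ij assms(1) by (auto simp: arc_models_def bij_betw_def inj_on_def)
  qed
  ultimately show ?thesis using assms(2) by (auto simp: pair_graph_iff sym_def irrefl_def)
qed

lemma arc_models_iso:
  assumes "arc_models G n R f" "arc_models X n R f'" "pair_graph G" "pair_graph X"
  shows "digraph_iso (with_proj G) (with_proj X)"
proof -
  define \<phi> where "\<phi> = f' \<circ> the_inv_into {..<n} f"
  have f: "bij_betw f {..<n} (pverts G)" and f': "bij_betw f' {..<n} (pverts X)"
    using assms by (auto simp: arc_models_def)
  then have bij: "bij_betw \<phi> (pverts G) (pverts X)"
    unfolding \<phi>_def using bij_betw_the_inv_into bij_betw_trans by blast
  have \<phi>: "\<phi> (f i) = f' i" if "i < n" for i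
    using f that by (simp add: \<phi>_def bij_betw_def the_inv_into_f_f)
  have arcs: "map_prod \<phi> \<phi> ` parcs G = parcs X"
  proof
    show "map_prod \<phi> \<phi> ` parcs G \<subseteq> parcs X"
    proof (rule image_subsetI)
      fix e assume e: "e \<in> parcs G"
      then have "fst e \<in> f ` {..<n}" "snd e \<in> f ` {..<n}" using f assms(3) by (auto simp: pair_graph_iff bij_betw_def)
      then obtain i j where "e = (f i, f j)" "i < n" "j < n" by (cases e) auto
      then show "map_prod \<phi> \<phi> e \<in> parcs X" using e assms(1,2) by (auto simp: arc_models_def \<phi>)
    qed
    show "parcs X \<subseteq> map_prod \<phi> \<phi> ` parcs G"
    proof
      fix e assume e: "e \<in> parcs X"
      then have "fst e \<in> f' ` {..<n}" "snd e \<in> f' ` {..<n}" using f' assms(4) by (auto simp: pair_graph_iff bij_betw_def)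
      then obtain i j where ij: "e = (f' i, f' j)" "i < n" "j < n" by (cases e) auto
      then have "(f i, f j) \<in> parcs G" using e assms(1,2) by (auto simp: arc_models_def)
      then show "e \<in> map_prod \<phi> \<phi> ` parcs G" using ij \<phi> by (auto intro!: image_eqI[of _ _ "(f i, f j)"])
    qed
  qed
  let ?h = "\<lparr>iso_verts = \<phi>, iso_arcs = map_prod \<phi> \<phi>, iso_head = snd, iso_tail = fst\<rparr>"
  have sub: "parcs G \<subseteq> pverts G \<times> pverts G" using assms(3) by (simp add: pair_graph_iff)
  have inj: "inj_on \<phi> (pverts G)" using bij by (simp add: bij_betw_def)
  have "inj_on (map_prod \<phi> \<phi>) (parcs G)"
    using map_prod_inj_on[OF inj inj] sub inj_on_subset by blast
  moreover have "wf_digraph (with_proj G)" using sub by (auto simp: wf_digraph_def)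
  ultimately have "pre_digraph.digraph_isomorphism (with_proj G) ?h"
    using inj by (auto simp: pre_digraph.digraph_isomorphism_def)
  moreover have "with_proj X = app_iso ?h (with_proj G)"
    using bij arcs by (simp add: app_iso_def with_proj_def bij_betw_def)
  ultimately show ?thesis unfolding digraph_iso_def by blast
qed

lemma iso_arc_models:
  assumes "digraph_iso (with_proj G) (with_proj X)" "arc_models X n R f'" "pair_graph G"
  shows "\<exists>f. arc_models G n R f"
proof -
  obtain h where h: "pre_digraph.digraph_isomorphism (with_proj G) h" "with_proj X = app_iso h (with_proj G)"
    using assms(1) by (auto simp: digraph_iso_def)
  let ?\<phi> = "iso_verts h"
  have X: "pverts X = ?\<phi> ` pverts G" "parcs X = iso_arcs h ` parcs G" "fst = iso_tail h" "snd = iso_head h"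
    using h(2) by (auto simp: with_proj_def app_iso_def)
  have inj: "inj_on ?\<phi> (pverts G)"
    and a: "\<And>e. e \<in> parcs G \<Longrightarrow> iso_arcs h e = (?\<phi> (fst e), ?\<phi> (snd e))"
    using h(1) by (auto simp: pre_digraph.digraph_isomorphism_def X(3,4)[symmetric] prod_eq_iff)
  have sub: "parcs G \<subseteq> pverts G \<times> pverts G" using assms(3) by (simp add: pair_graph_iff)
  have bij: "bij_betw ?\<phi> (pverts G) (pverts X)" using inj X(1) by (simp add: bij_betw_def)
  have arc: "(x, y) \<in> parcs G \<longleftrightarrow> (?\<phi> x, ?\<phi> y) \<in> parcs X" if xy: "x \<in> pverts G" "y \<in> pverts G" for x y
  proof
    assume "(x, y) \<in> parcs G"
    then show "(?\<phi> x, ?\<phi> y) \<in> parcs X" using a[of "(x, y)"] X(2) by force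
  next
    assume "(?\<phi> x, ?\<phi> y) \<in> parcs X"
    then obtain e where e: "e \<in> parcs G" "iso_arcs h e = (?\<phi> x, ?\<phi> y)" using X(2) by auto
    then have "?\<phi> (fst e) = ?\<phi> x" "?\<phi> (snd e) = ?\<phi> y" using a[of e] by auto
    moreover have "fst e \<in> pverts G" "snd e \<in> pverts G" using e sub by auto
    ultimately have "fst e = x" "snd e = y" using inj xy by (auto dest: inj_onD)
    then show "(x, y) \<in> parcs G" using e by (cases e) auto
  qed
  let ?\<psi> = "the_inv_into (pverts G) ?\<phi>"
  have f': "bij_betw f' {..<n} (pverts X)" using assms(2) by (simp add: arc_models_def)
  then have b: "bij_betw (?\<psi> \<circ> f') {..<n} (pverts G)"
    using bij bij_betw_the_inv_into bij_betw_trans by blast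
  moreover have "(?\<psi> (f' i), ?\<psi> (f' j)) \<in> parcs G \<longleftrightarrow> R i j" if ij: "i < n" "j < n" for i j
  proof -
    have m: "?\<psi> (f' i) \<in> pverts G" "?\<psi> (f' j) \<in> pverts G" using b ij by (auto simp: bij_betw_def)
    have "?\<phi> (?\<psi> (f' i)) = f' i" "?\<phi> (?\<psi> (f' j)) = f' j"
      using f' ij bij by (auto simp: bij_betw_def intro!: f_the_inv_into_f)
    then show ?thesis using arc[OF m] assms(2) ij by (simp add: arc_models_def)
  qed
  ultimately show ?thesis by (intro exI[of _ "?\<psi> \<circ> f'"]) (simp add: arc_models_def)
qed

section \<open>Vertices, arcs and labellings of the identified graphs\<close>

lemma identify_verts_iff [simp]:
  "Inl x \<in> pverts (identify_verts G u H v) \<longleftrightarrow> x \<in> pverts G \<or> (x = u \<and> v \<in> pverts H)"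
  "Inr y \<in> pverts (identify_verts G u H v) \<longleftrightarrow> y \<in> pverts H \<and> y \<noteq> v"
  by (auto simp: identify_verts_def Let_def image_iff split: if_splits)

lemma identify_arcs_iff [simp]:
  "(Inl x, Inl x') \<in> parcs (identify_verts G u H v) \<longleftrightarrow> (x, x') \<in> parcs G \<or> (x = u \<and> x' = u \<and> (v, v) \<in> parcs H)"
  "(Inl x, Inr y) \<in> parcs (identify_verts G u H v) \<longleftrightarrow> x = u \<and> y \<noteq> v \<and> (v, y) \<in> parcs H"
  "(Inr y, Inl x) \<in> parcs (identify_verts G u H v) \<longleftrightarrow> x = u \<and> y \<noteq> v \<and> (y, v) \<in> parcs H"
  "(Inr y, Inr y') \<in> parcs (identify_verts G u H v) \<longleftrightarrow> y \<noteq> v \<and> y' \<noteq> v \<and> (y, y') \<in> parcs H"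
  by (auto simp: identify_verts_def Let_def image_iff split: if_splits prod.splits) force+

lemma identify_wf:
  assumes "parcs G \<subseteq> pverts G \<times> pverts G" "parcs H \<subseteq> pverts H \<times> pverts H"
  shows "parcs (identify_verts G u H v) \<subseteq> pverts (identify_verts G u H v) \<times> pverts (identify_verts G u H v)"
proof (rule subrelI)
  fix a b assume "(a, b) \<in> parcs (identify_verts G u H v)"
  then show "(a, b) \<in> pverts (identify_verts G u H v) \<times> pverts (identify_verts G u H v)"
    using assms by (cases a; cases b) auto
qed

lemma basic_graphs_wf:
  "parcs (path_graph m) \<subseteq> pverts (path_graph m) \<times> pverts (path_graph m)"
  "parcs (cycle_graph m) \<subseteq> pverts (cycle_graph m) \<times> pverts (cycle_graph m)"
  "parcs (star_graph m) \<subseteq> pverts (star_graph m) \<times> pverts (star_graph m)"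
  by (auto simp: path_graph_def cycle_graph_def star_graph_def)

lemma cycle_arc_iff:
  "2 \<le> g \<Longrightarrow> (i, j) \<in> parcs (cycle_graph g) \<longleftrightarrow> i < g \<and> j < g \<and> lolli_adj g i j"
  using lolli_cycle_adj[of g i j] by (auto simp: cycle_graph_def)

lemma lolli_adj_sym: "lolli_adj g i j \<Longrightarrow> lolli_adj g j i"
  by (auto simp: lolli_adj_def)

lemma lolli_adj_irrefl: "2 \<le> g \<Longrightarrow> \<not> lolli_adj g i i"
  by (auto simp: lolli_adj_def)

lemma fork_adj_sym: "fork_adj m h i j \<Longrightarrow> fork_adj m h j i"
  by (auto simp: fork_adj_def pendant_adj_def lolli_adj_def)

lemma fork_adj_irrefl: "2 \<le> h \<Longrightarrow> 2 \<le> m \<Longrightarrow> \<not> fork_adj m h i i"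
  by (auto simp: fork_adj_def pendant_adj_def lolli_adj_def)

text \<open>The labels run around the cycle, then along the path.\<close>

definition L_label :: "nat \<Rightarrow> nat \<Rightarrow> nat + nat" where
  "L_label g i = (if Suc i < g then Inr (Suc i) else Inl (Suc i - g))"

lemma L_graph_models:
  assumes g: "3 \<le> g" "g \<le> n"
  shows "arc_models (L_graph n g) n (lolli_adj g) (L_label g)"
proof -
  have "bij_betw (L_label g) {..<n} (pverts (L_graph n g))"
  proof (rule bij_betw_imageI)
    show "inj_on (L_label g) {..<n}" using g by (auto simp: inj_on_def L_label_def split: if_splits)
    have "x \<in> pverts (L_graph n g) \<longleftrightarrow> x \<in> L_label g ` {..<n}" for x
    proof
      assume x: "x \<in> pverts (L_graph n g)"
      show "x \<in> L_label g ` {..<n}"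
      proof (cases x)
        case (Inl a)
        then have "a < n - g + 1" using x by (auto simp: L_graph_def path_graph_def)
        then show ?thesis using Inl g by (intro image_eqI[of _ _ "a + g - 1"]) (auto simp: L_label_def)
      next
        case (Inr a)
        then have "a < g" "a \<noteq> 0" using x by (auto simp: L_graph_def cycle_graph_def)
        then show ?thesis using Inr g by (intro image_eqI[of _ _ "a - 1"]) (auto simp: L_label_def)
      qed
    next
      assume "x \<in> L_label g ` {..<n}"
      then show "x \<in> pverts (L_graph n g)"
        using g by (auto simp: L_label_def L_graph_def path_graph_def cycle_graph_def)
    qed
    then show "L_label g ` {..<n} = pverts (L_graph n g)" by blast
  qed
  moreover have "(L_label g i, L_label g j) \<in> parcs (L_graph n g) \<longleftrightarrow> lolli_adj g i j" if "i < n" "j < n" for i j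
    using that g by (auto simp: L_label_def L_graph_def cycle_arc_iff path_graph_def lolli_adj_def)
  ultimately show ?thesis by (simp add: arc_models_def)
qed

lemma L_graph_pair_graph:
  assumes "3 \<le> g" "g \<le> n" shows "pair_graph (L_graph n g)"
proof (rule arc_models_pair_graph[OF L_graph_models[OF assms]])
  show "parcs (L_graph n g) \<subseteq> pverts (L_graph n g) \<times> pverts (L_graph n g)"
    unfolding L_graph_def by (rule identify_wf[OF basic_graphs_wf(1,2)])
  show "\<not> lolli_adj g i i" for i using lolli_adj_irrefl assms by simp
qed (rule lolli_adj_sym)

lemma path_star_arcs [simp]:
  "(Inl i, Inl j) \<in> parcs (path_star k r) \<longleftrightarrow> i < k \<and> j < k \<and> (j = i + 1 \<or> i = j + 1)"
  "(Inl i, Inr y) \<in> parcs (path_star k r) \<longleftrightarrow> i = 0 \<and> y \<noteq> 0 \<and> y \<le> r"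
  "(Inr y, Inl i) \<in> parcs (path_star k r) \<longleftrightarrow> i = 0 \<and> y \<noteq> 0 \<and> y \<le> r"
  "(Inr y, Inr y') \<in> parcs (path_star k r) \<longleftrightarrow> False"
  by (auto simp: path_star_def path_graph_def star_graph_def)

lemma path_star_verts [simp]:
  "1 \<le> k \<Longrightarrow> Inl i \<in> pverts (path_star k r) \<longleftrightarrow> i < k"
  "Inr y \<in> pverts (path_star k r) \<longleftrightarrow> y \<noteq> 0 \<and> y \<le> r"
  by (auto simp: path_star_def path_graph_def star_graph_def)

text \<open>The cycle comes first, its glued vertex last with label \<open>h - 1\<close>. The path
  is then traversed backwards, from the neighbour of its glued end to the star centre with label
  \<open>h + k - 2\<close>, and the two leaves get the last labels.\<close>

definition Q_label :: "nat \<Rightarrow> nat \<Rightarrow> nat \<Rightarrow> nat + (nat + nat)" where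
  "Q_label h k i = (if Suc i < h then Inl (Suc i) else if Suc i = h then Inl 0
     else if Suc i < h + k then Inr (Inl (h + k - 2 - i)) else if Suc i = h + k then Inr (Inr 1) else Inr (Inr 2))"

lemma Q_graph_models:
  assumes hk: "2 \<le> h" "2 \<le> k"
  shows "arc_models (Q_graph (h + k + 1) k) (h + k + 1) (fork_adj (h + k) h) (Q_label h k)"
    (is "arc_models ?Q ?n _ _")
proof -
  have h: "h + k + 1 - k - 1 = h" by simp
  have "bij_betw (Q_label h k) {..<?n} (pverts ?Q)"
  proof (rule bij_betw_imageI)
    show "inj_on (Q_label h k) {..<?n}" using hk by (auto simp: inj_on_def Q_label_def split: if_splits)
    have "x \<in> pverts ?Q \<longleftrightarrow> x \<in> Q_label h k ` {..<?n}" for x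
    proof
      assume x: "x \<in> pverts ?Q"
      consider "x = Inl 0" | a where "x = Inl (Suc a)" | a where "x = Inr (Inl a)" | a where "x = Inr (Inr a)"
        by (metis not0_implies_Suc sum.exhaust)
      then show "x \<in> Q_label h k ` {..<?n}"
      proof cases
        case 1
        then show ?thesis using hk by (intro image_eqI[of _ _ "h - 1"]) (auto simp: Q_label_def)
      next
        case 2
        then have "Suc a < h" using x hk by (auto simp: Q_graph_def cycle_graph_def)
        then show ?thesis using 2 hk by (intro image_eqI[of _ _ a]) (auto simp: Q_label_def)
      next
        case 3
        then have "Suc a < k" using x hk by (auto simp: Q_graph_def)
        then show ?thesis using 3 hk by (intro image_eqI[of _ _ "h + k - 2 - a"]) (auto simp: Q_label_def)
      next
        case 4
        then have "a = 1 \<or> a = 2" using x hk by (auto simp: Q_graph_def)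
        then show ?thesis
        proof
          assume "a = 1"
          then show ?thesis using 4 hk by (intro image_eqI[of _ _ "h + k - 1"]) (auto simp: Q_label_def)
        next
          assume "a = 2"
          then show ?thesis using 4 hk by (intro image_eqI[of _ _ "h + k"]) (auto simp: Q_label_def)
        qed
      qed
    next
      assume "x \<in> Q_label h k ` {..<?n}"
      then show "x \<in> pverts ?Q" using hk by (auto simp: Q_label_def Q_graph_def cycle_graph_def)
    qed
    then show "Q_label h k ` {..<?n} = pverts ?Q" by blast
  qed
  moreover have "(Q_label h k i, Q_label h k j) \<in> parcs ?Q \<longleftrightarrow> fork_adj (h + k) h i j" if "i < ?n" "j < ?n" for i j
  proof -
    have cases: "Suc i < h \<or> Suc i = h \<or> (h \<le> i \<and> Suc i < h + k) \<or> Suc i = h + k \<or> i = h + k" if "i < ?n" for i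
      using that by linarith
    show ?thesis
      unfolding Q_graph_def h using cases[OF that(1)] cases[OF that(2)] hk
      by (elim disjE; auto simp: Q_label_def cycle_arc_iff fork_adj_def pendant_adj_def lolli_adj_def)
  qed
  ultimately show ?thesis by (simp add: arc_models_def)
qed

lemma Q_graph_pair_graph:
  assumes "2 \<le> h" "2 \<le> k" shows "pair_graph (Q_graph (h + k + 1) k)"
proof (rule arc_models_pair_graph[OF Q_graph_models[OF assms]])
  have "parcs (path_star k 2) \<subseteq> pverts (path_star k 2) \<times> pverts (path_star k 2)"
    unfolding path_star_def by (rule identify_wf[OF basic_graphs_wf(1,3)])
  from identify_wf[OF basic_graphs_wf(2) this]
  show "parcs (Q_graph (h + k + 1) k) \<subseteq> pverts (Q_graph (h + k + 1) k) \<times> pverts (Q_graph (h + k + 1) k)"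
    unfolding Q_graph_def .
qed (use assms fork_adj_sym fork_adj_irrefl in auto)

theorem theorem4p9:
  fixes G :: "'a pair_pre_digraph" and n k :: nat
  assumes "1 \<le> k" and "k + 3 \<le> n"
    and "G \<in> cut_family_girth_nontree n k k"
  shows "num_connected_subgraphs G \<ge> num_connected_subgraphs (L_graph n (n - k))
    \<and> (n \<noteq> 2 * k + 1 \<longrightarrow>
         (num_connected_subgraphs G = num_connected_subgraphs (L_graph n (n - k)) \<longleftrightarrow>
            digraph_iso (with_proj G) (with_proj (L_graph n (n - k)))))
    \<and> (n = 2 * k + 1 \<longrightarrow>
         (num_connected_subgraphs G = num_connected_subgraphs (L_graph n (n - k)) \<longleftrightarrow>
            digraph_iso (with_proj G) (with_proj (L_graph (2 * k + 1) (k + 1))) \<or>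
            digraph_iso (with_proj G) (with_proj (Q_graph (2 * k + 1) k))))"
proof -
  define g where "g = n - k"
  have g: "3 \<le> g" "g \<le> n" "n - g = k" using assms(1,2) by (auto simp: g_def)
  have G: "pair_graph G" and con: "connected (with_proj G)" and card: "card (pverts G) = n"
    and cut: "card {v. cut_vertex G v} = k" and girth: "enat k \<le> girth G" and nontree: "\<not> graph_tree G"
    using assms(3) by (auto simp: cut_family_girth_nontree_def cut_family_girth_def cut_family_def)
  let ?E = "uedges (parcs G)" and ?V = "pverts G"
  interpret edges ?E by (rule uedges_edges[OF G])
  have fin: "finite ?V" using G by (simp add: pair_graph_iff)
  have cV: "conn ?E ?V" using con by (simp add: connected_pair_iff[OF G])
  have k: "card (cutv ?E ?V) = k" using cut by (simp add: cut_vertex_iff[OF G])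
  obtain p where "graph_cycle G p" using nontree con by (auto simp: graph_tree_def)
  then have nt: "nontree ?E ?V" by (rule graph_cycle_nontree[OF G])
  \<comment> \<open>A two-connected set contains a cycle no longer than its size, so the girth
    bounds this size from below.\<close>
  have "card (cutv ?E ?V) \<le> card S" if S: "S \<subseteq> ?V" "biconn ?E S" for S
  proof -
    obtain p where p: "graph_cycle G p" "length p \<le> card S" using biconn_graph_cycle[OF G S(2,1)] by blast
    have "girth G \<le> enat (length p)" unfolding girth_def using p(1) by (intro INF_lower) simp
    then have "k \<le> length p" using girth by (metis enat_ord_simps(1) order_trans)
    then show ?thesis using p(2) k by simp
  qed
  from lolli_count_le_ncs[OF fin cV nt this]
  have lower: "lolli_count g k \<le> 2 * num_connected_subgraphs G"
    and shape: "2 * num_connected_subgraphs G = lolli_count g k \<Longrightarrow> extremal_shape ?V k"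
    unfolding k card num_connected_subgraphs_ncs[OF G] by (simp_all add: g_def)
  note mL = L_graph_models[OF g(1,2)] and pL = L_graph_pair_graph[OF g(1,2)]
  have FL: "2 * num_connected_subgraphs (L_graph n g) = lolli_count g k"
    using edges.lolli_ncs[OF uedges_edges[OF pL] mL[unfolded arc_models_iff[OF pL]] g(1,2)] g(3)
    by (simp add: num_connected_subgraphs_ncs[OF pL])
  have L_eq: "2 * num_connected_subgraphs G = lolli_count g k" if iso: "digraph_iso (with_proj G) (with_proj (L_graph n g))"
  proof -
    obtain f where "arc_models G n (lolli_adj g) f" using iso_arc_models[OF iso mL G] by blast
    then show ?thesis using lolli_ncs[of ?V n g f] g
      by (simp add: arc_models_iff[OF G] num_connected_subgraphs_ncs[OF G])
  qed
  have L_iso: "digraph_iso (with_proj G) (with_proj (L_graph n g))" if "models ?E ?V n (lolli_adj g) f" for f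
    using arc_models_iso[OF _ mL G pL] that by (simp add: arc_models_iff[OF G])
  show ?thesis
  proof (cases "n = 2 * k + 1")
    case False
    then have "extremal_shape ?V k \<Longrightarrow> digraph_iso (with_proj G) (with_proj (L_graph n g))"
      using L_iso card unfolding extremal_shape_def g_def by auto
    then show ?thesis using lower shape FL L_eq False unfolding g_def[symmetric] by auto
  next
    case True
    then have gk: "g = k + 1" and k2: "2 \<le> k" using assms(2) by (auto simp: g_def)
    have n: "n = k + k + 1" "k + k = 2 * k" using True by auto
    note mQ = Q_graph_models[OF k2 k2, folded n(1), unfolded n(2)] and pQ = Q_graph_pair_graph[OF k2 k2, folded n(1)]
    have Q_iso: "digraph_iso (with_proj G) (with_proj (Q_graph n k))" if "models ?E ?V n (fork_adj (2 * k) k) f" for f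
      using arc_models_iso[OF _ mQ G pQ] that by (simp add: arc_models_iff[OF G])
    have Q_eq: "2 * num_connected_subgraphs G = lolli_count g k" if iso: "digraph_iso (with_proj G) (with_proj (Q_graph n k))"
    proof -
      obtain f where "arc_models G n (fork_adj (2 * k) k) f" using iso_arc_models[OF iso mQ G] by blast
      then have f: "models ?E ?V n (fork_adj (2 * k) k) f" by (simp add: arc_models_iff[OF G])
      show ?thesis
      proof (cases "k = 2")
        case k2: True
        then have "num_connected_subgraphs G = 17"
          using small_fork_ncs[of ?V f] f True by (simp add: num_connected_subgraphs_ncs[OF G])
        \<comment> \<open>A count of 17 contradicts the lower bound 27 for \<open>G\<close>, so this
          isomorphism cannot occur.\<close>
        then show ?thesis using lower gk k2 by (simp add: lolli_count_def)
      next
        case False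
        then show ?thesis using fork_ncs[of ?V k f] f True k2 gk by (simp add: num_connected_subgraphs_ncs[OF G])
      qed
    qed
    have "extremal_shape ?V k \<Longrightarrow> digraph_iso (with_proj G) (with_proj (L_graph n g)) \<or>
        digraph_iso (with_proj G) (with_proj (Q_graph n k))"
      using L_iso Q_iso card unfolding extremal_shape_def g_def by auto
    then have "num_connected_subgraphs G = num_connected_subgraphs (L_graph n g) \<longleftrightarrow>
        digraph_iso (with_proj G) (with_proj (L_graph n g)) \<or> digraph_iso (with_proj G) (with_proj (Q_graph n k))"
      using shape FL L_eq Q_eq by auto
    then show ?thesis using lower FL True gk unfolding g_def[symmetric] by simp
  qed
qed

end
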